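(* For any trinity with color classes $V,E,R$, let $\varphi_{V\to E}\colon \mathrm{Pic}^0(D_V)\to\mathrm{Pic}^0(D_E)$ be defined by $\varphi_{V\to E}([x])=[y]$, where $(x,\mathbf{0},\mathbf{0})\approx_W(\mathbf{0},-y,\mathbf{0})$ (with $x\in\mathrm{Div}^0(D_V)$, $y\in\mathrm{Div}^0(D_E)$). Then $\varphi_{V\to E}$ is well-defined and is an isomorphism between $\mathrm{Pic}^0(D_V)$ and $\mathrm{Pic}^0(D_E)$.
   Context: Trinities. A trinity is a triangulation of the oriented sphere $S^2$ (multiple edges between the same two points are allowed) together with a coloring of its points ($0$-simplices) with three colors, red, emerald and violet, such that points joined by an edge have different colors. The sets of red, emerald and violet points are $R$, $E$, $V$. Each edge is colored with the color not occurring among its ends. A triangle is white if its red, emerald and violet nodes follow each other in clockwise order, and black otherwise; triangles sharing an edge have different colors. $D_V$ is the digraph on $V$ having, for each violet edge, one directed edge from the violet node of the black triangle containing that violet edge to the violet node of the white triangle containing it. $D_E$ (on $E$, using emerald edges) is defined analogously: for each emerald edge, a directed edge from the emerald node of the black triangle containing it to the emerald node of the white triangle containing it. These digraphs are connected and Eulerian. Sandpile groups. For an Eulerian digraph $D$ with vertex set $W$, $\mathrm{Div}(D)=\mathbb{Z}^W$, $\deg(x)=\sum_{w\in W}x(w)$, and $\mathrm{Div}^0(D)$ is the set of $x$ with $\deg(x)=0$. Let $d(u,v)$ be the number of edges from $u$ to $v$ and $d^+(v)$ the outdegree. $L_D\in\mathbb{Z}^{W\times W}$ has entries $L_D(u,v)=d(v,u)$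 for $u\ne v$ and $L_D(v,v)=d(v,v)-d^+(v)$. Write $x\sim y$ if $y=x+L_Dz$ for some $z\in\mathbb{Z}^W$; $[x]$ is the class of $x$. The sandpile group is $\mathrm{Pic}^0(D)=\mathrm{Div}^0(D)/\sim$. White triangle equivalence. $\mathcal{A}$ is the free Abelian group on $V\cup E\cup R$, with elements written as triples $(x_V,x_E,x_R)$, $x_V\in\mathbb{Z}^V$, $x_E\in\mathbb{Z}^E$, $x_R\in\mathbb{Z}^R$. Two elements of $\mathcal{A}$ are white triangle equivalent ($\approx_W$) if their difference is an integer linear combination of characteristic vectors of white triangles (the characteristic vector of a triangle is $1$ on its three nodes and $0$ elsewhere). *)

theory Defs
  imports
    "HOL-Complex_Analysis.Complex_Analysis"
    "HOL-Algebra.Product_Groups"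
    "Graph_Theory.Digraph"
begin

section \<open>Triangulations of the sphere\<close>

type_synonym point = "real^3"

type_synonym edge = "real \<Rightarrow> point"

type_synonym triangle = "complex \<Rightarrow> point"

abbreviation S2 :: "point set"
  where "S2 \<equiv> sphere 0 1"

definition std_corners :: "complex set"
  where "std_corners = {0, 1, \<i>}"

definition std_triangle :: "complex set"
  where "std_triangle = convex hull std_corners"

definition open_edge :: "edge \<Rightarrow> point set"
  where "open_edge g = g ` {0<..<1}"

definition open_triangle :: "triangle \<Rightarrow> point set"
  where "open_triangle \<sigma> = \<sigma> ` interior std_triangle"

text \<open>
  A triangulation is a finite cell decomposition of the sphere into points, open edges and open
  triangles, given by characteristic maps, in which the sides of the triangles are edges. The
  intersection of two closed cells may consist of several faces, so multiple edges between two
  points, and different triangles with the same nodes, are allowed. The characteristic maps are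
  injective on the closed cells; for the triangulations used below this is no restriction, as the
  ends of an edge (and hence the three nodes and the three sides of a triangle) have different
  colors. Since each cell occurs only once, the direction of the arc representing an edge and the
  parametrization of a triangle are irrelevant choices.
\<close>

definition sphere_triangulation :: "point set \<Rightarrow> edge set \<Rightarrow> triangle set \<Rightarrow> bool"
  where "sphere_triangulation P Ed Tr \<longleftrightarrow>
    finite P \<and> finite Ed \<and> finite Tr \<and>
    P \<subseteq> S2 \<and>
    (\<forall>g\<in>Ed. arc g \<and> path_image g \<subseteq> S2 \<and> pathstart g \<in> P \<and> pathfinish g \<in> P) \<and>
    (\<forall>\<sigma>\<in>Tr. continuous_on std_triangle \<sigma> \<and> inj_on \<sigma> std_triangle \<and> \<sigma> ` std_triangle \<subseteq> S2 \<and>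
       (\<forall>p\<in>std_corners. \<forall>q\<in>std_corners. p \<noteq> q \<longrightarrow>
          (\<exists>g\<in>Ed. path_image g = \<sigma> ` closed_segment p q \<and>
                  {pathstart g, pathfinish g} = {\<sigma> p, \<sigma> q}))) \<and>
    disjoint_family_on open_edge Ed \<and>
    disjoint_family_on open_triangle Tr \<and>
    P \<inter> (\<Union>g\<in>Ed. open_edge g) = {} \<and>
    P \<inter> (\<Union>\<sigma>\<in>Tr. open_triangle \<sigma>) = {} \<and>
    (\<Union>g\<in>Ed. open_edge g) \<inter> (\<Union>\<sigma>\<in>Tr. open_triangle \<sigma>) = {} \<and>
    S2 = P \<union> (\<Union>g\<in>Ed. open_edge g) \<union> (\<Union>\<sigma>\<in>Tr. open_triangle \<sigma>)"


section \<open>Trinities\<close>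

record trinity_data =
  red :: "point set"
  emerald :: "point set"
  violet :: "point set"
  edges :: "edge set"
  triangles :: "triangle set"

definition trinity :: "trinity_data \<Rightarrow> bool"
  where "trinity T \<longleftrightarrow>
    sphere_triangulation (red T \<union> emerald T \<union> violet T) (edges T) (triangles T) \<and>
    red T \<inter> emerald T = {} \<and> red T \<inter> violet T = {} \<and> emerald T \<inter> violet T = {} \<and>
    (\<forall>g\<in>edges T. \<forall>C\<in>{red T, emerald T, violet T}.
       \<not> (pathstart g \<in> C \<and> pathfinish g \<in> C))"

text \<open>
  In the following, a color is represented by its color class \<open>C\<close>.
\<close>

definition colored_edges :: "trinity_data \<Rightarrow> point set \<Rightarrow> edge set"
  where "colored_edges T C = {g \<in> edges T. pathstart g \<notin> C \<and> pathfinish g \<notin> C}"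

definition nodes :: "triangle \<Rightarrow> point set"
  where "nodes \<sigma> = \<sigma> ` std_corners"

definition corner :: "triangle \<Rightarrow> point set \<Rightarrow> complex"
  where "corner \<sigma> C = (THE z. z \<in> std_corners \<and> \<sigma> z \<in> C)"

definition node :: "triangle \<Rightarrow> point set \<Rightarrow> point"
  where "node \<sigma> C = \<sigma> (corner \<sigma> C)"

definition contains_edge :: "triangle \<Rightarrow> edge \<Rightarrow> bool"
  where "contains_edge \<sigma> g \<longleftrightarrow> path_image g \<subseteq> \<sigma> ` std_triangle"

text \<open>
  The loop running once around the triangle, from the red node via the emerald node and the
  violet node back to the red node.
\<close>

definition boundary_loop :: "trinity_data \<Rightarrow> triangle \<Rightarrow> real \<Rightarrow> point"
  where "boundary_loop T \<sigma> =
    \<sigma> \<circ> (linepath (corner \<sigma> (red T)) (corner \<sigma> (emerald T)) +++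
         linepath (corner \<sigma> (emerald T)) (corner \<sigma> (violet T)) +++
         linepath (corner \<sigma> (violet T)) (corner \<sigma> (red T)))"

text \<open>
  The line through two points \<open>a \<noteq> b\<close> of the sphere meets the sphere in no other point, so a closed
  path \<open>p\<close> on the sphere avoiding \<open>a\<close> and \<open>b\<close> has a winding number around this line. It is computed
  by projecting along the line to the plane spanned by \<open>u\<close> and \<open>v\<close>. As \<open>(u, v, a - b)\<close> is
  right-handed and \<open>a - b\<close> points out of the ball at \<open>a\<close>, it counts the counterclockwise turns of
  \<open>p\<close> around \<open>a\<close>, seen from outside the sphere, where \<open>b\<close> plays the role of the point at infinity.
  It does not depend on the choice of \<open>u\<close> and \<open>v\<close>.
\<close>

definition winds_around :: "(real \<Rightarrow> point) \<Rightarrow> point \<Rightarrow> point \<Rightarrow> int \<Rightarrow> bool"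
  where "winds_around p a b n \<longleftrightarrow>
    (\<exists>u v. cross3 u v = a - b \<and>
       winding_number (\<lambda>s. Complex ((p s - a) \<bullet> u) ((p s - a) \<bullet> v)) 0 = of_int n)"

text \<open>
  Clockwise means winding number \<open>-1\<close> around an interior point of the triangle, relative to a point
  outside of the triangle; the choice of the two points does not matter. The sphere is oriented by
  its outward normal.
\<close>

definition white :: "trinity_data \<Rightarrow> triangle \<Rightarrow> bool"
  where "white T \<sigma> \<longleftrightarrow>
    (\<exists>a \<in> open_triangle \<sigma>. \<exists>b \<in> S2 - \<sigma> ` std_triangle. winds_around (boundary_loop T \<sigma>) a b (-1))"

definition white_triangles :: "trinity_data \<Rightarrow> triangle set"
  where "white_triangles T = {\<sigma> \<in> triangles T. white T \<sigma>}"

definition black_triangles :: "trinity_data \<Rightarrow> triangle set"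
  where "black_triangles T = {\<sigma> \<in> triangles T. \<not> white T \<sigma>}"

definition white_at :: "trinity_data \<Rightarrow> edge \<Rightarrow> triangle"
  where "white_at T g = (THE \<sigma>. \<sigma> \<in> white_triangles T \<and> contains_edge \<sigma> g)"

definition black_at :: "trinity_data \<Rightarrow> edge \<Rightarrow> triangle"
  where "black_at T g = (THE \<sigma>. \<sigma> \<in> black_triangles T \<and> contains_edge \<sigma> g)"

definition color_digraph :: "trinity_data \<Rightarrow> point set \<Rightarrow> (point, edge) pre_digraph"
  where "color_digraph T C =
    \<lparr> verts = C,
      arcs = colored_edges T C,
      tail = (\<lambda>g. node (black_at T g) C),
      head = (\<lambda>g. node (white_at T g) C) \<rparr>"

definition D_V :: "trinity_data \<Rightarrow> (point, edge) pre_digraph"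
  where "D_V T = color_digraph T (violet T)"

definition D_E :: "trinity_data \<Rightarrow> (point, edge) pre_digraph"
  where "D_E T = color_digraph T (emerald T)"


section \<open>Sandpile groups\<close>

definition int_vectors :: "'a set \<Rightarrow> ('a \<Rightarrow> int) monoid"
  where "int_vectors W = product_group W (\<lambda>_. integer_group)"

definition Div :: "('a, 'b) pre_digraph \<Rightarrow> ('a \<Rightarrow> int) monoid"
  where "Div D = int_vectors (verts D)"

definition deg :: "('a, 'b) pre_digraph \<Rightarrow> ('a \<Rightarrow> int) \<Rightarrow> int"
  where "deg D x = (\<Sum>w\<in>verts D. x w)"

definition Div0 :: "('a, 'b) pre_digraph \<Rightarrow> ('a \<Rightarrow> int) monoid"
  where "Div0 D = (Div D)\<lparr>carrier := {x \<in> carrier (Div D). deg D x = 0}\<rparr>"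

definition edge_count :: "('a, 'b) pre_digraph \<Rightarrow> 'a \<Rightarrow> 'a \<Rightarrow> nat"
  where "edge_count D u v = card {e \<in> arcs D. tail D e = u \<and> head D e = v}"

definition laplacian :: "('a, 'b) pre_digraph \<Rightarrow> 'a \<Rightarrow> 'a \<Rightarrow> int"
  where "laplacian D u v =
    (if u = v then int (edge_count D v v) - int (out_degree D v) else int (edge_count D v u))"

definition laplacian_mult :: "('a, 'b) pre_digraph \<Rightarrow> ('a \<Rightarrow> int) \<Rightarrow> 'a \<Rightarrow> int"
  where "laplacian_mult D z = (\<lambda>u\<in>verts D. \<Sum>v\<in>verts D. laplacian D u v * z v)"

definition lin_equiv :: "('a, 'b) pre_digraph \<Rightarrow> ('a \<Rightarrow> int) \<Rightarrow> ('a \<Rightarrow> int) \<Rightarrow> bool"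
  where "lin_equiv D x y \<longleftrightarrow>
    (\<exists>z \<in> carrier (Div D). y = x \<otimes>\<^bsub>Div D\<^esub> laplacian_mult D z)"

definition div_class :: "('a, 'b) pre_digraph \<Rightarrow> ('a \<Rightarrow> int) \<Rightarrow> ('a \<Rightarrow> int) set"
  where "div_class D x = {y \<in> carrier (Div0 D). lin_equiv D x y}"

definition Pic0 :: "('a, 'b) pre_digraph \<Rightarrow> ('a \<Rightarrow> int) set monoid"
  where "Pic0 D = Div0 D Mod div_class D \<one>\<^bsub>Div0 D\<^esub>"


section \<open>White triangle equivalence\<close>

definition all_points :: "trinity_data \<Rightarrow> point set"
  where "all_points T = violet T \<union> emerald T \<union> red T"

definition triple ::
    "trinity_data \<Rightarrow> (point \<Rightarrow> int) \<Rightarrow> (point \<Rightarrow> int) \<Rightarrow> (point \<Rightarrow> int) \<Rightarrow> point \<Rightarrow> int"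
  where "triple T xV xE xR =
    (\<lambda>p\<in>all_points T. if p \<in> violet T then xV p else if p \<in> emerald T then xE p else xR p)"

definition white_equiv :: "trinity_data \<Rightarrow> (point \<Rightarrow> int) \<Rightarrow> (point \<Rightarrow> int) \<Rightarrow> bool"
  where "white_equiv T x y \<longleftrightarrow>
    x \<in> carrier (int_vectors (all_points T)) \<and> y \<in> carrier (int_vectors (all_points T)) \<and>
    (\<exists>c :: triangle \<Rightarrow> int. \<forall>p\<in>all_points T.
       x p - y p = (\<Sum>\<sigma>\<in>white_triangles T. c \<sigma> * indicator (nodes \<sigma>) p))"

definition phi_related :: "trinity_data \<Rightarrow> (point \<Rightarrow> int) \<Rightarrow> (point \<Rightarrow> int) \<Rightarrow> bool"
  where "phi_related T x y \<longleftrightarrow>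
    x \<in> carrier (Div0 (D_V T)) \<and> y \<in> carrier (Div0 (D_E T)) \<and>
    white_equiv T (triple T x (\<lambda>_. 0) (\<lambda>_. 0)) (triple T (\<lambda>_. 0) (\<lambda>p. - y p) (\<lambda>_. 0))"

definition phi :: "trinity_data \<Rightarrow> (point \<Rightarrow> int) set \<Rightarrow> (point \<Rightarrow> int) set"
  where "phi T X =
    (THE Y. \<exists>x y. phi_related T x y \<and> X = div_class (D_V T) x \<and> Y = div_class (D_E T) y)"

end

theory Submission
  imports Defs
begin

text \<open>
  Let \<open>\<partial>c\<close> (\<open>boundary c\<close> below) denote the sum of the characteristic vectors of the white triangles with integer
  coefficients \<open>c\<close>. The elements \<open>x\<close> and \<open>y\<close> are related by \<open>\<phi>\<close> iff some \<open>\<partial>c\<close> equals \<open>x\<close> on the violet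
  points, \<open>y\<close> on the emerald points and \<open>0\<close> on the red points. This relation is additive and treats
  violet and emerald alike, so everything follows from two facts about a color class \<open>C\<close>.

  Existence (\<open>degree_zero_is_boundary\<close>): every \<open>x\<close> of degree zero on \<open>C\<close> is the restriction of some \<open>\<partial>c\<close>
  that vanishes on a prescribed other class \<open>D\<close>. Two white triangles with the same node in \<open>D\<close> yield the
  difference of their nodes in \<open>C\<close>, and the triangles of the sphere form one piece under adjacency across
  edges (\<open>triangles_connected\<close>), because the sphere without finitely many points is connected.

  Exactness: the vectors \<open>\<partial>c\<close> supported on \<open>C\<close> are exactly the vectors \<open>L z\<close>, where \<open>L\<close> is the Laplacian of
  the digraph on \<open>C\<close>. White triangles correspond to the edges of color \<open>C\<close>, and \<open>L z\<close> arises from the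
  coefficients \<open>c\<close> assigning to an edge of color \<open>C\<close> the difference of \<open>z\<close> between the nodes in \<open>C\<close> of its
  black and its white triangle (\<open>laplacian_is_boundary\<close>); that \<open>\<partial>c\<close> vanishes on the other two classes is the
  fact that white and black triangles alternate around each point. Conversely, if \<open>\<partial>c\<close> vanishes off \<open>C\<close>, then
  \<open>c\<close> is a cycle of the plane graph formed by the edges of color \<open>C\<close>, whose faces contain the points of \<open>C\<close>.
  Its winding number around these points is an integer function \<open>z\<close>, which changes by \<open>c\<close> across
  an edge (\<open>cycles_are_coboundaries\<close>). This replaces the vanishing of the first homology of the sphere.
  Applying exactness first to violet and then to emerald, or in the other order, shows that \<open>x\<close> is
  principal iff \<open>y\<close> is (\<open>laplacian_transfer\<close>).

  The cells are merely continuous, so the geometric input needs some topology of the sphere. White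
  triangles are defined by winding numbers around secants of the sphere; in a stereographic chart such a number
  becomes a difference of two planar winding numbers (\<open>winding_around_line\<close>). With the Jordan curve
  theorem and invariance of domain this gives each triangle a well-defined orientation (\<open>cell_orientation\<close>).
  Two triangles sharing an edge have opposite orientations, since the shared edge cancels
  in the difference of their boundaries, so that the winding number of this difference does not jump there
  (\<open>opposite_orientations\<close>). At least two triangles contain a given edge, because arcs have empty
  interior; hence exactly one white and one black triangle contain it (\<open>white_black_at_edge\<close>).
\<close>

section \<open>Winding numbers of products and linear images\<close>

lemma winding_number_exp_loop:
  assumes q: "path q" and p: "\<And>t. t \<in> {0..1} \<Longrightarrow> p t = exp (q t)"
  shows "winding_number p 0 = (pathfinish q - pathstart q) / (2 * of_real pi * \<i>)"
proof -
  have "winding_number p 0 = winding_number (exp \<circ> q) 0"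
    by (rule winding_number_cong) (simp add: p)
  then show ?thesis
    using winding_number_compose_exp[OF q] by simp
qed

lemma nonvanishing_path_log:
  assumes "path p" "0 \<notin> path_image p"
  obtains q where "path q" "pathfinish q - pathstart q = 2 * of_real pi * \<i> * winding_number p 0"
    "\<And>t. t \<in> {0..1} \<Longrightarrow> p t = exp (q t)"
  using winding_number_as_continuous_log[OF assms] by (metis add_0)

lemma winding_number_mult:
  assumes "path p" "0 \<notin> path_image p" "path q" "0 \<notin> path_image q"
  shows "winding_number (\<lambda>t. p t * q t) 0 = winding_number p 0 + winding_number q 0"
proof -
  obtain f where f: "path f" "pathfinish f - pathstart f = 2 * of_real pi * \<i> * winding_number p 0"
    "\<And>t. t \<in> {0..1} \<Longrightarrow> p t = exp (f t)"
    using nonvanishing_path_log assms(1,2) by metis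
  obtain g where g: "path g" "pathfinish g - pathstart g = 2 * of_real pi * \<i> * winding_number q 0"
    "\<And>t. t \<in> {0..1} \<Longrightarrow> q t = exp (g t)"
    using nonvanishing_path_log assms(3,4) by metis
  have "winding_number (\<lambda>t. p t * q t) 0
      = (pathfinish (\<lambda>t. f t + g t) - pathstart (\<lambda>t. f t + g t)) / (2 * of_real pi * \<i>)"
    using f g by (intro winding_number_exp_loop) (auto simp: path_def exp_add intro!: continuous_intros)
  also have "\<dots> = (pathfinish f - pathstart f + (pathfinish g - pathstart g)) / (2 * of_real pi * \<i>)"
    by (simp add: pathfinish_def pathstart_def)
  also have "\<dots> = winding_number p 0 + winding_number q 0"
    unfolding f(2) g(2) by (simp add: field_simps)
  finally show ?thesis .
qed

lemma winding_number_cnj_loop: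
  assumes "path p" "0 \<notin> path_image p" "pathfinish p = pathstart p"
  shows "winding_number (\<lambda>t. cnj (p t)) 0 = - winding_number p 0"
proof -
  obtain f where f: "path f" "pathfinish f - pathstart f = 2 * of_real pi * \<i> * winding_number p 0"
    "\<And>t. t \<in> {0..1} \<Longrightarrow> p t = exp (f t)"
    using nonvanishing_path_log assms(1,2) by metis
  have "winding_number (\<lambda>t. cnj (p t)) 0
      = (pathfinish (\<lambda>t. cnj (f t)) - pathstart (\<lambda>t. cnj (f t))) / (2 * of_real pi * \<i>)"
    using f by (intro winding_number_exp_loop) (auto simp: path_def exp_cnj intro!: continuous_intros)
  also have "\<dots> = cnj (pathfinish f - pathstart f) / (2 * of_real pi * \<i>)"
    by (simp add: pathfinish_def pathstart_def)
  also have "\<dots> = - cnj (winding_number p 0)"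
    unfolding f(2) by (simp add: field_simps)
  also have "cnj (winding_number p 0) = winding_number p 0"
    using integer_winding_number[OF assms(1,3,2)] by (auto elim!: Ints_cases)
  finally show ?thesis .
qed

text \<open>
  A positive factor has a real logarithm, which returns to its initial value, so it does not turn.
\<close>

lemma winding_number_pos_factor:
  assumes "path p" "0 \<notin> path_image p" "pathfinish p = pathstart p"
    and "continuous_on {0..1} r" "\<And>t. t \<in> {0..1} \<Longrightarrow> r t > (0::real)" "r 0 = r 1"
  shows "winding_number (\<lambda>t. of_real (r t) * p t) 0 = winding_number p 0"
proof -
  have *: "winding_number (\<lambda>t. complex_of_real (r t)) 0 =
     (pathfinish (\<lambda>t. complex_of_real (ln (r t))) - pathstart (\<lambda>t. complex_of_real (ln (r t)))) / (2 * of_real pi * \<i>)"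
    using assms(4,5)
    by (intro winding_number_exp_loop) (force simp: path_def exp_of_real intro!: continuous_intros)+
  have "winding_number (\<lambda>t. of_real (r t) * p t) 0
      = winding_number (\<lambda>t. complex_of_real (r t)) 0 + winding_number p 0"
    using assms by (intro winding_number_mult)
     (force simp: path_def path_image_def intro!: continuous_intros)+
  then show ?thesis using * assms(6) by (simp add: pathfinish_def pathstart_def)
qed

lemma winding_number_mult_const:
  assumes "path p" "0 \<notin> path_image p" "k \<noteq> 0"
  shows "winding_number (\<lambda>t. k * p t) 0 = winding_number p 0"
proof -
  have "winding_number (\<lambda>t. k * p t) 0 = winding_number (\<lambda>t. k) 0 + winding_number p 0"
    using assms by (intro winding_number_mult) (auto simp: path_def path_image_def)
  moreover have "winding_number (\<lambda>t::real. k) 0 = 0"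
    using winding_number_exp_loop[of "\<lambda>t. Ln k" "\<lambda>t. k"] \<open>k \<noteq> 0\<close>
    by (simp add: path_def pathfinish_def pathstart_def)
  ultimately show ?thesis by simp
qed

text \<open>
  The map \<open>w \<mapsto> \<mu> w + \<nu> cnj w\<close> with \<open>|\<nu>| < |\<mu>|\<close> is the general orientation preserving linear isomorphism of
  the plane. The term with \<open>\<nu>\<close> is always shorter than the other one, so dropping it does not change the winding
  number, and the factor \<open>\<mu>\<close> is constant.
\<close>

lemma winding_number_linear_image:
  assumes p: "path p" "0 \<notin> path_image p" "pathfinish p = pathstart p"
    and less: "cmod \<nu> < cmod \<mu>"
  shows "winding_number (\<lambda>t. \<mu> * p t + \<nu> * cnj (p t)) 0 = winding_number p 0"
proof -
  have "winding_number (\<lambda>t. \<mu> * p t + \<nu> * cnj (p t)) 0 = winding_number (\<lambda>t. \<mu> * p t) 0"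
  proof (rule winding_number_nearby_loops_eq)
    show "path (\<lambda>t. \<mu> * p t)" "path (\<lambda>t. \<mu> * p t + \<nu> * cnj (p t))"
      using p(1) by (auto simp: path_def intro!: continuous_intros)
    show "cmod (\<mu> * p t + \<nu> * cnj (p t) - \<mu> * p t) < cmod (\<mu> * p t - 0)" if "t \<in> {0..1}" for t
    proof -
      have "p t \<noteq> 0" using p(2) that by (force simp: path_image_def)
      then show ?thesis using less by (simp add: norm_mult)
    qed
  qed (use p(3) in \<open>auto simp: pathfinish_def pathstart_def\<close>)
  also have "\<dots> = winding_number p 0"
    using p less by (intro winding_number_mult_const) auto
  finally show ?thesis .
qed

lemma det_pos_complex_form:
  fixes p q r s :: real
  assumes "p * s - q * r > 0"
  obtains \<mu> \<nu> where "cmod \<nu> < cmod \<mu>"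
    "\<And>x y. Complex (p * x + q * y) (r * x + s * y) = \<mu> * Complex x y + \<nu> * cnj (Complex x y)"
proof
  let ?m = "Complex ((p + s) / 2) ((r - q) / 2)" and ?n = "Complex ((p - s) / 2) ((r + q) / 2)"
  show "Complex (p * x + q * y) (r * x + s * y) = ?m * Complex x y + ?n * cnj (Complex x y)" for x y
    by (simp add: complex_eq_iff field_simps)
  have "(cmod ?m)\<^sup>2 - (cmod ?n)\<^sup>2 = p * s - q * r"
    unfolding cmod_power2 complex.sel by (simp add: power2_eq_square field_simps)
  then show "cmod ?n < cmod ?m"
    using assms by (smt (verit) norm_ge_zero power_mono)
qed

text \<open>
  Two pairs of vectors whose cross products are positive multiples of each other are bases of the same
  oriented plane.
\<close>

lemma cross_basis_change:
  fixes u v u0 v0 n :: "real^3"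
  assumes uv: "cross3 u v = n" and uv0: "cross3 u0 v0 = \<kappa> *\<^sub>R n" and k: "\<kappa> > 0" and n: "n \<noteq> 0"
  obtains p q r s where "p * s - q * r > 0" "u = p *\<^sub>R u0 + q *\<^sub>R v0" "v = r *\<^sub>R u0 + s *\<^sub>R v0"
proof -
  define tr :: "real^3 \<Rightarrow> real^3 \<Rightarrow> real^3 \<Rightarrow> real" where "tr a b c = cross3 a b \<bullet> c" for a b c
  \<comment> \<open>expansion of a fourth vector in terms of three given ones\<close>
  have id: "tr u0 v0 n *\<^sub>R w = tr w v0 n *\<^sub>R u0 + tr u0 w n *\<^sub>R v0 + tr u0 v0 w *\<^sub>R n" for w
    unfolding tr_def cross3_def inner_vec_def by (simp add: vec_eq_iff forall_3 sum_3, algebra)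
  define d where "d = tr u0 v0 n"
  have d: "d = \<kappa> * (n \<bullet> n)" unfolding d_def tr_def uv0 by simp
  have dpos: "d > 0" using d k n by simp
  have zu: "tr u0 v0 u = 0" unfolding tr_def uv0 uv[symmetric] by (simp add: dot_cross_self)
  have zv: "tr u0 v0 v = 0" unfolding tr_def uv0 uv[symmetric] by (simp add: dot_cross_self)
  have c: "w = (tr w v0 n / d) *\<^sub>R u0 + (tr u0 w n / d) *\<^sub>R v0" if "tr u0 v0 w = 0" for w
  proof -
    have "d *\<^sub>R w = d *\<^sub>R ((tr w v0 n / d) *\<^sub>R u0 + (tr u0 w n / d) *\<^sub>R v0)"
      using id[of w] that dpos unfolding d_def[symmetric] by (simp add: scaleR_add_right)
    then show ?thesis using dpos by (metis less_irrefl real_vector.scale_left_imp_eq)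
  qed
  define p q r s where "p = tr u v0 n / d" and "q = tr u0 u n / d" and "r = tr v v0 n / d" and "s = tr u0 v n / d"
  have u: "u = p *\<^sub>R u0 + q *\<^sub>R v0" and v: "v = r *\<^sub>R u0 + s *\<^sub>R v0"
    using c[OF zu] c[OF zv] unfolding p_def q_def r_def s_def by auto
  have "n = (p * s - q * r) *\<^sub>R cross3 u0 v0"
    unfolding uv[symmetric] unfolding u v by (simp add: cross3_def vec_eq_iff forall_3, algebra)
  then have "n = ((p * s - q * r) * \<kappa>) *\<^sub>R n"
    unfolding uv0 by simp
  then have "(p * s - q * r) * \<kappa> = 1"
    by (metis n scaleR_cancel_right scaleR_one)
  then have "p * s - q * r > 0"
    using k by (metis zero_less_mult_pos2 zero_less_one)
  then show ?thesis using u v that by blast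
qed

section \<open>Stereographic charts of the sphere\<close>

text \<open>
  The projection is from the south pole, because this makes the chart orientation preserving with
  respect to the outward normal: its plane has the basis of the first two axes, and at the north pole their cross
  product points outwards.
\<close>

definition stereo :: "real^3 \<Rightarrow> complex"
  where "stereo x = Complex (x $ 1 / (1 + x $ 3)) (x $ 2 / (1 + x $ 3))"

definition stereo_inv :: "complex \<Rightarrow> real^3"
  where "stereo_inv z = (1 / (1 + (cmod z)\<^sup>2)) *\<^sub>R vector [2 * Re z, 2 * Im z, 1 - (cmod z)\<^sup>2]"

abbreviation south :: "real^3"
  where "south \<equiv> - axis 3 1"

lemma inner_real3: "x \<bullet> y = x $ 1 * y $ 1 + x $ 2 * y $ 2 + x $ 3 * y $ 3" for x y :: "real^3"
  by (simp add: inner_vec_def sum_3)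

lemma S2_coordinates:
  fixes x :: point
  shows "x \<in> S2 \<longleftrightarrow> (x $ 1)\<^sup>2 + (x $ 2)\<^sup>2 + (x $ 3)\<^sup>2 = 1"
  by (simp add: norm_eq_1 inner_real3 power2_eq_square)

lemma S2_third_coordinate:
  fixes x :: point
  assumes "x \<in> S2" "x \<noteq> south"
  shows "1 + x $ 3 > 0"
proof -
  have e: "(x $ 1)\<^sup>2 + (x $ 2)\<^sup>2 + (x $ 3)\<^sup>2 = 1" using assms(1) S2_coordinates by blast
  then have "(x $ 3)\<^sup>2 \<le> 1" by (smt (verit) zero_le_power2)
  then have "x $ 3 \<ge> -1" by (simp add: abs_square_le_1 abs_le_iff)
  moreover have "x $ 3 \<noteq> -1"
  proof
    assume "x $ 3 = -1"
    then have "x = south" using e by (simp add: vec_eq_iff forall_3 axis_def)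
    then show False using assms by simp
  qed
  ultimately show ?thesis by simp
qed

lemma stereo_inv_nth:
  "stereo_inv z $ 1 = 2 * Re z / (1 + (cmod z)\<^sup>2)"
  "stereo_inv z $ 2 = 2 * Im z / (1 + (cmod z)\<^sup>2)"
  "stereo_inv z $ 3 = (1 - (cmod z)\<^sup>2) / (1 + (cmod z)\<^sup>2)"
  by (simp_all add: stereo_inv_def)

lemma one_plus_square_pos: "1 + (cmod z)\<^sup>2 > 0"
  by (simp add: add_pos_nonneg)

lemma stereo_inv_S2: "stereo_inv z \<in> S2 - {south}"
proof -
  have p: "1 + (cmod z)\<^sup>2 \<noteq> 0" using one_plus_square_pos[of z] by simp
  have "((2 * Re z)\<^sup>2 + (2 * Im z)\<^sup>2 + (1 - (cmod z)\<^sup>2)\<^sup>2) = (1 + (cmod z)\<^sup>2)\<^sup>2"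
    unfolding cmod_power2 by (simp add: power2_eq_square algebra_simps)
  then have "stereo_inv z \<in> S2"
    unfolding S2_coordinates stereo_inv_nth using p by (simp add: power_divide add_divide_distrib[symmetric])
  moreover have "stereo_inv z $ 3 \<noteq> -1"
    using p by (simp add: stereo_inv_nth field_simps)
  ultimately show ?thesis by (auto simp: axis_def)
qed

lemma stereo_inv_inverse: "stereo (stereo_inv z) = z"
proof -
  have p: "1 + (cmod z)\<^sup>2 \<noteq> 0" using one_plus_square_pos[of z] by simp
  then have "1 + stereo_inv z $ 3 = 2 / (1 + (cmod z)\<^sup>2)" by (simp add: stereo_inv_nth field_simps)
  then show ?thesis using p by (simp add: stereo_def stereo_inv_nth complex_eq_iff)
qed

lemma stereo_inverse:
  fixes x :: point
  assumes "x \<in> S2" "x \<noteq> south"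
  shows "stereo_inv (stereo x) = x"
proof -
  define h where "h = 1 + x $ 3"
  have h: "h > 0" unfolding h_def using S2_third_coordinate[OF assms] .
  have e: "(x $ 1)\<^sup>2 + (x $ 2)\<^sup>2 = h * (2 - h)"
    using assms(1) unfolding h_def S2_coordinates by (simp add: power2_eq_square algebra_simps)
  have "(cmod (stereo x))\<^sup>2 = ((x $ 1)\<^sup>2 + (x $ 2)\<^sup>2) / h\<^sup>2"
    by (simp add: cmod_power2 stereo_def h_def power_divide add_divide_distrib)
  also have "\<dots> = (2 - h) / h" unfolding e using h by (simp add: power2_eq_square)
  finally have c: "(cmod (stereo x))\<^sup>2 = (2 - h) / h" .
  then have d: "1 + (cmod (stereo x))\<^sup>2 = 2 / h" using h by (simp add: field_simps)
  have "1 - (cmod (stereo x))\<^sup>2 = x $ 3 * (2 / h)" using c h by (simp add: h_def field_simps)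
  then show ?thesis
    using h by (simp add: vec_eq_iff forall_3 stereo_inv_nth d) (simp add: stereo_def h_def)
qed

lemma homeomorphism_stereo: "homeomorphism (S2 - {south}) UNIV stereo stereo_inv"
proof (rule homeomorphismI)
  have "1 + x $ 3 \<noteq> 0" if "x \<in> S2 - {south}" for x :: "real^3"
    using S2_third_coordinate[of x] that by auto
  then show "continuous_on (S2 - {south}) stereo"
    unfolding stereo_def Complex_eq by (intro continuous_intros) auto
  have "1 + (cmod x)\<^sup>2 \<noteq> 0" for x using one_plus_square_pos[of x] by simp
  moreover have "continuous_on UNIV (\<lambda>z. vector [2 * Re z, 2 * Im z, 1 - (cmod z)\<^sup>2] :: real^3)"
    by (subst continuous_on_componentwise) (auto simp: Basis_vec_def inner_axis forall_3 exhaust_3 intro!: continuous_intros)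
  ultimately show "continuous_on UNIV stereo_inv"
    unfolding stereo_inv_def by (intro continuous_intros) auto
qed (use stereo_inverse stereo_inv_inverse stereo_inv_S2 in auto)

text \<open>
  The vectors \<open>u\<close> and \<open>v\<close> are chosen such that \<open>(x - a) \<bullet> u + \<i> (x - a) \<bullet> v\<close>, multiplied by the denominator
  \<open>1 + |z|\<^sup>2\<close> of the inverse chart, becomes a multiple of \<open>(z - \<alpha>) cnj (z - \<beta>)\<close>: both are real-quadratic in
  \<open>z\<close> with the same coefficients. The argument of the latter is that of the Moebius transformation with
  zero \<open>\<alpha>\<close> and pole \<open>\<beta>\<close>.
\<close>

lemma stereo_moebius:
  fixes \<alpha> \<beta> :: complex
  defines "u \<equiv> vector [Re \<alpha> + Re \<beta>, Im \<alpha> + Im \<beta>, 1 - Re \<alpha> * Re \<beta> - Im \<alpha> * Im \<beta>] :: point"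
    and "v \<equiv> vector [Im \<alpha> - Im \<beta>, Re \<beta> - Re \<alpha>, Re \<alpha> * Im \<beta> - Im \<alpha> * Re \<beta>] :: point"
  shows "cross3 u v = ((1 + (cmod \<alpha>)\<^sup>2) * (1 + (cmod \<beta>)\<^sup>2) / 2) *\<^sub>R (stereo_inv \<alpha> - stereo_inv \<beta>)"
    and "Complex ((stereo_inv z - stereo_inv \<alpha>) \<bullet> u) ((stereo_inv z - stereo_inv \<alpha>) \<bullet> v)
      = of_real (2 / (1 + (cmod z)\<^sup>2)) * (- ((z - \<alpha>) * cnj (z - \<beta>)))"
proof -
  define N where "N = (\<lambda>z. 1 + (cmod z)\<^sup>2)"
  define w :: "complex \<Rightarrow> point" where "w = (\<lambda>z. vector [2 * Re z, 2 * Im z, 1 - (cmod z)\<^sup>2])"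
  have N0: "N z \<noteq> 0" for z unfolding N_def using one_plus_square_pos[of z] by simp
  have si: "stereo_inv z = (1 / N z) *\<^sub>R w z" for z by (simp add: stereo_inv_def N_def w_def)
  have "cross3 u v = (1 / 2) *\<^sub>R (N \<beta> *\<^sub>R w \<alpha> - N \<alpha> *\<^sub>R w \<beta>)"
    unfolding u_def v_def w_def N_def cross3_def cmod_power2
    by (simp add: vec_eq_iff forall_3 power2_eq_square field_simps)
  also have "\<dots> = (N \<alpha> * N \<beta> / 2) *\<^sub>R (stereo_inv \<alpha> - stereo_inv \<beta>)"
    using N0 unfolding si by (simp add: algebra_simps)
  finally show "cross3 u v = ((1 + (cmod \<alpha>)\<^sup>2) * (1 + (cmod \<beta>)\<^sup>2) / 2) *\<^sub>R (stereo_inv \<alpha> - stereo_inv \<beta>)"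
    by (simp add: N_def)
  have "w \<alpha> \<bullet> u = N \<alpha> * (1 + Re \<alpha> * Re \<beta> + Im \<alpha> * Im \<beta>)"
    unfolding u_def w_def N_def cmod_power2 by (simp add: inner_real3 power2_eq_square algebra_simps)
  then have au: "stereo_inv \<alpha> \<bullet> u = 1 + Re \<alpha> * Re \<beta> + Im \<alpha> * Im \<beta>" using N0 by (simp add: si)
  have "w \<alpha> \<bullet> v = N \<alpha> * (Im \<alpha> * Re \<beta> - Re \<alpha> * Im \<beta>)"
    unfolding v_def w_def N_def cmod_power2 by (simp add: inner_real3 power2_eq_square algebra_simps)
  then have av: "stereo_inv \<alpha> \<bullet> v = Im \<alpha> * Re \<beta> - Re \<alpha> * Im \<beta>" using N0 by (simp add: si)
  have "w z \<bullet> u - N z * (1 + Re \<alpha> * Re \<beta> + Im \<alpha> * Im \<beta>) = 2 * Re (- ((z - \<alpha>) * cnj (z - \<beta>)))"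
    unfolding u_def w_def N_def cmod_power2 by (simp add: inner_real3 power2_eq_square algebra_simps)
  then have u': "(stereo_inv z - stereo_inv \<alpha>) \<bullet> u = 2 / N z * Re (- ((z - \<alpha>) * cnj (z - \<beta>)))"
    using N0[of z] unfolding inner_diff_left au unfolding si inner_scaleR_left by (simp add: divide_simps mult.commute)
  have "w z \<bullet> v - N z * (Im \<alpha> * Re \<beta> - Re \<alpha> * Im \<beta>) = 2 * Im (- ((z - \<alpha>) * cnj (z - \<beta>)))"
    unfolding v_def w_def N_def cmod_power2 by (simp add: inner_real3 power2_eq_square algebra_simps)
  then have v': "(stereo_inv z - stereo_inv \<alpha>) \<bullet> v = 2 / N z * Im (- ((z - \<alpha>) * cnj (z - \<beta>)))"
    using N0[of z] unfolding inner_diff_left av unfolding si inner_scaleR_left by (simp add: divide_simps mult.commute)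
  show "Complex ((stereo_inv z - stereo_inv \<alpha>) \<bullet> u) ((stereo_inv z - stereo_inv \<alpha>) \<bullet> v)
      = of_real (2 / (1 + (cmod z)\<^sup>2)) * (- ((z - \<alpha>) * cnj (z - \<beta>)))"
    unfolding u' v' complex_eq_iff by (simp only: complex.sel Re_complex_of_real Im_complex_of_real times_complex.sel N_def) simp
qed

text \<open>
  Any two right-handed pairs \<open>(u, v)\<close> differ by an orientation preserving linear map, so the pair may be taken
  from \<open>stereo_moebius\<close>. There the winding number is that of \<open>(z - \<alpha>) cnj (z - \<beta>)\<close>, and conjugation changes the sign
  of the second contribution.
\<close>

lemma winding_around_line_stereo:
  assumes p: "path p" "pathfinish p = pathstart p" "path_image p \<subseteq> S2 - {south, a, b}"
    and a: "a \<in> S2 - {south}" and b: "b \<in> S2 - {south}" and "a \<noteq> b"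
    and uv: "cross3 u v = a - b"
  shows "winding_number (\<lambda>s. Complex ((p s - a) \<bullet> u) ((p s - a) \<bullet> v)) 0
    = winding_number (stereo \<circ> p) (stereo a) - winding_number (stereo \<circ> p) (stereo b)"
proof -
  define \<alpha> \<beta> where "\<alpha> = stereo a" and "\<beta> = stereo b"
  define z where "z = stereo \<circ> p"
  have a_eq: "a = stereo_inv \<alpha>" and b_eq: "b = stereo_inv \<beta>"
    using a b by (auto simp: \<alpha>_def \<beta>_def stereo_inverse)
  have p_eq: "p t = stereo_inv (z t)" if "t \<in> {0..1}" for t
    using p(3) that by (auto simp: z_def path_image_def stereo_inverse image_subset_iff)
  have z: "path z" "pathfinish z = pathstart z"
    unfolding z_def using p homeomorphism_stereo
    by (auto intro!: path_continuous_image continuous_on_subset[of "S2 - {south}" stereo]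
        simp: homeomorphism_def pathfinish_compose pathstart_compose)
  have z_ne: "z t \<noteq> \<alpha>" "z t \<noteq> \<beta>" if "t \<in> {0..1}" for t
  proof -
    have "p t \<noteq> a" "p t \<noteq> b" using p(3) imageI[OF that, of p] unfolding path_image_def by blast+
    then show "z t \<noteq> \<alpha>" "z t \<noteq> \<beta>" using p_eq[OF that] a_eq b_eq by auto
  qed
  define u0 v0 :: point
    where "u0 = vector [Re \<alpha> + Re \<beta>, Im \<alpha> + Im \<beta>, 1 - Re \<alpha> * Re \<beta> - Im \<alpha> * Im \<beta>]"
      and "v0 = vector [Im \<alpha> - Im \<beta>, Re \<beta> - Re \<alpha>, Re \<alpha> * Im \<beta> - Im \<alpha> * Re \<beta>]"
  note mob = stereo_moebius(1)[of \<alpha> \<beta>, folded u0_def v0_def a_eq b_eq]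
    stereo_moebius(2)[of _ \<alpha> \<beta>, folded u0_def v0_def]
  have kpos: "(1 + (cmod \<alpha>)\<^sup>2) * (1 + (cmod \<beta>)\<^sup>2) / 2 > 0"
    using one_plus_square_pos[of \<alpha>] one_plus_square_pos[of \<beta>] by simp
  obtain c d e f where cdef: "c * f - d * e > 0" "u = c *\<^sub>R u0 + d *\<^sub>R v0" "v = e *\<^sub>R u0 + f *\<^sub>R v0"
    using cross_basis_change[OF uv mob(1) kpos] \<open>a \<noteq> b\<close> by (metis right_minus_eq)
  obtain \<mu> \<nu> where mn: "cmod \<nu> < cmod \<mu>"
    "\<And>x y. Complex (c * x + d * y) (e * x + f * y) = \<mu> * Complex x y + \<nu> * cnj (Complex x y)"
    using det_pos_complex_form[OF cdef(1)] by metis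
  define G where "G = (\<lambda>t. (z t - \<alpha>) * cnj (z t - \<beta>))"
  define H where "H = (\<lambda>t. of_real (2 / (1 + (cmod (z t))\<^sup>2)) * (- 1 * G t))"
  have n0: "1 + (cmod x)\<^sup>2 \<noteq> 0" for x using one_plus_square_pos[of x] by simp
  have G: "path G" "pathfinish G = pathstart G" "0 \<notin> path_image G"
    using z z_ne unfolding G_def by (auto simp: path_def pathfinish_def pathstart_def path_image_def intro!: continuous_intros)
  then have G': "path (\<lambda>t. - 1 * G t)" "pathfinish (\<lambda>t. - 1 * G t) = pathstart (\<lambda>t. - 1 * G t)"
     "0 \<notin> path_image (\<lambda>t. - 1 * G t)"
    by (auto simp: path_def pathfinish_def pathstart_def path_image_def intro!: continuous_intros)
  have rc: "continuous_on {0..1} (\<lambda>t. 2 / (1 + (cmod (z t))\<^sup>2))"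
    using z(1) n0 unfolding path_def by (intro continuous_intros) auto
  have H: "path H" "pathfinish H = pathstart H" "0 \<notin> path_image H"
    using G z(2) n0 rc unfolding H_def
    by (auto simp: path_def pathfinish_def pathstart_def path_image_def simp del: of_real_divide intro!: continuous_intros)
  have "winding_number (\<lambda>s. Complex ((p s - a) \<bullet> u) ((p s - a) \<bullet> v)) 0
      = winding_number (\<lambda>t. \<mu> * H t + \<nu> * cnj (H t)) 0"
  proof (rule winding_number_cong)
    fix t :: real assume "0 \<le> t" "t \<le> 1"
    then have pt: "p t = stereo_inv (z t)" using p_eq by simp
    have "Complex ((p t - a) \<bullet> u0) ((p t - a) \<bullet> v0) = H t"
      using mob(2)[of "z t"] unfolding pt H_def G_def a_eq by simp
    then show "Complex ((p t - a) \<bullet> u) ((p t - a) \<bullet> v) = \<mu> * H t + \<nu> * cnj (H t)"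
      unfolding cdef(2,3) inner_add_right inner_scaleR_right mn(2) by simp
  qed
  also have "\<dots> = winding_number H 0"
    by (rule winding_number_linear_image[OF H(1,3,2) mn(1)])
  also have "\<dots> = winding_number (\<lambda>t. - 1 * G t) 0"
    unfolding H_def
    using z(2) one_plus_square_pos by (intro winding_number_pos_factor[OF G'(1,3,2) rc])
       (auto simp: pathfinish_def pathstart_def)
  also have "\<dots> = winding_number G 0"
    by (rule winding_number_mult_const[OF G(1,3)]) simp
  also have "\<dots> = winding_number (\<lambda>t. z t - \<alpha>) 0 + winding_number (\<lambda>t. cnj (z t - \<beta>)) 0"
    unfolding G_def using z z_ne
    by (intro winding_number_mult) (auto simp: path_def path_image_def intro!: continuous_intros)
  also have "winding_number (\<lambda>t. cnj (z t - \<beta>)) 0 = - winding_number (\<lambda>t. z t - \<beta>) 0"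
    using z z_ne
    by (intro winding_number_cnj_loop) (auto simp: path_def path_image_def pathfinish_def pathstart_def intro!: continuous_intros)
  finally show ?thesis
    unfolding winding_number_offset[of "stereo \<circ> p"] by (simp add: z_def \<alpha>_def \<beta>_def)
qed

text \<open>
  A stereographic projection from \<open>base\<close>, reduced to the properties that matter: it is a homeomorphism onto the
  plane, and it turns winding numbers around secants into differences of planar winding numbers.
\<close>

locale sphere_chart =
  fixes base :: point and \<phi> :: "point \<Rightarrow> complex" and \<psi> :: "complex \<Rightarrow> point"
  assumes base: "base \<in> S2"
    and homeo: "homeomorphism (S2 - {base}) UNIV \<phi> \<psi>"
    and winding_around_line: "\<And>p a b u v. \<lbrakk>path p; pathfinish p = pathstart p; path_image p \<subseteq> S2 - {base, a, b};
       a \<in> S2 - {base}; b \<in> S2 - {base}; a \<noteq> b; cross3 u v = a - b\<rbrakk> \<Longrightarrow>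
       winding_number (\<lambda>s. Complex ((p s - a) \<bullet> u) ((p s - a) \<bullet> v)) 0
         = winding_number (\<phi> \<circ> p) (\<phi> a) - winding_number (\<phi> \<circ> p) (\<phi> b)"

text \<open>
  A rotation moves \<open>base\<close> to the south pole. It preserves inner products and, having determinant one, cross
  products.
\<close>

lemma sphere_chart_exists:
  assumes "base \<in> S2"
  obtains \<phi> \<psi> where "sphere_chart base \<phi> \<psi>"
proof -
  have "norm base = norm south" using assms by (simp add: norm_axis_1)
  then obtain f where f: "orthogonal_transformation f" "det (matrix f) = 1" "f base = south"
    using rotation_exists[of base south] by auto
  obtain g where g: "orthogonal_transformation g" "\<And>x. g (f x) = x" "\<And>x. f (g x) = x"
    using orthogonal_transformation_inv[OF f(1)] orthogonal_transformation_bij[OF f(1)]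
    by (metis bij_inv_eq_iff)
  have nf: "norm (f x) = norm x" "norm (g x) = norm x" for x
    using f(1) g(1) orthogonal_transformation_norm by auto
  have h: "homeomorphism (S2 - {base}) (S2 - {south}) f g"
  proof (rule homeomorphismI)
    show "continuous_on (S2 - {base}) f" "continuous_on (S2 - {south}) g"
      using f(1) g(1)[THEN orthogonal_transformation_linear] f(1)[THEN orthogonal_transformation_linear]
      by (simp_all add: linear_continuous_on linear_conv_bounded_linear)
    show "f ` (S2 - {base}) \<subseteq> S2 - {south}" "g ` (S2 - {south}) \<subseteq> S2 - {base}"
      using f(3) g(2,3) nf by auto metis+
  qed (use g in auto)
  have "sphere_chart base (stereo \<circ> f) (g \<circ> stereo_inv)"
  proof
    show "base \<in> S2" by fact
    show "homeomorphism (S2 - {base}) UNIV (stereo \<circ> f) (g \<circ> stereo_inv)"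
      using homeomorphism_compose[OF h homeomorphism_stereo] .
  next
    fix p a b u v
    assume A: "path p" "pathfinish p = pathstart p" "path_image p \<subseteq> S2 - {base, a, b}"
       "a \<in> S2 - {base}" "b \<in> S2 - {base}" "a \<noteq> b" "cross3 u v = a - b"
    have lin: "linear f" using f(1) orthogonal_transformation_linear by blast
    have inj: "f x = f y \<longleftrightarrow> x = y" for x y using g(2) by metis
    have "winding_number (\<lambda>s. Complex (((f \<circ> p) s - f a) \<bullet> f u) (((f \<circ> p) s - f a) \<bullet> f v)) 0
      = winding_number (stereo \<circ> (f \<circ> p)) (stereo (f a)) - winding_number (stereo \<circ> (f \<circ> p)) (stereo (f b))"
    proof (rule winding_around_line_stereo)
      show "path (f \<circ> p)" using A(1) lin
        by (intro path_continuous_image) (simp_all add: linear_continuous_on linear_conv_bounded_linear)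
      show "pathfinish (f \<circ> p) = pathstart (f \<circ> p)" using A(2) by (simp add: pathfinish_compose pathstart_compose)
      show "path_image (f \<circ> p) \<subseteq> S2 - {south, f a, f b}"
        using A(3) unfolding f(3)[symmetric] by (auto simp: path_image_compose nf inj)
      show "f a \<in> S2 - {south}" "f b \<in> S2 - {south}" "f a \<noteq> f b"
        using A(4-6) unfolding f(3)[symmetric] by (auto simp: nf inj)
      show "cross3 (f u) (f v) = f a - f b"
        using cross_orthogonal_transformation[OF f(1), of u v] A(7) f(2) lin by (simp add: linear_diff)
    qed
    moreover have "(f x - f a) \<bullet> f w = (x - a) \<bullet> w" for x w
      using f(1) lin by (metis linear_diff orthogonal_transformation_def)
    ultimately show "winding_number (\<lambda>s. Complex ((p s - a) \<bullet> u) ((p s - a) \<bullet> v)) 0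
         = winding_number ((stereo \<circ> f) \<circ> p) ((stereo \<circ> f) a) - winding_number ((stereo \<circ> f) \<circ> p) ((stereo \<circ> f) b)"
      by (simp add: comp_assoc)
  qed
  then show ?thesis using that by blast
qed

lemma cross3_surj:
  fixes n :: point
  obtains u v where "cross3 u v = n"
proof (cases "n = 0")
  case True
  then show ?thesis using that[of 0 0] by simp
next
  case False
  have nn: "norm (norm n *\<^sub>R axis 3 1 :: point) = norm n" by (simp add: norm_axis_1)
  then obtain f where f: "orthogonal_transformation f" "det (matrix f) = 1" "f (norm n *\<^sub>R axis 3 1) = n"
    using rotation_exists[of "norm n *\<^sub>R axis 3 1" n] by auto
  have "cross3 (norm n *\<^sub>R axis 1 1) (axis 2 1) = norm n *\<^sub>R (axis 3 1 :: point)"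
    by (simp add: cross3_def vec_eq_iff forall_3 axis_def)
  then have "cross3 (f (norm n *\<^sub>R axis 1 1)) (f (axis 2 1)) = n"
    using cross_orthogonal_transformation[OF f(1)] f(2,3) by simp
  then show ?thesis using that by blast
qed

section \<open>Embedded triangles\<close>

definition corner_order :: "complex \<Rightarrow> complex \<Rightarrow> complex \<Rightarrow> bool"
  where "corner_order p q r \<longleftrightarrow> std_corners = {p, q, r} \<and> p \<noteq> q \<and> q \<noteq> r \<and> r \<noteq> p"

definition corner_loop :: "complex \<Rightarrow> complex \<Rightarrow> complex \<Rightarrow> real \<Rightarrow> complex"
  where "corner_loop p q r = linepath p q +++ linepath q r +++ linepath r p"

definition triangle_cell :: "triangle \<Rightarrow> bool"
  where "triangle_cell \<sigma> \<longleftrightarrow>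
    continuous_on std_triangle \<sigma> \<and> inj_on \<sigma> std_triangle \<and> \<sigma> ` std_triangle \<subseteq> S2"

lemma not_collinear_std_corners: "\<not> collinear std_corners"
  unfolding std_corners_def collinear_lemma by (simp add: complex_eq_iff)

lemma compact_std_triangle: "compact std_triangle"
  unfolding std_triangle_def std_corners_def by (simp add: finite_imp_compact_convex_hull)

lemma convex_std_triangle: "convex std_triangle"
  unfolding std_triangle_def by simp

lemma std_corners_subset: "std_corners \<subseteq> std_triangle"
  unfolding std_triangle_def by (rule hull_subset)

lemma std_interior_nonempty: "interior std_triangle \<noteq> {}"
proof -
  have "\<not> affine_dependent std_corners"
    using not_collinear_std_corners unfolding std_corners_def by (simp add: collinear_3_eq_affine_dependent)
  then show ?thesis
    unfolding std_triangle_def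
    by (subst interior_convex_hull_eq_empty) (auto simp: std_corners_def complex_eq_iff)
qed

lemma std_triangle_hull: "corner_order p q r \<Longrightarrow> std_triangle = convex hull {p, q, r}"
  unfolding corner_order_def std_triangle_def by simp

lemma std_frontier:
  assumes "corner_order p q r"
  shows "frontier std_triangle = closed_segment p q \<union> closed_segment q r \<union> closed_segment r p"
  unfolding std_triangle_hull[OF assms] by (rule frontier_of_triangle) simp

lemma std_frontier_subset: "frontier std_triangle \<subseteq> std_triangle"
  using frontier_subset_closed[OF compact_imp_closed[OF compact_std_triangle]] .

lemma std_triangle_split: "std_triangle = interior std_triangle \<union> frontier std_triangle"
  using closure_closed[OF compact_imp_closed[OF compact_std_triangle]] interior_subset[of std_triangle]
  unfolding frontier_def by blast

lemma std_segment_subset: "p \<in> std_corners \<Longrightarrow> q \<in> std_corners \<Longrightarrow> closed_segment p q \<subseteq> std_triangle"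
  using std_corners_subset by (intro closed_segment_subset convex_std_triangle) blast+

lemma corner_order_rotate: "corner_order p q r \<Longrightarrow> corner_order q r p"
  unfolding corner_order_def by (auto simp: insert_commute)

lemma corner_segments_Int:
  assumes "corner_order p q r"
  shows "closed_segment p q \<inter> closed_segment q r = {q}"
proof (rule Int_closed_segment)
  have "\<not> collinear {p, q, r}" using not_collinear_std_corners assms unfolding corner_order_def by simp
  then show "q \<in> closed_segment p r \<or> \<not> collinear {p, q, r}" by simp
qed

lemma corner_loop_simple:
  assumes "corner_order p q r"
  shows "simple_path (corner_loop p q r)" "pathfinish (corner_loop p q r) = pathstart (corner_loop p q r)"
    "path_image (corner_loop p q r) = frontier std_triangle"
proof -
  have ne: "p \<noteq> q" "q \<noteq> r" "r \<noteq> p" using assms unfolding corner_order_def by auto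
  note I = corner_segments_Int[OF assms] corner_segments_Int[OF corner_order_rotate[OF assms]]
    corner_segments_Int[OF corner_order_rotate[OF corner_order_rotate[OF assms]]]
  have i: "path_image (linepath q r +++ linepath r p) = closed_segment q r \<union> closed_segment r p"
    by (simp add: path_image_join)
  have "arc (linepath q r +++ linepath r p)"
  proof (rule arc_join)
    show "arc (linepath q r)" "arc (linepath r p)" using ne by (simp_all add: arc_linepath)
    show "path_image (linepath q r) \<inter> path_image (linepath r p) \<subseteq> {pathstart (linepath r p)}"
      using I(2) by simp
  qed simp
  then show "simple_path (corner_loop p q r)"
    unfolding corner_loop_def
  proof (rule simple_path_join_loop[rotated])
    show "arc (linepath p q)" using ne by (simp add: arc_linepath)
    show "path_image (linepath p q) \<inter> path_image (linepath q r +++ linepath r p)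
        \<subseteq> {pathstart (linepath p q), pathstart (linepath q r +++ linepath r p)}"
      unfolding i using I(1,3) by auto
  qed simp_all
  show "pathfinish (corner_loop p q r) = pathstart (corner_loop p q r)"
    by (simp add: corner_loop_def)
  show "path_image (corner_loop p q r) = frontier std_triangle"
    unfolding std_frontier[OF assms] corner_loop_def by (simp add: path_image_join Un_assoc)
qed

text \<open>
  The two arcs are reparametrizations of each other. This makes the arc of a triangulation interchangeable with
  the sides of the triangles that contain it.
\<close>

lemma winding_number_same_arc:
  assumes "arc g" "arc h" "path_image g = path_image h" "pathstart g = pathstart h" "pathfinish g = pathfinish h"
    and "z \<notin> path_image h"
  shows "winding_number g z = winding_number h z"
proof -
  define f where "f = inv_into {0..1} h \<circ> g"
  have inj: "inj_on h {0..1}" and ch: "continuous_on {0..1} h" using assms(2) by (auto simp: arc_def path_def)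
  have c: "continuous_on {0..1} f"
    unfolding f_def
  proof (rule continuous_on_compose)
    show "continuous_on {0..1} g" using assms(1) by (auto simp: arc_def path_def)
    have "continuous_on (h ` {0..1}) (inv_into {0..1} h)"
      using ch inj by (intro continuous_on_inv) auto
    then show "continuous_on (g ` {0..1}) (inv_into {0..1} h)"
      using assms(3) by (simp add: path_image_def)
  qed
  have hf: "g t = h (f t)" and fin: "f t \<in> {0..1}" if "t \<in> {0..1}" for t
  proof -
    have "g t \<in> h ` {0..1}" using that assms(3) by (auto simp: path_image_def)
    then show "g t = h (f t)" "f t \<in> {0..1}" unfolding f_def by (auto simp: f_inv_into_f inv_into_into simp del: atLeastAtMost_iff)
  qed
  have "f 0 = 0" "f 1 = 1"
    using assms(4,5) inj by (auto simp: f_def pathstart_def pathfinish_def inv_into_f_f)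
  then have "homotopic_paths (- {z}) h g"
    using assms c fin hf by (intro homotopic_paths_reparametrize[where f = f]) (auto simp: arc_imp_path)
  then show ?thesis by (metis winding_number_homotopic_paths)
qed

context sphere_chart
begin

lemma chart_continuous: "continuous_on (S2 - {base}) \<phi>"
  and chart_inj: "inj_on \<phi> (S2 - {base})"
  and chart_surj: "\<phi> ` (S2 - {base}) = UNIV"
  using homeo unfolding homeomorphism_def by (auto intro!: inj_on_inverseI[of _ \<psi> \<phi>])

lemma chart_eq_iff: "x \<in> S2 - {base} \<Longrightarrow> y \<in> S2 - {base} \<Longrightarrow> \<phi> x = \<phi> y \<longleftrightarrow> x = y"
  using chart_inj by (auto dest: inj_onD)

lemma chart_open_image:
  assumes "closed K"
  shows "open (\<phi> ` (S2 - {base} - K))"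
proof -
  have "openin (top_of_set (S2 - {base})) (S2 - {base} - K)"
    using assms by (auto simp: openin_open open_Compl intro!: exI[of _ "- K"])
  from homeomorphism_imp_open_map[OF homeo this] show ?thesis by simp
qed

end

text \<open>
  One part of the splitting is connected, so it lies in one of the two components; it fills this
  component, since otherwise the component would be split by \<open>A\<close> and \<open>B\<close>.
\<close>

lemma open_split_eq_components:
  fixes A B I O' J :: "'a::topological_space set"
  assumes "A \<union> B = - J" "A \<inter> B = {}" "open A" "open B" "connected A" "A \<noteq> {}"
    and "I \<union> O' = - J" "I \<inter> O' = {}" "open I" "open O'" "connected I" "connected O'"
  shows "A = I \<and> B = O' \<or> A = O' \<and> B = I"
proof -
  have eq: "A = U" if "connected U" "A \<subseteq> U" "U \<subseteq> - J" for U
  proof (rule ccontr)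
    assume "A \<noteq> U"
    then have "B \<inter> U \<noteq> {}" using that assms(1) by blast
    moreover have "A \<inter> U \<noteq> {}" using that assms(6) by blast
    moreover have "U \<subseteq> A \<union> B" using that assms(1) by blast
    ultimately show False using connectedD[OF that(1) assms(3,4)] assms(2) by blast
  qed
  have "I \<inter> A = {} \<or> O' \<inter> A = {}"
  proof (rule connectedD[OF assms(5,9,10)])
    show "I \<inter> O' \<inter> A = {}" using assms(8) by blast
    show "A \<subseteq> I \<union> O'" using assms(1,7) by blast
  qed
  then have "A \<subseteq> I \<or> A \<subseteq> O'" using assms(1,7) by blast
  then have "A = I \<or> A = O'" using eq assms(7,11,12) by blast
  then show ?thesis using assms(1,2,7,8) by blast
qed

text \<open>
  The projection center may lie inside or outside the triangle, but not on its boundary. In the chart, the images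
  of the inside and the outside, both without the projection center, take the roles of the two Jordan domains.
\<close>

locale cell_in_chart = sphere_chart +
  fixes \<sigma> :: triangle
  assumes cell: "triangle_cell \<sigma>"
    and base_off: "base \<notin> \<sigma> ` frontier std_triangle"
begin

abbreviation "cell_inner \<equiv> \<phi> ` (\<sigma> ` interior std_triangle - {base})"

abbreviation "cell_outer \<equiv> \<phi> ` (S2 - {base} - \<sigma> ` std_triangle)"

abbreviation "bdry p q r \<equiv> \<phi> \<circ> \<sigma> \<circ> corner_loop p q r"

lemma cell_cont: "continuous_on std_triangle \<sigma>" and cell_inj: "inj_on \<sigma> std_triangle" and cell_S2: "\<sigma> ` std_triangle \<subseteq> S2"
  using cell unfolding triangle_cell_def by auto

lemma frontier_image_subset: "\<sigma> ` frontier std_triangle \<subseteq> S2 - {base}"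
  using cell_S2 base_off std_frontier_subset by blast

lemma chart_cell_continuous: "continuous_on (frontier std_triangle) (\<phi> \<circ> \<sigma>)"
  by (intro continuous_on_compose continuous_on_subset[OF cell_cont std_frontier_subset]
       continuous_on_subset[OF chart_continuous frontier_image_subset])

lemma chart_cell_inj: "inj_on (\<phi> \<circ> \<sigma>) (frontier std_triangle)"
  by (intro comp_inj_on inj_on_subset[OF cell_inj std_frontier_subset]
       inj_on_subset[OF chart_inj frontier_image_subset])

lemma bdry_simple:
  assumes "corner_order p q r"
  shows "simple_path (bdry p q r)" "pathfinish (bdry p q r) = pathstart (bdry p q r)"
    "path_image (bdry p q r) = \<phi> ` \<sigma> ` frontier std_triangle"
  using corner_loop_simple[OF assms] chart_cell_continuous chart_cell_inj
  by (auto intro!: simple_path_continuous_image simp: pathfinish_compose pathstart_compose path_image_compose image_comp)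

text \<open>
  That the inside is open is invariance of domain. It is connected although the projection center may have been
  removed, since a plane domain stays connected without finitely many points.
\<close>

lemma inner_outer:
  shows "cell_inner \<union> cell_outer = - \<phi> ` \<sigma> ` frontier std_triangle" "cell_inner \<inter> cell_outer = {}"
    "open cell_inner" "open cell_outer" "connected cell_inner" "cell_inner \<noteq> {}"
proof -
  have d: "\<sigma> ` std_triangle = \<sigma> ` interior std_triangle \<union> \<sigma> ` frontier std_triangle"
    using std_triangle_split by (metis image_Un)
  have "interior std_triangle \<inter> frontier std_triangle = {}" unfolding frontier_def by auto
  then have dd: "\<sigma> ` interior std_triangle \<inter> \<sigma> ` frontier std_triangle = {}"
    using cell_inj std_triangle_split
    by (metis image_empty inj_on_image_Int interior_subset std_frontier_subset)
  have "(\<sigma> ` interior std_triangle - {base}) \<union> (S2 - {base} - \<sigma> ` std_triangle)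
     = (S2 - {base}) - \<sigma> ` frontier std_triangle"
    using d dd cell_S2 by blast
  then have "cell_inner \<union> cell_outer = \<phi> ` ((S2 - {base}) - \<sigma> ` frontier std_triangle)" by (metis image_Un)
  also have "\<dots> = - \<phi> ` \<sigma> ` frontier std_triangle"
    using chart_inj chart_surj frontier_image_subset by (simp add: inj_on_image_set_diff[of \<phi> "S2 - {base}"] Compl_eq_Diff_UNIV)
  finally show "cell_inner \<union> cell_outer = - \<phi> ` \<sigma> ` frontier std_triangle" .
  have "(\<sigma> ` interior std_triangle - {base}) \<inter> (S2 - {base} - \<sigma> ` std_triangle) = {}" using d by blast
  moreover have "\<sigma> ` interior std_triangle - {base} \<subseteq> S2 - {base}" using d cell_S2 by blast
  ultimately show "cell_inner \<inter> cell_outer = {}"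
    using inj_on_image_Int[OF chart_inj, of "\<sigma> ` interior std_triangle - {base}" "S2 - {base} - \<sigma> ` std_triangle"] by auto
  show "open cell_outer"
    by (intro chart_open_image compact_imp_closed compact_continuous_image cell_cont compact_std_triangle)
  define F where "F = {z \<in> interior std_triangle. \<sigma> z = base}"
  have fF: "finite F"
  proof -
    have "\<sigma> ` F \<subseteq> {base}" unfolding F_def by auto
    moreover have "inj_on \<sigma> F" using cell_inj interior_subset unfolding F_def by (auto intro: inj_on_subset)
    ultimately show ?thesis by (meson finite.emptyI finite.insertI inj_on_finite)
  qed
  have inner_eq: "cell_inner = (\<phi> \<circ> \<sigma>) ` (interior std_triangle - F)"
    unfolding F_def image_comp[symmetric] by (rule arg_cong[of _ _ "(`) \<phi>"]) auto
  have sub: "interior std_triangle - F \<subseteq> std_triangle" using interior_subset by auto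
  have subb: "\<sigma> ` (interior std_triangle - F) \<subseteq> S2 - {base}"
    using sub cell_S2 unfolding F_def by auto
  have cont: "continuous_on (interior std_triangle - F) (\<phi> \<circ> \<sigma>)"
    by (intro continuous_on_compose continuous_on_subset[OF cell_cont sub] continuous_on_subset[OF chart_continuous subb])
  have inj: "inj_on (\<phi> \<circ> \<sigma>) (interior std_triangle - F)"
    by (intro comp_inj_on inj_on_subset[OF cell_inj sub] inj_on_subset[OF chart_inj subb])
  show "open cell_inner" unfolding inner_eq
    using fF by (intro invariance_of_domain cont inj open_Diff) (auto simp: finite_imp_closed)
  show "connected cell_inner" unfolding inner_eq
    using fF by (intro connected_continuous_image cont connected_open_diff_countable)
      (auto simp: convex_connected convex_std_triangle uncountable_infinite countable_finite)
  have "infinite (interior std_triangle)"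
    using std_interior_nonempty finite_imp_not_open open_interior by blast
  then have "interior std_triangle - F \<noteq> {}" using fF by (metis Diff_eq_empty_iff finite_subset)
  then show "cell_inner \<noteq> {}" unfolding inner_eq by simp
qed

lemma inner_outer_Jordan:
  assumes "corner_order p q r"
  defines "J \<equiv> path_image (bdry p q r)"
  shows "cell_inner = inside J \<and> cell_outer = outside J \<or> cell_inner = outside J \<and> cell_outer = inside J"
    and "cell_outer \<noteq> {}" "connected cell_outer" "J \<subseteq> closure cell_inner" "J \<subseteq> closure cell_outer"
proof -
  note S = bdry_simple[OF assms(1), folded J_def]
  have jor: "inside J \<noteq> {}" "open (inside J)" "connected (inside J)"
     "outside J \<noteq> {}" "open (outside J)" "connected (outside J)" "inside J \<inter> outside J = {}"
     "inside J \<union> outside J = - J" "frontier (inside J) = J" "frontier (outside J) = J"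
    using Jordan_inside_outside[OF S(1,2)] unfolding J_def by auto
  note io = inner_outer[folded S(3)]
  show *: "cell_inner = inside J \<and> cell_outer = outside J \<or> cell_inner = outside J \<and> cell_outer = inside J"
    by (rule open_split_eq_components[OF io(1-6) jor(8,7,2,5,3,6)])
  show "cell_outer \<noteq> {}" "connected cell_outer" using * jor by metis+
  show "J \<subseteq> closure cell_inner" "J \<subseteq> closure cell_outer"
    using * jor(9,10) frontier_def by (metis Diff_subset)+
qed

text \<open>
  The planar winding number is \<open>\<plusminus>1\<close> in the bounded Jordan domain and \<open>0\<close> in the other. If the projection center is
  inside the triangle, then the inside of the triangle is the unbounded domain; therefore only the difference has
  a meaning independent of the chart.
\<close>

lemma bdry_winding:
  assumes "corner_order p q r"
  obtains s where "s \<in> {1, -1::int}"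
    "\<And>x y. x \<in> cell_inner \<Longrightarrow> y \<in> cell_outer \<Longrightarrow>
       winding_number (bdry p q r) x - winding_number (bdry p q r) y = of_int s"
proof -
  note S = bdry_simple[OF assms]
  have out: "winding_number (bdry p q r) x = 0" if "x \<in> outside (path_image (bdry p q r))" for x
    using winding_number_zero_in_outside[OF simple_path_imp_path[OF S(1)] S(2) that] .
  obtain e where e: "e \<in> {1, -1::int}"
     "\<And>x. x \<in> inside (path_image (bdry p q r)) \<Longrightarrow> winding_number (bdry p q r) x = of_int e"
  proof (rule simple_closed_path_winding_number_inside[OF S(1)])
    assume "\<And>z. z \<in> inside (path_image (bdry p q r)) \<Longrightarrow> winding_number (bdry p q r) z = 1"
    then show thesis using that[of 1] by simp
  next
    assume "\<And>z. z \<in> inside (path_image (bdry p q r)) \<Longrightarrow> winding_number (bdry p q r) z = -1"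
    then show thesis using that[of "-1"] by simp
  qed
  from inner_outer_Jordan(1)[OF assms] show ?thesis
  proof
    assume "cell_inner = inside (path_image (bdry p q r)) \<and> cell_outer = outside (path_image (bdry p q r))"
    then show ?thesis using that[of e] e out by simp
  next
    assume "cell_inner = outside (path_image (bdry p q r)) \<and> cell_outer = inside (path_image (bdry p q r))"
    then show ?thesis using that[of "- e"] e out by auto
  qed
qed

lemma winds_around_in_chart:
  assumes "corner_order p q r" "a \<in> \<sigma> ` interior std_triangle - {base}" "b \<in> S2 - {base} - \<sigma> ` std_triangle"
    and "cross3 u v = a - b"
  shows "winding_number (\<lambda>s. Complex (((\<sigma> \<circ> corner_loop p q r) s - a) \<bullet> u) (((\<sigma> \<circ> corner_loop p q r) s - a) \<bullet> v)) 0
    = winding_number (bdry p q r) (\<phi> a) - winding_number (bdry p q r) (\<phi> b)"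
proof -
  note L = corner_loop_simple[OF assms(1)]
  have aJ: "a \<notin> \<sigma> ` frontier std_triangle"
  proof
    assume "a \<in> \<sigma> ` frontier std_triangle"
    then obtain x where x: "x \<in> frontier std_triangle" "a = \<sigma> x" by blast
    obtain y where y: "y \<in> interior std_triangle" "a = \<sigma> y" using assms(2) by blast
    have "x = y" using cell_inj x y interior_subset std_frontier_subset
      by (meson inj_onD subsetD)
    then show False using x y unfolding frontier_def by simp
  qed
  have "a \<in> \<sigma> ` std_triangle" using assms(2) interior_subset by blast
  then have ab: "a \<noteq> b" "a \<in> S2" using assms(3) cell_S2 by blast+
  have c: "path (\<sigma> \<circ> corner_loop p q r)"
    using L by (auto intro!: path_continuous_image continuous_on_subset[OF cell_cont] simp: simple_path_imp_path std_frontier_subset[THEN subsetD])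
  have f: "pathfinish (\<sigma> \<circ> corner_loop p q r) = pathstart (\<sigma> \<circ> corner_loop p q r)"
    using L(2) by (simp add: pathfinish_compose pathstart_compose)
  have i: "path_image (\<sigma> \<circ> corner_loop p q r) \<subseteq> S2 - {base, a, b}"
    unfolding path_image_compose L(3) using aJ frontier_image_subset assms(3) std_frontier_subset by blast
  have "winding_number (\<lambda>s. Complex (((\<sigma> \<circ> corner_loop p q r) s - a) \<bullet> u) (((\<sigma> \<circ> corner_loop p q r) s - a) \<bullet> v)) 0
    = winding_number (\<phi> \<circ> (\<sigma> \<circ> corner_loop p q r)) (\<phi> a) - winding_number (\<phi> \<circ> (\<sigma> \<circ> corner_loop p q r)) (\<phi> b)"
    by (rule winding_around_line[OF c f i _ _ ab(1) assms(4)]) (use assms ab in auto)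
  then show ?thesis by (simp add: comp_assoc)
qed

end

text \<open>
  The winding number around a secant does not mention any chart, while in each chart the difference
  of the planar winding numbers does not depend on the two points. Comparing two pairs of points in a chart with a third
  point as projection center, and two charts by means of a common pair of points, shows that all
  these numbers are equal.
\<close>

lemma cell_orientation:
  assumes cell: "triangle_cell \<sigma>" and pqr: "corner_order p q r"
  obtains s where "s \<in> {1, -1::int}"
    "\<And>a b u v. a \<in> \<sigma> ` interior std_triangle \<Longrightarrow> b \<in> S2 - \<sigma> ` std_triangle \<Longrightarrow> cross3 u v = a - b \<Longrightarrow>
      winding_number (\<lambda>t. Complex (((\<sigma> \<circ> corner_loop p q r) t - a) \<bullet> u) (((\<sigma> \<circ> corner_loop p q r) t - a) \<bullet> v)) 0 = of_int s"
    "\<And>base \<phi> \<psi> a b. cell_in_chart base \<phi> \<psi> \<sigma> \<Longrightarrow> a \<in> \<sigma> ` interior std_triangle - {base} \<Longrightarrow>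
      b \<in> S2 - {base} - \<sigma> ` std_triangle \<Longrightarrow>
      winding_number (\<phi> \<circ> \<sigma> \<circ> corner_loop p q r) (\<phi> a) - winding_number (\<phi> \<circ> \<sigma> \<circ> corner_loop p q r) (\<phi> b) = of_int s"
proof -
  define n where "n = (\<lambda>a u v. winding_number (\<lambda>t. Complex (((\<sigma> \<circ> corner_loop p q r) t - a) \<bullet> u) (((\<sigma> \<circ> corner_loop p q r) t - a) \<bullet> v)) 0)"
  define I where "I = \<sigma> ` interior std_triangle"
  define X where "X = S2 - \<sigma> ` std_triangle"
  have I_S2: "I \<subseteq> S2" using cell interior_subset unfolding I_def triangle_cell_def by blast
  have infI: "infinite I"
    unfolding I_def using std_interior_nonempty finite_imp_not_open[OF _ open_interior] cell interior_subset
    unfolding triangle_cell_def by (metis finite_imageD inj_on_subset)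
  have chart: "\<exists>base \<phi> \<psi>. cell_in_chart base \<phi> \<psi> \<sigma> \<and> base \<in> I - F" if "finite F" for F
  proof -
    obtain c where c: "c \<in> I - F" using infI \<open>finite F\<close> by (metis Diff_eq_empty_iff ex_in_conv finite_subset)
    obtain \<phi> \<psi> where ch: "sphere_chart c \<phi> \<psi>" using sphere_chart_exists c I_S2 by blast
    obtain y where y: "y \<in> interior std_triangle" "c = \<sigma> y" using c unfolding I_def by blast
    have "c \<notin> \<sigma> ` frontier std_triangle"
      using cell y interior_subset std_frontier_subset unfolding triangle_cell_def frontier_def
      by (metis (no_types, lifting) DiffE image_iff inj_on_image_mem_iff subset_iff)
    then show ?thesis using ch c cell by (auto simp: cell_in_chart_def cell_in_chart_axioms_def)
  qed
  have key: "\<exists>s\<in>{1,-1::int}. (\<forall>a\<in>I - {base}. \<forall>b\<in>X - {base}.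
       winding_number (\<phi> \<circ> \<sigma> \<circ> corner_loop p q r) (\<phi> a) - winding_number (\<phi> \<circ> \<sigma> \<circ> corner_loop p q r) (\<phi> b) = of_int s
       \<and> (\<forall>u v. cross3 u v = a - b \<longrightarrow> n a u v = of_int s))"
    if "cell_in_chart base \<phi> \<psi> \<sigma>" for base \<phi> \<psi>
  proof -
    interpret cell_in_chart base \<phi> \<psi> \<sigma> by fact
    obtain s where s: "s \<in> {1, -1::int}"
     "\<And>x y. x \<in> cell_inner \<Longrightarrow> y \<in> cell_outer \<Longrightarrow>
       winding_number (bdry p q r) x - winding_number (bdry p q r) y = of_int s"
      using bdry_winding[OF pqr] by metis
    have X: "X - {base} = S2 - {base} - \<sigma> ` std_triangle" unfolding X_def by auto
    show ?thesis
    proof (intro bexI[OF _ s(1)] ballI conjI allI impI)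
      fix a b assume ab: "a \<in> I - {base}" "b \<in> X - {base}"
      then show w: "winding_number (bdry p q r) (\<phi> a) - winding_number (bdry p q r) (\<phi> b) = of_int s"
        unfolding X I_def by (intro s(2) imageI)
      fix u v assume "cross3 u v = a - b"
      then show "n a u v = of_int s"
        using winds_around_in_chart[OF pqr, of a b u v] ab w unfolding X I_def n_def by simp
    qed
  qed
  have ne: "I - {base} \<noteq> {} \<and> X - {base} \<noteq> {}" if "cell_in_chart base \<phi> \<psi> \<sigma>" for base \<phi> \<psi>
  proof -
    interpret cell_in_chart base \<phi> \<psi> \<sigma> by fact
    have "S2 - {base} - \<sigma> ` std_triangle = X - {base}" unfolding X_def by auto
    then show ?thesis using inner_outer(6) inner_outer_Jordan(2)[OF pqr] unfolding I_def by auto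
  qed
  obtain base0 \<phi>0 \<psi>0 where c0: "cell_in_chart base0 \<phi>0 \<psi>0 \<sigma>" using chart[of "{}"] by blast
  obtain a0 b0 where ab0: "a0 \<in> I - {base0}" "b0 \<in> X - {base0}" using ne[OF c0] by blast
  obtain u0 v0 where uv0: "cross3 u0 v0 = a0 - b0" using cross3_surj by blast
  obtain s where s: "s \<in> {1, -1::int}" "n a0 u0 v0 = of_int s"
    using key[OF c0] ab0 uv0 by blast
  have n: "n a u v = of_int s" if "a \<in> I" "b \<in> X" "cross3 u v = a - b" for a b u v
  proof -
    \<comment> \<open>a chart in which all four points are visible\<close>
    obtain base \<phi> \<psi> where c: "cell_in_chart base \<phi> \<psi> \<sigma>" "base \<in> I - {a, a0}" using chart[of "{a, a0}"] by blast
    have "base \<notin> X" using c(2) interior_subset unfolding I_def X_def by blast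
    then have "a \<in> I - {base}" "b \<in> X - {base}" "a0 \<in> I - {base}" "b0 \<in> X - {base}" using c(2) that ab0 by auto
    then have "n a u v = n a0 u0 v0" using key[OF c(1)] that(3) uv0 by metis
    then show ?thesis using s by simp
  qed
  have w: "winding_number (\<phi> \<circ> \<sigma> \<circ> corner_loop p q r) (\<phi> a) - winding_number (\<phi> \<circ> \<sigma> \<circ> corner_loop p q r) (\<phi> b) = of_int s"
    if "cell_in_chart base \<phi> \<psi> \<sigma>" "a \<in> I - {base}" "b \<in> X - {base}" for base \<phi> \<psi> a b
  proof -
    obtain u v where "cross3 u v = a - b" using cross3_surj by blast
    then show ?thesis using key[OF that(1)] that(2,3) n[of a b u v] by (metis Diff_iff)
  qed
  show ?thesis
    by (rule that[of s]) (use s n w in \<open>auto simp: n_def I_def X_def\<close>)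
qed

section \<open>Arcs have empty interior on the sphere\<close>

text \<open>
  A common property of points and arcs that suffices for an empty interior, by invariance of dimension.
\<close>

definition embeds_in_line :: "point set \<Rightarrow> bool"
  where "embeds_in_line K \<longleftrightarrow> closed K \<and> (\<exists>f::point \<Rightarrow> real. continuous_on K f \<and> inj_on f K)"

lemma embeds_in_line_no_interior:
  assumes K: "embeds_in_line K" and U: "openin (top_of_set S2) U" "U \<subseteq> K"
  shows "U = {}"
proof (rule ccontr)
  assume "U \<noteq> {}"
  then obtain x where x: "x \<in> U" by blast
  have xS: "x \<in> S2" using x U(1) openin_imp_subset by blast
  then have b: "- x \<in> S2" by simp
  have xb: "x \<noteq> - x"
  proof
    assume "x = - x"
    then have "x + x = 0" by (metis add.right_inverse)
    then have "x = 0" by (simp add: scaleR_2[symmetric])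
    then show False using xS by simp
  qed
  \<comment> \<open>the projection center is any point other than \<open>x\<close>\<close>
  obtain \<phi> \<psi> where ch: "sphere_chart (- x) \<phi> \<psi>" using sphere_chart_exists[OF b] by blast
  interpret sphere_chart "- x" \<phi> \<psi> by fact
  obtain O' where O': "open O'" "U = S2 \<inter> O'" using U(1) unfolding openin_open by blast
  define D where "D = \<phi> ` (S2 - {- x} - (- O'))"
  have D: "open D" unfolding D_def by (rule chart_open_image) (use O' in auto)
  have Dx: "\<phi> x \<in> D" unfolding D_def using x xS xb O' by auto
  obtain f :: "point \<Rightarrow> real" where f: "continuous_on K f" "inj_on f K" using K unfolding embeds_in_line_def by blast
  have inv: "homeomorphism UNIV (S2 - {- x}) \<psi> \<phi>" using homeo by (rule homeomorphism_symD)
  have psi: "\<psi> ` D \<subseteq> U"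
    unfolding D_def O'(2) using homeo unfolding homeomorphism_def by auto
  have c\<psi>: "continuous_on UNIV \<psi>" and i\<psi>: "inj \<psi>"
    using inv unfolding homeomorphism_def by (auto intro: inj_on_inverseI[of _ \<phi>])
  have "dim (UNIV :: complex set) \<le> dim (UNIV :: real set)"
  proof (rule invariance_of_dimension_subspaces[of UNIV D UNIV "f \<circ> \<psi>"])
    show "openin (top_of_set UNIV) D" using D by simp
    show "continuous_on D (f \<circ> \<psi>)"
      using psi U(2) by (intro continuous_on_compose continuous_on_subset[OF c\<psi>] continuous_on_subset[OF f(1)]) auto
    show "inj_on (f \<circ> \<psi>) D"
      using psi U(2) by (intro comp_inj_on inj_on_subset[OF i\<psi>] inj_on_subset[OF f(2)]) auto
  qed (use Dx in auto)
  then show False by simp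
qed

lemma embeds_in_line_arc:
  assumes "arc g"
  shows "embeds_in_line (path_image g)"
  unfolding embeds_in_line_def
proof (intro conjI exI)
  have g: "continuous_on {0..1} g" "inj_on g {0..1}" using assms by (auto simp: arc_def path_def)
  show "closed (path_image g)" using assms by (simp add: arc_imp_path closed_path_image)
  show "continuous_on (path_image g) (inv_into {0..1} g)"
    unfolding path_image_def using g by (intro continuous_on_inv) auto
  show "inj_on (inv_into {0..1} g) (path_image g)"
    unfolding path_image_def by (rule inj_on_inv_into) simp
qed

lemma embeds_in_line_singleton: "embeds_in_line {p}"
  unfolding embeds_in_line_def by auto

text \<open>
  Removing one closed set without interior from a nonempty open set leaves a nonempty open set, so this can be
  repeated finitely often.
\<close>

lemma open_minus_embedded_lines:
  assumes "finite \<K>" "\<And>K. K \<in> \<K> \<Longrightarrow> embeds_in_line K" "openin (top_of_set S2) U" "U \<noteq> {}"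
  shows "U - \<Union>\<K> \<noteq> {}"
  using assms
proof (induction \<K> arbitrary: U rule: finite_induct)
  case (insert K \<K>)
  have "U - K \<noteq> {}"
    using embeds_in_line_no_interior[of K U] insert.prems by auto
  moreover have "openin (top_of_set S2) (U - K)"
    using insert.prems(1)[of K] insert.prems(2) unfolding embeds_in_line_def Diff_eq
    by (intro openin_Int_open open_Compl) auto
  ultimately have "(U - K) - \<Union>\<K> \<noteq> {}" using insert by blast
  then show ?case by blast
qed simp

section \<open>The cells of a trinity\<close>

text \<open>
  The cyclic order matches the direction of \<open>boundary_loop\<close>. With \<open>C\<close> last, it orients an edge of color \<open>C\<close> from \<open>C1\<close>
  to \<open>C2\<close> in the same way as the boundary loops, so that one argument covers all three colors.
\<close>

definition cyclic_colors :: "trinity_data \<Rightarrow> point set \<Rightarrow> point set \<Rightarrow> point set \<Rightarrow> bool"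
  where "cyclic_colors T C1 C2 C \<longleftrightarrow>
    (C1, C2, C) \<in> {(red T, emerald T, violet T), (emerald T, violet T, red T), (violet T, red T, emerald T)}"

lemma cyclic_colors_rotate: "cyclic_colors T C1 C2 C \<Longrightarrow> cyclic_colors T C2 C C1"
  unfolding cyclic_colors_def by auto

locale trinity_complex =
  fixes T :: trinity_data
  assumes trinity: "trinity T"
begin

abbreviation "points \<equiv> red T \<union> emerald T \<union> violet T"

abbreviation "colors \<equiv> {red T, emerald T, violet T}"

definition skeleton :: "point set"
  where "skeleton = points \<union> (\<Union>g\<in>edges T. path_image g)"

lemma finite_parts: "finite points" "finite (edges T)" "finite (triangles T)"
  and points_S2: "points \<subseteq> S2"
  and edge_props: "\<forall>g\<in>edges T. arc g \<and> path_image g \<subseteq> S2 \<and> pathstart g \<in> points \<and> pathfinish g \<in> points"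
  and triangle_props: "\<forall>\<sigma>\<in>triangles T. continuous_on std_triangle \<sigma> \<and> inj_on \<sigma> std_triangle \<and> \<sigma> ` std_triangle \<subseteq> S2 \<and>
       (\<forall>p\<in>std_corners. \<forall>q\<in>std_corners. p \<noteq> q \<longrightarrow>
          (\<exists>g\<in>edges T. path_image g = \<sigma> ` closed_segment p q \<and> {pathstart g, pathfinish g} = {\<sigma> p, \<sigma> q}))"
  and open_edges_disjoint: "disjoint_family_on open_edge (edges T)"
  and open_triangles_disjoint: "disjoint_family_on open_triangle (triangles T)"
  and points_edges: "points \<inter> (\<Union>g\<in>edges T. open_edge g) = {}"
  and points_triangles: "points \<inter> (\<Union>\<sigma>\<in>triangles T. open_triangle \<sigma>) = {}"
  and edges_triangles: "(\<Union>g\<in>edges T. open_edge g) \<inter> (\<Union>\<sigma>\<in>triangles T. open_triangle \<sigma>) = {}"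
  and cover: "S2 = points \<union> (\<Union>g\<in>edges T. open_edge g) \<union> (\<Union>\<sigma>\<in>triangles T. open_triangle \<sigma>)"
  using trinity unfolding trinity_def sphere_triangulation_def by - (elim conjE, assumption)+

lemma edge_arc: "g \<in> edges T \<Longrightarrow> arc g" and edge_S2: "g \<in> edges T \<Longrightarrow> path_image g \<subseteq> S2"
  and edge_ends: "g \<in> edges T \<Longrightarrow> pathstart g \<in> points \<and> pathfinish g \<in> points"
  using edge_props by blast+

lemma triangle_cell: "\<sigma> \<in> triangles T \<Longrightarrow> triangle_cell \<sigma>"
  and triangle_edges: "\<sigma> \<in> triangles T \<Longrightarrow> p \<in> std_corners \<Longrightarrow> q \<in> std_corners \<Longrightarrow> p \<noteq> q \<Longrightarrow>
      \<exists>g\<in>edges T. path_image g = \<sigma> ` closed_segment p q \<and> {pathstart g, pathfinish g} = {\<sigma> p, \<sigma> q}"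
  using triangle_props unfolding triangle_cell_def by blast+

lemma colors_disjoint: "red T \<inter> emerald T = {}" "red T \<inter> violet T = {}" "emerald T \<inter> violet T = {}"
  and edge_colors: "g \<in> edges T \<Longrightarrow> C \<in> colors \<Longrightarrow> \<not> (pathstart g \<in> C \<and> pathfinish g \<in> C)"
  using trinity unfolding trinity_def by blast+

lemma path_image_edge: "path_image g = open_edge g \<union> {pathstart g, pathfinish g}"
proof -
  have "{0..1::real} = {0<..<1} \<union> {0, 1}" by auto
  then show ?thesis unfolding path_image_def open_edge_def pathstart_def pathfinish_def by (metis image_Un image_insert image_empty)
qed

lemma open_edge_nonempty: "open_edge g \<noteq> {}"
  unfolding open_edge_def by simp

lemma skeleton_eq: "skeleton = points \<union> (\<Union>g\<in>edges T. open_edge g)"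
  unfolding skeleton_def path_image_edge using edge_ends by blast

lemma frontier_in_skeleton:
  assumes "\<sigma> \<in> triangles T"
  shows "\<sigma> ` frontier std_triangle \<subseteq> skeleton"
proof -
  have "\<sigma> ` closed_segment p q \<subseteq> skeleton" if "p \<in> std_corners" "q \<in> std_corners" "p \<noteq> q" for p q
    using triangle_edges[OF assms that] unfolding skeleton_def by blast
  moreover have "corner_order 0 1 \<i>" unfolding corner_order_def std_corners_def by (auto simp: complex_eq_iff)
  ultimately show ?thesis
    unfolding std_frontier[OF \<open>corner_order 0 1 \<i>\<close>] image_Un
    by (intro Un_least) (simp_all add: std_corners_def complex_eq_iff)
qed

lemma closed_triangle_split:
  assumes "\<sigma> \<in> triangles T"
  shows "\<sigma> ` std_triangle = open_triangle \<sigma> \<union> \<sigma> ` frontier std_triangle"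
  unfolding open_triangle_def using std_triangle_split by (metis image_Un)

lemma closed_triangle_subset:
  assumes "\<sigma> \<in> triangles T"
  shows "\<sigma> ` std_triangle \<subseteq> open_triangle \<sigma> \<union> skeleton"
  using closed_triangle_split[OF assms] frontier_in_skeleton[OF assms] by blast

lemma skeleton_open_triangle: "\<sigma> \<in> triangles T \<Longrightarrow> open_triangle \<sigma> \<inter> skeleton = {}"
  unfolding skeleton_eq using points_triangles edges_triangles by blast

lemma open_closed_triangle_disjoint:
  assumes "\<sigma> \<in> triangles T" "\<tau> \<in> triangles T" "\<sigma> \<noteq> \<tau>"
  shows "open_triangle \<sigma> \<inter> \<tau> ` std_triangle = {}"
proof -
  have "open_triangle \<sigma> \<inter> open_triangle \<tau> = {}"
    using open_triangles_disjoint assms by (simp add: disjoint_family_on_def)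
  then show ?thesis
    using closed_triangle_subset[OF assms(2)] skeleton_open_triangle[OF assms(1)] by blast
qed

lemma closed_triangle_closed: "\<sigma> \<in> triangles T \<Longrightarrow> closed (\<sigma> ` std_triangle)"
  using triangle_cell unfolding triangle_cell_def
  by (intro compact_imp_closed compact_continuous_image compact_std_triangle) blast

lemma open_minus_skeleton:
  assumes "openin (top_of_set S2) U" "U \<noteq> {}"
  shows "U - skeleton \<noteq> {}"
proof -
  have "skeleton = \<Union>((\<lambda>p. {p}) ` points \<union> path_image ` edges T)"
    unfolding skeleton_def by blast
  moreover have "U - \<Union>((\<lambda>p. {p}) ` points \<union> path_image ` edges T) \<noteq> {}"
    using finite_parts assms
    by (intro open_minus_embedded_lines) (auto intro: embeds_in_line_arc embeds_in_line_singleton edge_arc)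
  ultimately show ?thesis by simp
qed

text \<open>
  Since the skeleton has empty interior, an open set minus a finite union of closed triangles either is empty or
  meets a further open triangle.
\<close>

lemma in_some_closed_triangle:
  assumes U: "openin (top_of_set S2) U" "x \<in> closure U" and F: "F \<subseteq> triangles T"
    and UF: "\<And>\<sigma>. \<sigma> \<in> triangles T \<Longrightarrow> open_triangle \<sigma> \<inter> U \<noteq> {} \<Longrightarrow> \<sigma> \<in> F"
  shows "\<exists>\<sigma>\<in>F. x \<in> \<sigma> ` std_triangle"
proof (rule ccontr)
  assume A: "\<not> ?thesis"
  define X where "X = (\<Union>\<sigma>\<in>F. \<sigma> ` std_triangle)"
  have "closed X" unfolding X_def using F closed_triangle_closed finite_subset[OF F finite_parts(3)] by (intro closed_UN) auto
  then have oX: "open (- X)" by (rule open_Compl)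
  have "x \<in> - X" using A unfolding X_def by blast
  then have "U \<inter> - X \<noteq> {}" using U(2) oX by (metis Int_commute disjoint_iff open_Int_closure_eq_empty)
  moreover have "openin (top_of_set S2) (U \<inter> - X)" using U(1) oX by (rule openin_Int_open)
  ultimately obtain y where y: "y \<in> U" "y \<notin> X" "y \<notin> skeleton" using open_minus_skeleton by blast
  have "y \<in> S2" using y U(1) openin_imp_subset by blast
  then obtain \<sigma> where s: "\<sigma> \<in> triangles T" "y \<in> open_triangle \<sigma>" using cover y(3) unfolding skeleton_eq by blast
  then have "\<sigma> \<in> F" using UF y(1) by blast
  then show False using y(2) s(2) closed_triangle_split[OF s(1)] unfolding X_def by blast
qed

lemma point_in_closed_triangle:
  assumes "x \<in> S2"
  shows "\<exists>\<sigma>\<in>triangles T. x \<in> \<sigma> ` std_triangle"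
  using assms by (intro in_some_closed_triangle[of S2]) (auto simp: closure_def)

lemma base_exists: "\<exists>base. base \<in> S2 - skeleton"
proof -
  have "axis 1 1 \<in> S2" by (simp add: norm_axis_1)
  then have "S2 \<noteq> {}" by (metis empty_iff)
  then have "S2 - skeleton \<noteq> {}" by (intro open_minus_skeleton) simp_all
  then show ?thesis by (metis ex_in_conv)
qed

lemma corner_colors:
  assumes "\<sigma> \<in> triangles T" "p \<in> std_corners" "q \<in> std_corners" "p \<noteq> q" "C \<in> colors"
  shows "\<sigma> p \<in> points" "\<not> (\<sigma> p \<in> C \<and> \<sigma> q \<in> C)"
proof -
  obtain g where g: "g \<in> edges T" "{pathstart g, pathfinish g} = {\<sigma> p, \<sigma> q}" using triangle_edges[OF assms(1-4)] by blast
  show "\<sigma> p \<in> points" using edge_ends[OF g(1)] g(2) by (auto simp: doubleton_eq_iff)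
  show "\<not> (\<sigma> p \<in> C \<and> \<sigma> q \<in> C)" using edge_colors[OF g(1) assms(5)] g(2) by (auto simp: doubleton_eq_iff)
qed

lemma corner_unique:
  assumes "\<sigma> \<in> triangles T" "C \<in> colors"
  shows "\<exists>!z. z \<in> std_corners \<and> \<sigma> z \<in> C"
proof -
  note c = corner_colors[OF assms(1)]
  have ne: "(0::complex) \<noteq> 1" "(0::complex) \<noteq> \<i>" "(1::complex) \<noteq> \<i>" by (auto simp: complex_eq_iff)
  have m: "0 \<in> std_corners" "1 \<in> std_corners" "\<i> \<in> std_corners" by (auto simp: std_corners_def)
  have P: "\<sigma> 0 \<in> points" "\<sigma> 1 \<in> points" "\<sigma> \<i> \<in> points"
    using c(1)[OF m(1,2) ne(1) assms(2)] c(1)[OF m(2,3) ne(3) assms(2)] c(1)[OF m(3,2) ne(3)[symmetric] assms(2)] .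
  have D: "\<not> (\<sigma> 0 \<in> D \<and> \<sigma> 1 \<in> D)" "\<not> (\<sigma> 0 \<in> D \<and> \<sigma> \<i> \<in> D)" "\<not> (\<sigma> 1 \<in> D \<and> \<sigma> \<i> \<in> D)"
    if "D \<in> colors" for D
    using c(2)[OF m(1,2) ne(1) that] c(2)[OF m(1,3) ne(2) that] c(2)[OF m(2,3) ne(3) that] .
  have "\<sigma> 0 \<in> C \<or> \<sigma> 1 \<in> C \<or> \<sigma> \<i> \<in> C"
    using P D[of "red T"] D[of "emerald T"] D[of "violet T"] assms(2) by auto
  then obtain z where z: "z \<in> std_corners" "\<sigma> z \<in> C" using m by blast
  then show ?thesis using c(2)[OF _ _ _ assms(2)] by blast
qed

lemma corner_props:
  assumes "\<sigma> \<in> triangles T" "C \<in> colors"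
  shows "corner \<sigma> C \<in> std_corners" "node \<sigma> C \<in> C" "z \<in> std_corners \<Longrightarrow> \<sigma> z \<in> C \<Longrightarrow> corner \<sigma> C = z"
  using theI'[OF corner_unique[OF assms]] corner_unique[OF assms] unfolding corner_def node_def by blast+

lemma cyclic_members:
  assumes "cyclic_colors T C1 C2 C"
  shows "C1 \<in> colors" "C2 \<in> colors" "C \<in> colors"
    "C1 \<inter> C2 = {}" "C2 \<inter> C = {}" "C \<inter> C1 = {}" "C1 \<union> C2 \<union> C = points"
  using assms colors_disjoint unfolding cyclic_colors_def by auto

lemma corner_order_cyclic:
  assumes "\<sigma> \<in> triangles T" "cyclic_colors T C1 C2 C"
  shows "corner_order (corner \<sigma> C1) (corner \<sigma> C2) (corner \<sigma> C)"
proof -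
  note m = cyclic_members[OF assms(2)]
  note p = corner_props[OF assms(1) m(1)] corner_props[OF assms(1) m(2)] corner_props[OF assms(1) m(3)]
  have ne: "corner \<sigma> C1 \<noteq> corner \<sigma> C2" "corner \<sigma> C2 \<noteq> corner \<sigma> C" "corner \<sigma> C \<noteq> corner \<sigma> C1"
    using p(2,5,8) m(4-6) unfolding node_def by (metis IntI empty_iff)+
  have "card {corner \<sigma> C1, corner \<sigma> C2, corner \<sigma> C} = 3" using ne by auto
  moreover have "card std_corners = 3" by (simp add: std_corners_def complex_eq_iff)
  moreover have "{corner \<sigma> C1, corner \<sigma> C2, corner \<sigma> C} \<subseteq> std_corners" using p by blast
  moreover have "finite std_corners" by (simp add: std_corners_def)
  ultimately have "{corner \<sigma> C1, corner \<sigma> C2, corner \<sigma> C} = std_corners" by (metis card_subset_eq)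
  then show ?thesis using ne unfolding corner_order_def by simp
qed

text \<open>
  An open edge meets another edge nowhere, so a single common point identifies the edge with a side.
\<close>

lemma edge_through_point:
  assumes "\<sigma> \<in> triangles T" "g \<in> edges T" "x \<in> open_edge g" "p \<in> std_corners" "q \<in> std_corners" "p \<noteq> q"
    "x \<in> \<sigma> ` closed_segment p q"
  shows "path_image g = \<sigma> ` closed_segment p q" "{pathstart g, pathfinish g} = {\<sigma> p, \<sigma> q}"
proof -
  obtain h where h: "h \<in> edges T" "path_image h = \<sigma> ` closed_segment p q" "{pathstart h, pathfinish h} = {\<sigma> p, \<sigma> q}"
    using triangle_edges[OF assms(1,4-6)] by blast
  have "x \<notin> points" using assms(2,3) points_edges by blast
  then have "x \<noteq> pathstart h" "x \<noteq> pathfinish h" using edge_ends[OF h(1)] by auto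
  moreover have "x \<in> path_image h" using assms(7) h(2) by simp
  ultimately have "x \<in> open_edge h" using path_image_edge[of h] by simp
  then have "h = g" using open_edges_disjoint h(1) assms(2,3) unfolding disjoint_family_on_def by blast
  then show "path_image g = \<sigma> ` closed_segment p q" "{pathstart g, pathfinish g} = {\<sigma> p, \<sigma> q}" using h by auto
qed

lemma edge_point_in_triangle:
  assumes "\<sigma> \<in> triangles T" "g \<in> edges T" "x \<in> open_edge g" "x \<in> \<sigma> ` std_triangle"
  shows "contains_edge \<sigma> g" "x \<in> \<sigma> ` frontier std_triangle"
    "\<exists>p\<in>std_corners. \<exists>q\<in>std_corners. p \<noteq> q \<and> path_image g = \<sigma> ` closed_segment p q \<and> {pathstart g, pathfinish g} = {\<sigma> p, \<sigma> q}"
proof -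
  have "x \<notin> open_triangle \<sigma>" using assms(1-3) edges_triangles by blast
  then show f: "x \<in> \<sigma> ` frontier std_triangle" using closed_triangle_split[OF assms(1)] assms(4) by blast
  have co: "corner_order 0 1 \<i>" unfolding corner_order_def std_corners_def by (auto simp: complex_eq_iff)
  have "\<exists>p\<in>std_corners. \<exists>q\<in>std_corners. p \<noteq> q \<and> x \<in> \<sigma> ` closed_segment p q"
    using f unfolding std_frontier[OF co] using co unfolding corner_order_def by blast
  then obtain p q where pq: "p \<in> std_corners" "q \<in> std_corners" "p \<noteq> q" "x \<in> \<sigma> ` closed_segment p q" by blast
  note e = edge_through_point[OF assms(1-3) pq]
  show "\<exists>p\<in>std_corners. \<exists>q\<in>std_corners. p \<noteq> q \<and> path_image g = \<sigma> ` closed_segment p q \<and> {pathstart g, pathfinish g} = {\<sigma> p, \<sigma> q}"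
    using pq e by blast
  show "contains_edge \<sigma> g" unfolding contains_edge_def e(1) using std_segment_subset[OF pq(1,2)] by blast
qed

lemma contains_edge_side:
  assumes "\<sigma> \<in> triangles T" "cyclic_colors T C1 C2 C" "g \<in> colored_edges T C" "contains_edge \<sigma> g"
  shows "path_image g = \<sigma> ` closed_segment (corner \<sigma> C1) (corner \<sigma> C2)"
    "{pathstart g, pathfinish g} = {node \<sigma> C1, node \<sigma> C2}"
proof -
  have g: "g \<in> edges T" "pathstart g \<notin> C" "pathfinish g \<notin> C" using assms(3) unfolding colored_edges_def by auto
  obtain x where x: "x \<in> open_edge g" using open_edge_nonempty by blast
  then have "x \<in> \<sigma> ` std_triangle" using assms(4) path_image_edge unfolding contains_edge_def by blast
  then obtain p q where pq: "p \<in> std_corners" "q \<in> std_corners" "p \<noteq> q" "path_image g = \<sigma> ` closed_segment p q"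
      "{pathstart g, pathfinish g} = {\<sigma> p, \<sigma> q}"
    using edge_point_in_triangle(3)[OF assms(1) g(1) x] by blast
  have "\<sigma> p \<notin> C" "\<sigma> q \<notin> C" using pq(5) g by (auto simp: doubleton_eq_iff)
  then have "p \<noteq> corner \<sigma> C" "q \<noteq> corner \<sigma> C"
    using corner_props(2)[OF assms(1) cyclic_members(3)[OF assms(2)]] unfolding node_def by auto
  then have "p = corner \<sigma> C1 \<and> q = corner \<sigma> C2 \<or> p = corner \<sigma> C2 \<and> q = corner \<sigma> C1"
  proof -
    have e: "std_corners = {corner \<sigma> C1, corner \<sigma> C2, corner \<sigma> C}"
      using corner_order_cyclic[OF assms(1,2)] unfolding corner_order_def by (elim conjE)
    assume "p \<noteq> corner \<sigma> C" "q \<noteq> corner \<sigma> C"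
    then show ?thesis using pq(1-3) unfolding e by auto
  qed
  then show "path_image g = \<sigma> ` closed_segment (corner \<sigma> C1) (corner \<sigma> C2)"
    "{pathstart g, pathfinish g} = {node \<sigma> C1, node \<sigma> C2}"
    using pq(4,5) unfolding node_def by (auto simp: closed_segment_commute)
qed

lemma triangle_side_unique:
  assumes "\<sigma> \<in> triangles T" "cyclic_colors T C1 C2 C"
  shows "\<exists>!g. g \<in> colored_edges T C \<and> contains_edge \<sigma> g"
proof -
  have co: "corner \<sigma> C1 \<in> std_corners" "corner \<sigma> C2 \<in> std_corners" "corner \<sigma> C1 \<noteq> corner \<sigma> C2"
    using corner_order_cyclic[OF assms] unfolding corner_order_def by auto
  obtain g where g: "g \<in> edges T" "path_image g = \<sigma> ` closed_segment (corner \<sigma> C1) (corner \<sigma> C2)"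
     "{pathstart g, pathfinish g} = {\<sigma> (corner \<sigma> C1), \<sigma> (corner \<sigma> C2)}" using triangle_edges[OF assms(1) co] by blast
  have "node \<sigma> C1 \<notin> C" "node \<sigma> C2 \<notin> C"
    using corner_props(2)[OF assms(1)] cyclic_members[OF assms(2)] by blast+
  then have "g \<in> colored_edges T C" using g unfolding colored_edges_def node_def by (auto simp: doubleton_eq_iff)
  moreover have "contains_edge \<sigma> g" using g(2) std_segment_subset[OF co(1,2)] unfolding contains_edge_def by blast
  moreover have "h = g" if h: "h \<in> colored_edges T C" "contains_edge \<sigma> h" for h
  proof -
    have hE: "h \<in> edges T" using h(1) unfolding colored_edges_def by auto
    have "path_image h = path_image g" using contains_edge_side(1)[OF assms h] g(2) by simp
    moreover obtain x where x: "x \<in> open_edge h" using open_edge_nonempty by blast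
    ultimately have "x \<in> path_image g" using path_image_edge by blast
    moreover have "x \<notin> points" using x hE points_edges by blast
    then have "x \<noteq> pathstart g" "x \<noteq> pathfinish g" using edge_ends[OF g(1)] by auto
    ultimately have "x \<in> open_edge g" using path_image_edge[of g] by simp
    then show "h = g" using open_edges_disjoint x hE g(1) unfolding disjoint_family_on_def by blast
  qed
  ultimately show ?thesis by blast
qed

lemma point_is_node:
  assumes "C \<in> colors" "x \<in> C"
  shows "\<exists>\<sigma>\<in>triangles T. x = node \<sigma> C"
proof -
  have xp: "x \<in> points" using assms by auto
  then obtain \<sigma> where s: "\<sigma> \<in> triangles T" "x \<in> \<sigma> ` std_triangle" using point_in_closed_triangle points_S2 by blast
  have co: "corner_order 0 1 \<i>" unfolding corner_order_def std_corners_def by (auto simp: complex_eq_iff)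
  have "x \<notin> open_triangle \<sigma>" using xp points_triangles s(1) by blast
  then have "x \<in> \<sigma> ` frontier std_triangle" using closed_triangle_split[OF s(1)] s(2) by blast
  then have "\<exists>p\<in>std_corners. \<exists>q\<in>std_corners. p \<noteq> q \<and> x \<in> \<sigma> ` closed_segment p q"
    unfolding std_frontier[OF co] using co unfolding corner_order_def by blast
  then obtain p q where pq: "p \<in> std_corners" "q \<in> std_corners" "p \<noteq> q" "x \<in> \<sigma> ` closed_segment p q" by blast
  obtain h where h: "h \<in> edges T" "path_image h = \<sigma> ` closed_segment p q" "{pathstart h, pathfinish h} = {\<sigma> p, \<sigma> q}"
    using triangle_edges[OF s(1) pq(1-3)] by blast
  have "x \<notin> open_edge h" using xp points_edges h(1) by blast
  then have "x \<in> {\<sigma> p, \<sigma> q}" using pq(4) h(2,3) path_image_edge by blast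
  then obtain z where "z \<in> std_corners" "x = \<sigma> z" using pq by blast
  then have "x = node \<sigma> C" using corner_props(3)[OF s(1) assms(1)] assms(2) unfolding node_def by metis
  then show ?thesis using s by blast
qed

end

section \<open>Orientations of triangles\<close>

text \<open>
  The tool for comparing winding numbers on the two sides of an edge.
\<close>

lemma const_limits_agree:
  fixes f :: "complex \<Rightarrow> complex"
  assumes "isCont f q" "q \<in> closure A" "q \<in> closure B" "\<And>x. x \<in> A \<Longrightarrow> f x = a" "\<And>x. x \<in> B \<Longrightarrow> f x = b"
  shows "a = b"
proof -
  have lim: "f q = c" if "q \<in> closure S" "\<And>x. x \<in> S \<Longrightarrow> f x = c" for S c
  proof -
    have "\<exists>x. (\<forall>n. x n \<in> S) \<and> x \<longlonglongrightarrow> q" using that(1) unfolding closure_sequential .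
    then obtain x where x: "\<forall>n::nat. x n \<in> S" "x \<longlonglongrightarrow> q" by blast
    have "(\<lambda>n. f (x n)) \<longlonglongrightarrow> f q" using isCont_tendsto_compose[OF assms(1) x(2)] .
    moreover have "(\<lambda>n. f (x n)) = (\<lambda>n. c)" using x(1) that(2) by blast
    ultimately show ?thesis by (simp add: LIMSEQ_const_iff)
  qed
  then show ?thesis using assms by metis
qed

lemma integer_valued_constant:
  fixes f :: "complex \<Rightarrow> complex"
  assumes "connected S" "continuous_on S f" "\<And>x. x \<in> S \<Longrightarrow> f x \<in> \<int>" "a \<in> S" "b \<in> S"
  shows "f a = f b"
proof -
  have "f constant_on S"
  proof (rule continuous_discrete_range_constant[OF assms(1,2)])
    fix x assume "x \<in> S"
    have "1 \<le> norm (f y - f x)" if "y \<in> S" "f y \<noteq> f x" for y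
    proof -
      have "f y - f x \<in> \<int>" using assms(3)[OF that(1)] assms(3)[OF \<open>x \<in> S\<close>] by (rule Ints_diff)
      then obtain n :: int where n: "f y - f x = of_int n" by (rule Ints_cases)
      then have "n \<noteq> 0" using that(2) by auto
      then show ?thesis unfolding n norm_of_int by linarith
    qed
    then show "\<exists>e>0. \<forall>y. y \<in> S \<and> f y \<noteq> f x \<longrightarrow> e \<le> norm (f y - f x)" by (intro exI[of _ 1]) auto
  qed
  then show ?thesis using assms(4,5) unfolding constant_on_def by metis
qed

context trinity_complex
begin

text \<open>
  Counterclockwise triangles have orientation \<open>1\<close>.
\<close>

definition orientation :: "triangle \<Rightarrow> int"
  where "orientation \<sigma> = (if white T \<sigma> then - 1 else 1)"

lemma cell_in_chart_triangle:
  assumes "\<sigma> \<in> triangles T" "sphere_chart base \<phi> \<psi>" "base \<notin> skeleton"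
  shows "cell_in_chart base \<phi> \<psi> \<sigma>"
  using assms triangle_cell frontier_in_skeleton unfolding cell_in_chart_def cell_in_chart_axioms_def by blast

lemma boundary_loop_eq: "boundary_loop T \<sigma> = \<sigma> \<circ> corner_loop (corner \<sigma> (red T)) (corner \<sigma> (emerald T)) (corner \<sigma> (violet T))"
  unfolding boundary_loop_def corner_loop_def ..

text \<open>
  \<open>white\<close> asks for one pair of points and one pair of projection vectors; by \<open>cell_orientation\<close> all
  choices give the same winding number \<open>\<plusminus>1\<close>.
\<close>

lemma orientation_winding:
  assumes s: "\<sigma> \<in> triangles T" and ch: "sphere_chart base \<phi> \<psi>" "base \<notin> skeleton"
    and a: "a \<in> \<sigma> ` interior std_triangle - {base}" and b: "b \<in> S2 - {base} - \<sigma> ` std_triangle"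
  shows "winding_number (\<phi> \<circ> boundary_loop T \<sigma>) (\<phi> a) - winding_number (\<phi> \<circ> boundary_loop T \<sigma>) (\<phi> b)
    = of_int (orientation \<sigma>)"
proof -
  have co: "corner_order (corner \<sigma> (red T)) (corner \<sigma> (emerald T)) (corner \<sigma> (violet T))"
    using corner_order_cyclic[OF s] by (simp add: cyclic_colors_def)
  obtain e where e: "e \<in> {1, -1::int}"
    "\<And>a b u v. a \<in> \<sigma> ` interior std_triangle \<Longrightarrow> b \<in> S2 - \<sigma> ` std_triangle \<Longrightarrow> cross3 u v = a - b \<Longrightarrow>
      winding_number (\<lambda>t. Complex ((boundary_loop T \<sigma> t - a) \<bullet> u) ((boundary_loop T \<sigma> t - a) \<bullet> v)) 0 = of_int e"
    "\<And>base \<phi> \<psi> a b. cell_in_chart base \<phi> \<psi> \<sigma> \<Longrightarrow> a \<in> \<sigma> ` interior std_triangle - {base} \<Longrightarrow>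
      b \<in> S2 - {base} - \<sigma> ` std_triangle \<Longrightarrow>
      winding_number (\<phi> \<circ> boundary_loop T \<sigma>) (\<phi> a) - winding_number (\<phi> \<circ> boundary_loop T \<sigma>) (\<phi> b) = of_int e"
    by (rule cell_orientation[OF triangle_cell[OF s] co, unfolded comp_assoc, folded boundary_loop_eq])
       (rule that, assumption+)
  have "white T \<sigma> \<longleftrightarrow> e = -1"
  proof
    assume "white T \<sigma>"
    then obtain a b where ab: "a \<in> open_triangle \<sigma>" "b \<in> S2 - \<sigma> ` std_triangle" "winds_around (boundary_loop T \<sigma>) a b (- 1)"
      unfolding white_def by blast
    from ab(3) obtain u v where uv: "cross3 u v = a - b"
      "winding_number (\<lambda>t. Complex ((boundary_loop T \<sigma> t - a) \<bullet> u) ((boundary_loop T \<sigma> t - a) \<bullet> v)) 0 = of_int (- 1)"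
      unfolding winds_around_def by blast
    then have "of_int e = (of_int (- 1) :: complex)" using e(2)[OF ab(1)[unfolded open_triangle_def] ab(2) uv(1)] by simp
    then show "e = -1" by (simp only: of_int_eq_iff)
  next
    assume "e = -1"
    obtain u v where uv: "cross3 u v = a - b" using cross3_surj by blast
    have "winding_number (\<lambda>t. Complex ((boundary_loop T \<sigma> t - a) \<bullet> u) ((boundary_loop T \<sigma> t - a) \<bullet> v)) 0 = of_int e"
      by (rule e(2)[OF _ _ uv]) (use a b in auto)
    then have "winds_around (boundary_loop T \<sigma>) a b (-1)"
      using uv unfolding winds_around_def \<open>e = -1\<close> by blast
    moreover have "a \<in> open_triangle \<sigma>" "b \<in> S2 - \<sigma> ` std_triangle" using a b unfolding open_triangle_def by blast+
    ultimately show "white T \<sigma>" unfolding white_def by blast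
  qed
  then have "e = orientation \<sigma>" using e(1) unfolding orientation_def by auto
  then show ?thesis using e(3)[OF cell_in_chart_triangle[OF s ch] a b] by simp
qed

lemma red_emerald_violet: "cyclic_colors T (red T) (emerald T) (violet T)"
  by (simp add: cyclic_colors_def)

lemma segment_in_skeleton:
  assumes "\<sigma> \<in> triangles T" "cyclic_colors T C1 C2 C"
  shows "\<sigma> ` closed_segment (corner \<sigma> C1) (corner \<sigma> C2) \<subseteq> skeleton"
  using frontier_in_skeleton[OF assms(1)] std_frontier[OF corner_order_cyclic[OF assms]] by blast

lemma side_point:
  assumes "\<sigma> \<in> triangles T" "cyclic_colors T C1 C2 C" "g \<in> edges T" "x \<in> open_edge g"
    "x \<in> \<sigma> ` closed_segment (corner \<sigma> C1) (corner \<sigma> C2)"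
  shows "contains_edge \<sigma> g" "g \<in> colored_edges T C"
proof -
  have co: "corner \<sigma> C1 \<in> std_corners" "corner \<sigma> C2 \<in> std_corners" "corner \<sigma> C1 \<noteq> corner \<sigma> C2"
    using corner_order_cyclic[OF assms(1,2)] unfolding corner_order_def by auto
  note e = edge_through_point[OF assms(1,3,4) co assms(5)]
  show "contains_edge \<sigma> g" unfolding contains_edge_def e(1) using std_segment_subset[OF co(1,2)] by blast
  have "node \<sigma> C1 \<notin> C" "node \<sigma> C2 \<notin> C"
    using corner_props(2)[OF assms(1)] cyclic_members[OF assms(2)] by blast+
  then show "g \<in> colored_edges T C" using e(2) assms(3) unfolding colored_edges_def node_def by (auto simp: doubleton_eq_iff)
qed

lemma colored_edges_distinct:
  assumes "cyclic_colors T C1 C2 C" "g \<in> colored_edges T C"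
  shows "g \<notin> colored_edges T C1" "g \<notin> colored_edges T C2"
proof -
  have g: "g \<in> edges T" "pathstart g \<notin> C" "pathfinish g \<notin> C" using assms(2) unfolding colored_edges_def by auto
  have "pathstart g \<in> C1 \<union> C2 \<union> C" "pathfinish g \<in> C1 \<union> C2 \<union> C" using edge_ends[OF g(1)] cyclic_members(7)[OF assms(1)] by auto
  moreover have "\<not> (pathstart g \<in> C1 \<and> pathfinish g \<in> C1)" "\<not> (pathstart g \<in> C2 \<and> pathfinish g \<in> C2)"
    using edge_colors[OF g(1)] cyclic_members(1,2)[OF assms(1)] by blast+
  ultimately show "g \<notin> colored_edges T C1" "g \<notin> colored_edges T C2" using g unfolding colored_edges_def by blast+
qed

lemma other_side_off:
  assumes "\<sigma> \<in> triangles T" "cyclic_colors T C1 C2 C" "g \<in> colored_edges T C" "x \<in> open_edge g"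
  shows "x \<notin> \<sigma> ` closed_segment (corner \<sigma> C2) (corner \<sigma> C)" "x \<notin> \<sigma> ` closed_segment (corner \<sigma> C) (corner \<sigma> C1)"
proof -
  have g: "g \<in> edges T" using assms(3) unfolding colored_edges_def by auto
  note c2 = cyclic_colors_rotate[OF assms(2)]
  note c3 = cyclic_colors_rotate[OF c2]
  show "x \<notin> \<sigma> ` closed_segment (corner \<sigma> C2) (corner \<sigma> C)" "x \<notin> \<sigma> ` closed_segment (corner \<sigma> C) (corner \<sigma> C1)"
    using side_point(2)[OF assms(1) c2 g assms(4)] side_point(2)[OF assms(1) c3 g assms(4)] colored_edges_distinct[OF assms(2,3)] by blast+
qed

lemma open_edge_skeleton: "g \<in> edges T \<Longrightarrow> open_edge g \<subseteq> skeleton"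
  unfolding skeleton_eq by blast

lemma side_nodes_agree:
  assumes "\<sigma> \<in> triangles T" "\<tau> \<in> triangles T" "cyclic_colors T C1 C2 C" "g \<in> colored_edges T C"
    "contains_edge \<sigma> g" "contains_edge \<tau> g"
  shows "node \<sigma> C1 = node \<tau> C1" "node \<sigma> C2 = node \<tau> C2"
proof -
  have "{node \<sigma> C1, node \<sigma> C2} = {node \<tau> C1, node \<tau> C2}"
    using contains_edge_side(2)[OF assms(1,3,4,5)] contains_edge_side(2)[OF assms(2,3,4,6)] by simp
  moreover have "node \<sigma> C1 \<in> C1" "node \<sigma> C2 \<in> C2" "node \<tau> C1 \<in> C1" "node \<tau> C2 \<in> C2"
    using corner_props(2)[OF assms(1)] corner_props(2)[OF assms(2)] cyclic_members(1,2)[OF assms(3)] by blast+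
  ultimately show "node \<sigma> C1 = node \<tau> C1" "node \<sigma> C2 = node \<tau> C2"
    using cyclic_members(4)[OF assms(3)] by (auto simp: doubleton_eq_iff)
qed

lemma white_in_triangles: "\<sigma> \<in> white_triangles T \<Longrightarrow> \<sigma> \<in> triangles T"
  and finite_white: "finite (white_triangles T)"
  using finite_parts(3) unfolding white_triangles_def by auto

text \<open>
  A potential on the points pairs to zero with a chain whose sums over the triangles at each point vanish.
\<close>

lemma sum_by_node:
  fixes h :: "triangle \<Rightarrow> complex"
  assumes "C \<in> colors"
    and zero: "\<And>p. p \<in> C \<Longrightarrow> (\<Sum>\<sigma> | \<sigma> \<in> white_triangles T \<and> node \<sigma> C = p. c \<sigma>) = (0::int)"
  shows "(\<Sum>\<sigma>\<in>white_triangles T. of_int (c \<sigma>) * (L (node \<sigma> C) :: complex)) = 0"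
proof -
  have f: "finite C" using assms(1) finite_parts(1) by auto
  have "(\<Sum>\<sigma>\<in>white_triangles T. of_int (c \<sigma>) * L (node \<sigma> C))
      = (\<Sum>p\<in>C. \<Sum>\<sigma> | \<sigma> \<in> white_triangles T \<and> node \<sigma> C = p. of_int (c \<sigma>) * L (node \<sigma> C))"
    using corner_props(2)[OF white_in_triangles assms(1)]
    by (intro sum.group[symmetric] finite_white f) auto
  also have "\<dots> = (\<Sum>p\<in>C. of_int (\<Sum>\<sigma> | \<sigma> \<in> white_triangles T \<and> node \<sigma> C = p. c \<sigma>) * L p)"
    by (intro sum.cong refl) (simp add: sum_distrib_right)
  also have "\<dots> = 0" using zero by simp
  finally show ?thesis .
qed

end

section \<open>Winding numbers of sides and boundaries\<close>

text \<open>
  A projection center off the skeleton keeps all edges in the plane.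
\<close>

locale trinity_in_chart = trinity_complex T + sphere_chart base \<phi> \<psi>
  for T :: trinity_data and base \<phi> \<psi> +
  assumes base_generic: "base \<notin> skeleton"
begin

text \<open>
  The winding number of a side is not an integer in general; it is used in sums over loops or cycles.
\<close>

definition arc_winding :: "triangle \<Rightarrow> point set \<Rightarrow> point set \<Rightarrow> complex \<Rightarrow> complex"
  where "arc_winding \<sigma> C1 C2 = winding_number (\<phi> \<circ> \<sigma> \<circ> linepath (corner \<sigma> C1) (corner \<sigma> C2))"

definition loop_winding :: "triangle \<Rightarrow> complex \<Rightarrow> complex"
  where "loop_winding \<sigma> = winding_number (\<phi> \<circ> boundary_loop T \<sigma>)"

definition inner_region :: "triangle \<Rightarrow> complex set"
  where "inner_region \<sigma> = \<phi> ` (open_triangle \<sigma> - {base})"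

lemma cell_chart: "\<sigma> \<in> triangles T \<Longrightarrow> cell_in_chart base \<phi> \<psi> \<sigma>"
  using cell_in_chart_triangle base_generic sphere_chart_axioms by blast

lemma skeleton_S2: "skeleton \<subseteq> S2 - {base}"
  using base_generic points_S2 edge_S2 unfolding skeleton_def by auto

lemma arc_side:
  assumes "\<sigma> \<in> triangles T" "cyclic_colors T C1 C2 C"
  shows "arc (\<phi> \<circ> \<sigma> \<circ> linepath (corner \<sigma> C1) (corner \<sigma> C2))"
    "path_image (\<phi> \<circ> \<sigma> \<circ> linepath (corner \<sigma> C1) (corner \<sigma> C2)) = \<phi> ` \<sigma> ` closed_segment (corner \<sigma> C1) (corner \<sigma> C2)"
    "pathstart (\<phi> \<circ> \<sigma> \<circ> linepath (corner \<sigma> C1) (corner \<sigma> C2)) = \<phi> (node \<sigma> C1)"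
    "pathfinish (\<phi> \<circ> \<sigma> \<circ> linepath (corner \<sigma> C1) (corner \<sigma> C2)) = \<phi> (node \<sigma> C2)"
proof -
  interpret cell_in_chart base \<phi> \<psi> \<sigma> by (rule cell_chart[OF assms(1)])
  have co: "corner_order (corner \<sigma> C1) (corner \<sigma> C2) (corner \<sigma> C)" using corner_order_cyclic[OF assms] .
  have sub: "path_image (linepath (corner \<sigma> C1) (corner \<sigma> C2)) \<subseteq> frontier std_triangle"
    using std_frontier[OF co] by auto
  have ne: "corner \<sigma> C1 \<noteq> corner \<sigma> C2" using co unfolding corner_order_def by blast
  show "arc (\<phi> \<circ> \<sigma> \<circ> linepath (corner \<sigma> C1) (corner \<sigma> C2))"
    unfolding arc_def
  proof
    show "path (\<phi> \<circ> \<sigma> \<circ> linepath (corner \<sigma> C1) (corner \<sigma> C2))"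
      by (intro path_continuous_image continuous_on_subset[OF chart_cell_continuous sub]) simp
    have "inj_on (linepath (corner \<sigma> C1) (corner \<sigma> C2)) {0..1}"
      using arc_linepath[OF ne] unfolding arc_def by blast
    then show "inj_on (\<phi> \<circ> \<sigma> \<circ> linepath (corner \<sigma> C1) (corner \<sigma> C2)) {0..1}"
      using sub unfolding path_image_def
      by (intro comp_inj_on inj_on_subset[OF chart_cell_inj]) auto
  qed
qed (auto simp: path_image_compose image_comp pathstart_compose pathfinish_compose node_def)

lemma arc_winding_continuous:
  assumes "\<sigma> \<in> triangles T" "cyclic_colors T C1 C2 C" "z \<notin> \<phi> ` \<sigma> ` closed_segment (corner \<sigma> C1) (corner \<sigma> C2)"
  shows "isCont (arc_winding \<sigma> C1 C2) z"
  unfolding arc_winding_def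
  using continuous_at_winding_number[OF arc_imp_path[OF arc_side(1)[OF assms(1,2)]]] assms(3) arc_side(2)[OF assms(1,2)] by simp

text \<open>
  The sum does not depend on the side at which the loop starts, so it may be written beginning with the
  edge of any given color.
\<close>

lemma loop_winding_sum:
  assumes "\<sigma> \<in> triangles T" "cyclic_colors T C1 C2 C" "z \<notin> \<phi> ` \<sigma> ` frontier std_triangle"
  shows "loop_winding \<sigma> z = arc_winding \<sigma> C1 C2 z + arc_winding \<sigma> C2 C z + arc_winding \<sigma> C C1 z"
proof -
  define R E V where "R = red T" and "E = emerald T" and "V = violet T"
  have c: "cyclic_colors T R E V" unfolding R_def E_def V_def by (rule red_emerald_violet)
  note c2 = cyclic_colors_rotate[OF c]
  note c3 = cyclic_colors_rotate[OF c2]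
  have z: "z \<notin> \<phi> ` \<sigma> ` closed_segment (corner \<sigma> R) (corner \<sigma> E)" "z \<notin> \<phi> ` \<sigma> ` closed_segment (corner \<sigma> E) (corner \<sigma> V)"
    "z \<notin> \<phi> ` \<sigma> ` closed_segment (corner \<sigma> V) (corner \<sigma> R)"
    using assms(3) unfolding std_frontier[OF corner_order_cyclic[OF assms(1) c]] by blast+
  note a1 = arc_side[OF assms(1) c] and a2 = arc_side[OF assms(1) c2] and a3 = arc_side[OF assms(1) c3]
  have "loop_winding \<sigma> z = arc_winding \<sigma> R E z + (arc_winding \<sigma> E V z + arc_winding \<sigma> V R z)"
    unfolding loop_winding_def arc_winding_def boundary_loop_eq corner_loop_def R_def[symmetric] E_def[symmetric] V_def[symmetric]
      comp_assoc[symmetric] path_compose_join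
    using a1 a2 a3 z
    by (subst winding_number_join, simp_all add: arc_imp_path path_image_join)
       (subst winding_number_join, simp_all add: arc_imp_path path_image_join)
  then show ?thesis using assms(2) unfolding cyclic_colors_def R_def E_def V_def by auto
qed

lemma loop_path:
  assumes "\<sigma> \<in> triangles T"
  shows "path (\<phi> \<circ> boundary_loop T \<sigma>)" "pathfinish (\<phi> \<circ> boundary_loop T \<sigma>) = pathstart (\<phi> \<circ> boundary_loop T \<sigma>)"
    "path_image (\<phi> \<circ> boundary_loop T \<sigma>) = \<phi> ` \<sigma> ` frontier std_triangle"
proof -
  interpret cell_in_chart base \<phi> \<psi> \<sigma> by (rule cell_chart[OF assms(1)])
  have co: "corner_order (corner \<sigma> (red T)) (corner \<sigma> (emerald T)) (corner \<sigma> (violet T))" using corner_order_cyclic[OF assms red_emerald_violet] .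
  show "path (\<phi> \<circ> boundary_loop T \<sigma>)" "pathfinish (\<phi> \<circ> boundary_loop T \<sigma>) = pathstart (\<phi> \<circ> boundary_loop T \<sigma>)"
    "path_image (\<phi> \<circ> boundary_loop T \<sigma>) = \<phi> ` \<sigma> ` frontier std_triangle"
    using bdry_simple[OF co] unfolding boundary_loop_eq by (simp_all add: comp_assoc simple_path_imp_path)
qed

lemma inner_region_props:
  assumes "\<sigma> \<in> triangles T"
  shows "inner_region \<sigma> \<noteq> {}" "connected (inner_region \<sigma>)" "inner_region \<sigma> \<inter> \<phi> ` skeleton = {}"
    "x \<in> \<sigma> ` frontier std_triangle \<Longrightarrow> \<phi> x \<in> closure (inner_region \<sigma>)"
proof -
  interpret cell_in_chart base \<phi> \<psi> \<sigma> by (rule cell_chart[OF assms(1)])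
  have co: "corner_order (corner \<sigma> (red T)) (corner \<sigma> (emerald T)) (corner \<sigma> (violet T))" using corner_order_cyclic[OF assms red_emerald_violet] .
  show "inner_region \<sigma> \<noteq> {}" "connected (inner_region \<sigma>)"
    unfolding inner_region_def open_triangle_def by (rule inner_outer)+
  have "open_triangle \<sigma> \<subseteq> S2" using cell_S2 closed_triangle_split[OF assms] by blast
  then have "open_triangle \<sigma> - {base} \<subseteq> S2 - {base}" by blast
  then have "\<phi> ` ((open_triangle \<sigma> - {base}) \<inter> skeleton) = inner_region \<sigma> \<inter> \<phi> ` skeleton"
    unfolding inner_region_def by (rule inj_on_image_Int[OF chart_inj _ skeleton_S2])
  then show "inner_region \<sigma> \<inter> \<phi> ` skeleton = {}" using skeleton_open_triangle[OF assms] by blast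
  show "\<phi> x \<in> closure (inner_region \<sigma>)" if "x \<in> \<sigma> ` frontier std_triangle"
    using inner_outer_Jordan(4)[OF co] that unfolding inner_region_def open_triangle_def bdry_simple(3)[OF co] by blast
qed

lemma inner_region_off_frontier:
  assumes "\<sigma> \<in> triangles T" "\<tau> \<in> triangles T" "a \<in> inner_region \<sigma>"
  shows "a \<notin> \<phi> ` \<tau> ` frontier std_triangle"
  using inner_region_props(3)[OF assms(1)] frontier_in_skeleton[OF assms(2)] assms(3) by blast

lemma loop_winding_const:
  assumes "\<sigma> \<in> triangles T" "\<tau> \<in> triangles T" "a \<in> inner_region \<tau>" "b \<in> inner_region \<tau>"
  shows "loop_winding \<sigma> a = loop_winding \<sigma> b"
proof -
  have "winding_number (\<phi> \<circ> boundary_loop T \<sigma>) constant_on inner_region \<tau>"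
  proof (rule winding_number_constant)
    show "inner_region \<tau> \<inter> path_image (\<phi> \<circ> boundary_loop T \<sigma>) = {}"
      unfolding loop_path(3)[OF assms(1)] using inner_region_props(3)[OF assms(2)] frontier_in_skeleton[OF assms(1)] by blast
  qed (use loop_path[OF assms(1)] inner_region_props(2)[OF assms(2)] in auto)
  then show ?thesis using assms(3,4) unfolding constant_on_def loop_winding_def by metis
qed

text \<open>
  The inside of another triangle lies outside of \<open>\<sigma>\<close>.
\<close>

lemma loop_winding_jump:
  assumes "\<sigma> \<in> triangles T" "\<tau> \<in> triangles T" "\<sigma> \<noteq> \<tau>" "a \<in> inner_region \<sigma>" "b \<in> inner_region \<tau>"
  shows "loop_winding \<sigma> a - loop_winding \<sigma> b = of_int (orientation \<sigma>)"
proof -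
  obtain x y where x: "x \<in> open_triangle \<sigma> - {base}" "a = \<phi> x" and y: "y \<in> open_triangle \<tau> - {base}" "b = \<phi> y"
    using assms(4,5) unfolding inner_region_def by blast
  have "y \<in> S2" using y closed_triangle_split[OF assms(2)] triangle_cell[OF assms(2)] unfolding triangle_cell_def by blast
  moreover have "y \<notin> \<sigma> ` std_triangle" using open_closed_triangle_disjoint[OF assms(2,1)] assms(3) y by blast
  ultimately have "y \<in> S2 - {base} - \<sigma> ` std_triangle" using y by blast
  then show ?thesis
    unfolding loop_winding_def x y
    by (intro orientation_winding[OF assms(1) sphere_chart_axioms base_generic]) (use x in \<open>auto simp: open_triangle_def\<close>)
qed

lemma chart_image_mem:
  assumes "x \<in> skeleton" "S \<subseteq> skeleton" "\<phi> x \<in> \<phi> ` S"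
  shows "x \<in> S"
  using assms chart_eq_iff skeleton_S2 by blast

text \<open>
  In the difference of the two boundaries the shared edge cancels. The winding number of the remaining sides is
  continuous at a point of the open edge, which is a limit of inner points of both triangles, hence it has the same
  value in both triangles. On the other hand, passing from \<open>\<sigma>\<close> to \<open>\<tau>\<close> changes it by the sum of both orientations.
\<close>

lemma opposite_orientations:
  assumes s: "\<sigma> \<in> triangles T" and t: "\<tau> \<in> triangles T" and ne: "\<sigma> \<noteq> \<tau>"
    and c: "cyclic_colors T C1 C2 C" and g: "g \<in> colored_edges T C" "contains_edge \<sigma> g" "contains_edge \<tau> g"
  shows "orientation \<sigma> + orientation \<tau> = 0"
proof -
  have gE: "g \<in> edges T" using g(1) unfolding colored_edges_def by auto
  obtain x where x: "x \<in> open_edge g" using open_edge_nonempty by blast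
  have xs: "x \<in> skeleton" using open_edge_skeleton[OF gE] x by blast
  note c2 = cyclic_colors_rotate[OF c]
  note c3 = cyclic_colors_rotate[OF c2]
  \<comment> \<open>the four sides that are not shared\<close>
  define F where "F = (\<lambda>z. arc_winding \<sigma> C2 C z + arc_winding \<sigma> C C1 z - (arc_winding \<tau> C2 C z + arc_winding \<tau> C C1 z))"
  have cont1: "isCont (arc_winding \<rho> C2 C) (\<phi> x)" "isCont (arc_winding \<rho> C C1) (\<phi> x)" if "\<rho> \<in> triangles T" for \<rho>
    using arc_winding_continuous[OF that c2, of "\<phi> x"] arc_winding_continuous[OF that c3, of "\<phi> x"]
      other_side_off[OF that c g(1) x] chart_image_mem[OF xs segment_in_skeleton[OF that c2]]
      chart_image_mem[OF xs segment_in_skeleton[OF that c3]] by blast+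
  have cont: "isCont F (\<phi> x)"
    unfolding F_def by (intro continuous_intros cont1 s t)
  have clos: "\<phi> x \<in> closure (inner_region \<rho>)" if "\<rho> \<in> triangles T" "contains_edge \<rho> g" for \<rho>
    using edge_point_in_triangle(2)[OF that(1) gE x] that x path_image_edge inner_region_props(4)[OF that(1)]
    unfolding contains_edge_def by blast
  have F: "F z = loop_winding \<sigma> z - loop_winding \<tau> z" if "z \<in> inner_region \<rho>" "\<rho> \<in> triangles T" for z \<rho>
  proof -
    have "z \<notin> \<phi> ` \<sigma> ` closed_segment (corner \<sigma> C1) (corner \<sigma> C2)" "z \<notin> \<phi> ` \<tau> ` closed_segment (corner \<tau> C1) (corner \<tau> C2)"
      using inner_region_props(3)[OF that(2)] that(1) segment_in_skeleton[OF s c] segment_in_skeleton[OF t c] by blast+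
    moreover have "node \<sigma> C1 = node \<tau> C1" "node \<sigma> C2 = node \<tau> C2"
      using side_nodes_agree[OF s t c g] .
    moreover have "\<sigma> ` closed_segment (corner \<sigma> C1) (corner \<sigma> C2) = \<tau> ` closed_segment (corner \<tau> C1) (corner \<tau> C2)"
      using contains_edge_side(1)[OF s c g(1,2)] contains_edge_side(1)[OF t c g(1,3)] by simp
    ultimately have "arc_winding \<sigma> C1 C2 z = arc_winding \<tau> C1 C2 z"
      unfolding arc_winding_def by (intro winding_number_same_arc) (simp_all add: arc_side[OF s c] arc_side[OF t c])
    then show ?thesis
      unfolding F_def loop_winding_sum[OF s c inner_region_off_frontier[OF that(2) s that(1)]]
        loop_winding_sum[OF t c inner_region_off_frontier[OF that(2) t that(1)]] by simp
  qed
  obtain a b where a: "a \<in> inner_region \<sigma>" and b: "b \<in> inner_region \<tau>" using inner_region_props(1) s t by blast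
  have "F a = F b"
  proof (rule const_limits_agree[OF cont clos[OF s g(2)] clos[OF t g(3)]])
    show "F z = F a" if "z \<in> inner_region \<sigma>" for z
      using F[OF that s] F[OF a s] loop_winding_const[OF s s that a] loop_winding_const[OF t s that a] by simp
    show "F z = F b" if "z \<in> inner_region \<tau>" for z
      using F[OF that t] F[OF b t] loop_winding_const[OF s t that b] loop_winding_const[OF t t that b] by simp
  qed
  then have "(loop_winding \<sigma> a - loop_winding \<sigma> b) + (loop_winding \<tau> b - loop_winding \<tau> a) = 0"
    unfolding F[OF a s] F[OF b t] by (simp add: algebra_simps)
  then have "of_int (orientation \<sigma> + orientation \<tau>) = (0::complex)"
    using loop_winding_jump[OF s t ne a b] loop_winding_jump[OF t s ne[symmetric] b a] by simp
  then show ?thesis by (simp only: of_int_eq_0_iff)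
qed

text \<open>
  A point of the open edge lies in some closed triangle and on its boundary. By the Jordan curve theorem it is also a limit of
  points outside this triangle, which are covered by the finitely many other closed triangles, up to the skeleton.
\<close>

lemma two_triangles_at_edge:
  assumes "g \<in> edges T"
  shows "\<exists>\<sigma>\<in>triangles T. \<exists>\<tau>\<in>triangles T. \<sigma> \<noteq> \<tau> \<and> contains_edge \<sigma> g \<and> contains_edge \<tau> g"
proof -
  obtain x where x: "x \<in> open_edge g" using open_edge_nonempty by blast
  have xb: "x \<in> S2 - {base}" using open_edge_skeleton[OF assms] x skeleton_S2 by blast
  then obtain \<sigma> where s: "\<sigma> \<in> triangles T" "x \<in> \<sigma> ` std_triangle" using point_in_closed_triangle by blast
  interpret cell_in_chart base \<phi> \<psi> \<sigma> by (rule cell_chart[OF s(1)])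
  have co: "corner_order (corner \<sigma> (red T)) (corner \<sigma> (emerald T)) (corner \<sigma> (violet T))" using corner_order_cyclic[OF s(1) red_emerald_violet] .
  define U where "U = S2 - \<sigma> ` std_triangle"
  note e = edge_point_in_triangle[OF s(1) assms x s(2)]
  have "\<phi> x \<in> closure cell_outer"
    using inner_outer_Jordan(5)[OF co] e(2) unfolding bdry_simple(3)[OF co] by blast
  moreover have "\<psi> ` closure cell_outer \<subseteq> closure U"
  proof (rule image_closure_subset)
    show "continuous_on (closure cell_outer) \<psi>" using homeo unfolding homeomorphism_def by (auto intro: continuous_on_subset)
    have "\<psi> ` cell_outer \<subseteq> U" using homeo unfolding homeomorphism_def U_def by auto
    then show "\<psi> ` cell_outer \<subseteq> closure U" using closure_subset by blast
  qed simp
  moreover have "\<psi> (\<phi> x) = x" using homeo xb unfolding homeomorphism_def by blast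
  ultimately have xU: "x \<in> closure U" by (metis image_subset_iff)
  have "open (- \<sigma> ` std_triangle)" using closed_triangle_closed[OF s(1)] by (rule open_Compl)
  then have oU: "openin (top_of_set S2) U" unfolding U_def Diff_eq by (intro openin_Int_open) auto
  have "\<exists>\<tau>\<in>triangles T - {\<sigma>}. x \<in> \<tau> ` std_triangle"
  proof (rule in_some_closed_triangle[OF oU xU])
    fix \<tau> assume "\<tau> \<in> triangles T" "open_triangle \<tau> \<inter> U \<noteq> {}"
    then show "\<tau> \<in> triangles T - {\<sigma>}" using closed_triangle_split[OF s(1)] unfolding U_def by blast
  qed blast
  then obtain \<tau> where t: "\<tau> \<in> triangles T" "\<tau> \<noteq> \<sigma>" "x \<in> \<tau> ` std_triangle" by blast
  then show ?thesis using e(1) s(1) edge_point_in_triangle(1)[OF t(1) assms x t(3)] by blast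
qed

section \<open>Cycles bound\<close>

text \<open>
  White triangles stand for the edges of the color opposite to \<open>C1\<close> and \<open>C2\<close>.
\<close>

definition chain_winding :: "(triangle \<Rightarrow> int) \<Rightarrow> point set \<Rightarrow> point set \<Rightarrow> complex \<Rightarrow> complex"
  where "chain_winding c C1 C2 z = (\<Sum>\<sigma>\<in>white_triangles T. of_int (c \<sigma>) * arc_winding \<sigma> C1 C2 z)"

text \<open>
  The winding number of each side is, up to an integer, the difference of the logarithms of \<open>\<phi> p - z\<close> at its ends.
  These differences cancel in a cycle.
\<close>

lemma chain_winding_integer:
  assumes c: "cyclic_colors T C1 C2 C"
    and zero1: "\<And>p. p \<in> C1 \<Longrightarrow> (\<Sum>\<sigma> | \<sigma> \<in> white_triangles T \<and> node \<sigma> C1 = p. c \<sigma>) = (0::int)"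
    and zero2: "\<And>p. p \<in> C2 \<Longrightarrow> (\<Sum>\<sigma> | \<sigma> \<in> white_triangles T \<and> node \<sigma> C2 = p. c \<sigma>) = (0::int)"
    and z: "\<And>\<sigma>. \<sigma> \<in> white_triangles T \<Longrightarrow> z \<notin> \<phi> ` \<sigma> ` closed_segment (corner \<sigma> C1) (corner \<sigma> C2)"
  shows "chain_winding c C1 C2 z \<in> \<int>"
proof -
  define L where "L = (\<lambda>p. Ln (\<phi> p - z) / (2 * of_real pi * \<i>))"
  have "\<exists>k. arc_winding \<sigma> C1 C2 z = of_int k + (L (node \<sigma> C2) - L (node \<sigma> C1))" if s: "\<sigma> \<in> white_triangles T" for \<sigma>
  proof -
    note a = arc_side[OF white_in_triangles[OF s] c]
    have zn: "z \<notin> path_image (\<phi> \<circ> \<sigma> \<circ> linepath (corner \<sigma> C1) (corner \<sigma> C2))" unfolding a(2) by (rule z[OF s])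
    have ends: "\<phi> (node \<sigma> C1) - z \<noteq> 0" "\<phi> (node \<sigma> C2) - z \<noteq> 0"
      using zn pathstart_in_path_image pathfinish_in_path_image a(3,4) by (metis eq_iff_diff_eq_0)+
    have "\<phi> (node \<sigma> C2) - z = exp (2 * of_real pi * \<i> * arc_winding \<sigma> C1 C2 z) * (\<phi> (node \<sigma> C1) - z)"
      using winding_number_exp_2pi[OF arc_imp_path[OF a(1)] zn] unfolding a(3,4) arc_winding_def by simp
    then have "exp (Ln (\<phi> (node \<sigma> C2) - z)) = exp (2 * of_real pi * \<i> * arc_winding \<sigma> C1 C2 z + Ln (\<phi> (node \<sigma> C1) - z))"
      using ends by (simp add: exp_add)
    then obtain n :: int where "Ln (\<phi> (node \<sigma> C2) - z) = 2 * of_real pi * \<i> * arc_winding \<sigma> C1 C2 z + Ln (\<phi> (node \<sigma> C1) - z) + (of_int (2 * n) * pi) * \<i>"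
      unfolding exp_eq by blast
    then have "arc_winding \<sigma> C1 C2 z = of_int (- n) + (L (node \<sigma> C2) - L (node \<sigma> C1))"
      unfolding L_def by (simp add: field_simps)
    then show ?thesis by blast
  qed
  then obtain k where k: "\<And>\<sigma>. \<sigma> \<in> white_triangles T \<Longrightarrow> arc_winding \<sigma> C1 C2 z = of_int (k \<sigma>) + (L (node \<sigma> C2) - L (node \<sigma> C1))"
    by metis
  have "chain_winding c C1 C2 z = (\<Sum>\<sigma>\<in>white_triangles T. of_int (c \<sigma> * k \<sigma>)
      + (of_int (c \<sigma>) * L (node \<sigma> C2) - of_int (c \<sigma>) * L (node \<sigma> C1)))"
    unfolding chain_winding_def by (intro sum.cong refl) (simp add: k algebra_simps)
  also have "\<dots> = of_int (\<Sum>\<sigma>\<in>white_triangles T. c \<sigma> * k \<sigma>)"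
  proof -
    have "(\<Sum>\<sigma>\<in>white_triangles T. of_int (c \<sigma>) * L (node \<sigma> C1)) = 0"
      by (rule sum_by_node[OF cyclic_members(1)[OF c] zero1])
    moreover have "(\<Sum>\<sigma>\<in>white_triangles T. of_int (c \<sigma>) * L (node \<sigma> C2)) = 0"
      by (rule sum_by_node[OF cyclic_members(2)[OF c] zero2])
    ultimately show ?thesis by (simp add: sum.distrib sum_subtractf)
  qed
  finally show ?thesis by (metis Ints_of_int)
qed

lemma segment_closed_points:
  assumes "\<rho> \<in> triangles T" "cyclic_colors T C1 C2 C" "x \<in> \<rho> ` closed_segment (corner \<rho> C1) (corner \<rho> C2)"
  shows "x \<in> (\<Union>g\<in>colored_edges T C. open_edge g) \<union> C1 \<union> C2"
proof -
  obtain g where g: "g \<in> colored_edges T C" "contains_edge \<rho> g" using triangle_side_unique[OF assms(1,2)] by blast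
  note e = contains_edge_side[OF assms(1,2) g]
  have "x \<in> open_edge g \<union> {node \<rho> C1, node \<rho> C2}" using assms(3) path_image_edge[of g] unfolding e(1)[symmetric] e(2)[symmetric] by simp
  then show ?thesis using g(1) corner_props(2)[OF assms(1)] cyclic_members(1,2)[OF assms(2)] by blast
qed

text \<open>
  A triangle together with its node in \<open>C\<close> is connected and avoids all edges of color \<open>C\<close>. Thus the value in the
  triangle can be read off at the point of \<open>C\<close>, where it is shared by all triangles at this point.
\<close>

lemma chain_winding_region:
  assumes c: "cyclic_colors T C1 C2 C" and s: "\<sigma> \<in> triangles T" and a: "a \<in> inner_region \<sigma>"
    and zero1: "\<And>p. p \<in> C1 \<Longrightarrow> (\<Sum>\<sigma> | \<sigma> \<in> white_triangles T \<and> node \<sigma> C1 = p. c \<sigma>) = (0::int)"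
    and zero2: "\<And>p. p \<in> C2 \<Longrightarrow> (\<Sum>\<sigma> | \<sigma> \<in> white_triangles T \<and> node \<sigma> C2 = p. c \<sigma>) = (0::int)"
  shows "chain_winding c C1 C2 a = chain_winding c C1 C2 (\<phi> (node \<sigma> C))"
proof -
  define N where "N = node \<sigma> C"
  have NC: "N \<in> C" unfolding N_def using corner_props(2)[OF s] cyclic_members(3)[OF c] by blast
  have Nsk: "N \<in> skeleton" using NC cyclic_members(7)[OF c] unfolding skeleton_def by blast
  define S where "S = insert (\<phi> N) (inner_region \<sigma>)"
  have "N \<in> \<sigma> ` frontier std_triangle"
  proof -
    have "corner \<sigma> C \<in> frontier std_triangle" using std_frontier[OF corner_order_cyclic[OF s c]] by simp
    then show ?thesis unfolding N_def node_def by blast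
  qed
  then have N_closure: "\<phi> N \<in> closure (inner_region \<sigma>)" by (rule inner_region_props(4)[OF s])
  have conn: "connected S"
  proof (rule connected_intermediate_closure[OF inner_region_props(2)[OF s]])
    show "inner_region \<sigma> \<subseteq> S" unfolding S_def by blast
    show "S \<subseteq> closure (inner_region \<sigma>)"
      unfolding S_def using N_closure closure_subset by blast
  qed
  have off: "z \<notin> \<phi> ` \<rho> ` closed_segment (corner \<rho> C1) (corner \<rho> C2)" if "z \<in> S" "\<rho> \<in> triangles T" for z \<rho>
  proof
    assume A: "z \<in> \<phi> ` \<rho> ` closed_segment (corner \<rho> C1) (corner \<rho> C2)"
    note sk = segment_in_skeleton[OF that(2) c]
    show False
    proof (cases "z = \<phi> N")
      case True
      then have "N \<in> \<rho> ` closed_segment (corner \<rho> C1) (corner \<rho> C2)" using chart_image_mem[OF Nsk sk] A by blast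
      then have "N \<in> (\<Union>g\<in>colored_edges T C. open_edge g) \<union> C1 \<union> C2" by (rule segment_closed_points[OF that(2) c])
      moreover have "N \<in> points" using NC cyclic_members(7)[OF c] by blast
      ultimately show False using NC cyclic_members(5,6)[OF c] points_edges unfolding colored_edges_def by blast
    next
      case False
      then have "z \<in> inner_region \<sigma>" using that(1) unfolding S_def by blast
      then show False using inner_region_props(3)[OF s] sk A by blast
    qed
  qed
  have cont: "continuous_on S (chain_winding c C1 C2)"
    unfolding chain_winding_def
    by (intro continuous_intros continuous_at_imp_continuous_on ballI arc_winding_continuous[OF _ c] off) (auto simp: white_in_triangles)
  show ?thesis unfolding N_def[symmetric]
    by (rule integer_valued_constant[OF conn cont])
       (use chain_winding_integer[OF c zero1 zero2] off white_in_triangles a in \<open>auto simp: S_def\<close>)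
qed

text \<open>
  Subtracting \<open>c \<sigma>\<close> times the boundary of the white triangle \<open>\<sigma>\<close> from the cycle removes the edge \<open>g\<close>, so the
  winding number of the result does not change across \<open>g\<close>. The jump is therefore that of the boundary of \<open>\<sigma>\<close>, which is
  \<open>- 1\<close> since \<open>\<sigma>\<close> is white.
\<close>

lemma chain_winding_jump:
  assumes c: "cyclic_colors T C1 C2 C" and s: "\<sigma> \<in> white_triangles T" and t: "\<tau> \<in> triangles T" "\<tau> \<noteq> \<sigma>"
    and g: "g \<in> colored_edges T C" "contains_edge \<sigma> g" "contains_edge \<tau> g"
    and zero1: "\<And>p. p \<in> C1 \<Longrightarrow> (\<Sum>\<sigma> | \<sigma> \<in> white_triangles T \<and> node \<sigma> C1 = p. c \<sigma>) = (0::int)"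
    and zero2: "\<And>p. p \<in> C2 \<Longrightarrow> (\<Sum>\<sigma> | \<sigma> \<in> white_triangles T \<and> node \<sigma> C2 = p. c \<sigma>) = (0::int)"
  shows "chain_winding c C1 C2 (\<phi> (node \<tau> C)) - chain_winding c C1 C2 (\<phi> (node \<sigma> C)) = of_int (c \<sigma>)"
proof -
  note sT = white_in_triangles[OF s]
  have gE: "g \<in> edges T" using g(1) unfolding colored_edges_def by auto
  obtain x where x: "x \<in> open_edge g" using open_edge_nonempty by blast
  have xs: "x \<in> skeleton" using open_edge_skeleton[OF gE] x by blast
  note c2 = cyclic_colors_rotate[OF c]
  note c3 = cyclic_colors_rotate[OF c2]
  \<comment> \<open>the chain without \<open>g\<close>, with the other two sides of \<open>\<sigma>\<close> instead\<close>
  define F where "F = (\<lambda>z. (\<Sum>\<rho>\<in>white_triangles T - {\<sigma>}. of_int (c \<rho>) * arc_winding \<rho> C1 C2 z)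
      - of_int (c \<sigma>) * (arc_winding \<sigma> C2 C z + arc_winding \<sigma> C C1 z))"
  have cont1: "isCont (arc_winding \<sigma> C2 C) (\<phi> x)" "isCont (arc_winding \<sigma> C C1) (\<phi> x)"
    using arc_winding_continuous[OF sT c2, of "\<phi> x"] arc_winding_continuous[OF sT c3, of "\<phi> x"]
      other_side_off[OF sT c g(1) x] chart_image_mem[OF xs segment_in_skeleton[OF sT c2]]
      chart_image_mem[OF xs segment_in_skeleton[OF sT c3]] by blast+
  have cont2: "isCont (arc_winding \<rho> C1 C2) (\<phi> x)" if r: "\<rho> \<in> white_triangles T - {\<sigma>}" for \<rho>
  proof -
    have rT: "\<rho> \<in> triangles T" using r white_in_triangles by blast
    have "x \<notin> \<rho> ` closed_segment (corner \<rho> C1) (corner \<rho> C2)"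
    proof
      assume "x \<in> \<rho> ` closed_segment (corner \<rho> C1) (corner \<rho> C2)"
      then have "contains_edge \<rho> g" by (rule side_point(1)[OF rT c gE x])
      then have "orientation \<rho> + orientation \<sigma> = 0" using opposite_orientations[OF rT sT _ c g(1) _ g(2)] r by blast
      then show False using r s unfolding orientation_def white_triangles_def by simp
    qed
    then show ?thesis
      using arc_winding_continuous[OF rT c, of "\<phi> x"] chart_image_mem[OF xs segment_in_skeleton[OF rT c]] by blast
  qed
  have cont: "isCont F (\<phi> x)"
    unfolding F_def by (intro continuous_intros cont1 cont2)
  have clos: "\<phi> x \<in> closure (inner_region \<rho>)" if "\<rho> \<in> triangles T" "contains_edge \<rho> g" for \<rho>
    using edge_point_in_triangle(2)[OF that(1) gE x] that x path_image_edge inner_region_props(4)[OF that(1)]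
    unfolding contains_edge_def by blast
  have F: "F z = chain_winding c C1 C2 z - of_int (c \<sigma>) * loop_winding \<sigma> z" if "z \<in> inner_region \<rho>" "\<rho> \<in> triangles T" for z \<rho>
    unfolding F_def chain_winding_def loop_winding_sum[OF sT c inner_region_off_frontier[OF that(2) sT that(1)]]
    by (simp add: sum.remove[OF finite_white s] algebra_simps)
  obtain a b where a: "a \<in> inner_region \<sigma>" and b: "b \<in> inner_region \<tau>" using inner_region_props(1) sT t(1) by blast
  note R = chain_winding_region[OF c _ _ zero1 zero2]
  have "F a = F b"
  proof (rule const_limits_agree[OF cont clos[OF sT g(2)] clos[OF t(1) g(3)]])
    show "F z = F a" if "z \<in> inner_region \<sigma>" for z
      using F[OF that sT] F[OF a sT] loop_winding_const[OF sT sT that a] R[OF sT that] R[OF sT a] by simp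
    show "F z = F b" if "z \<in> inner_region \<tau>" for z
      using F[OF that t(1)] F[OF b t(1)] loop_winding_const[OF sT t(1) that b] R[OF t(1) that] R[OF t(1) b] by simp
  qed
  then have "chain_winding c C1 C2 b - chain_winding c C1 C2 a = of_int (c \<sigma>) * - (loop_winding \<sigma> a - loop_winding \<sigma> b)"
    unfolding F[OF a sT] F[OF b t(1)] by (simp add: algebra_simps)
  also have "\<dots> = of_int (c \<sigma>)"
    using s unfolding loop_winding_jump[OF sT t(1) t(2)[symmetric] a b] orientation_def white_triangles_def by simp
  finally show ?thesis using R[OF sT a] R[OF t(1) b] by simp
qed

end

context trinity_complex
begin

lemma chart_exists: "\<exists>base \<phi> \<psi>. trinity_in_chart T base \<phi> \<psi>"
proof -
  obtain base where b: "base \<in> S2 - skeleton" using base_exists by blast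
  obtain \<phi> \<psi> where "sphere_chart base \<phi> \<psi>" using sphere_chart_exists b by blast
  then have "trinity_in_chart T base \<phi> \<psi>"
    using b by (intro trinity_in_chart.intro trinity_complex_axioms trinity_in_chart_axioms.intro) auto
  then show ?thesis by blast
qed

lemma edge_has_color:
  assumes "g \<in> edges T"
  obtains C1 C2 C where "cyclic_colors T C1 C2 C" "g \<in> colored_edges T C"
proof -
  have e: "pathstart g \<in> points" "pathfinish g \<in> points" using edge_ends[OF assms] by auto
  have "\<not> (pathstart g \<in> D \<and> pathfinish g \<in> D)" if "D \<in> colors" for D
    using edge_colors[OF assms that] .
  then have "\<exists>C\<in>colors. pathstart g \<notin> C \<and> pathfinish g \<notin> C"
    using e colors_disjoint by auto
  then obtain C where C: "C \<in> colors" "g \<in> colored_edges T C"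
    using assms unfolding colored_edges_def by blast
  moreover obtain C1 C2 where "cyclic_colors T C1 C2 C" using C(1) unfolding cyclic_colors_def by blast
  ultimately show ?thesis using that by blast
qed

text \<open>
  There are at least two triangles at the edge, and any two have opposite orientations.
\<close>

lemma white_black_at_edge:
  assumes "g \<in> edges T"
  shows "\<exists>!\<sigma>. \<sigma> \<in> white_triangles T \<and> contains_edge \<sigma> g" "\<exists>!\<sigma>. \<sigma> \<in> black_triangles T \<and> contains_edge \<sigma> g"
proof -
  obtain base \<phi> \<psi> where "trinity_in_chart T base \<phi> \<psi>" using chart_exists by blast
  then interpret trinity_in_chart T base \<phi> \<psi> .
  obtain C1 C2 C where c: "cyclic_colors T C1 C2 C" "g \<in> colored_edges T C" using edge_has_color[OF assms] .
  have opp: "white T \<sigma> \<noteq> white T \<tau>"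
    if "\<sigma> \<in> triangles T" "\<tau> \<in> triangles T" "\<sigma> \<noteq> \<tau>" "contains_edge \<sigma> g" "contains_edge \<tau> g" for \<sigma> \<tau>
    using opposite_orientations[OF that(1-3) c that(4,5)] unfolding orientation_def by (auto split: if_splits)
  obtain \<sigma> \<tau> where "\<sigma> \<in> triangles T" "\<tau> \<in> triangles T" "\<sigma> \<noteq> \<tau>" "contains_edge \<sigma> g" "contains_edge \<tau> g"
    using two_triangles_at_edge[OF assms] by blast
  then show "\<exists>!\<sigma>. \<sigma> \<in> white_triangles T \<and> contains_edge \<sigma> g" "\<exists>!\<sigma>. \<sigma> \<in> black_triangles T \<and> contains_edge \<sigma> g"
    using opp unfolding white_triangles_def black_triangles_def mem_Collect_eq by metis+
qed

lemma cycles_are_coboundaries: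
  assumes c: "cyclic_colors T C1 C2 C"
    and zero1: "\<And>p. p \<in> C1 \<Longrightarrow> (\<Sum>\<sigma> | \<sigma> \<in> white_triangles T \<and> node \<sigma> C1 = p. c \<sigma>) = (0::int)"
    and zero2: "\<And>p. p \<in> C2 \<Longrightarrow> (\<Sum>\<sigma> | \<sigma> \<in> white_triangles T \<and> node \<sigma> C2 = p. c \<sigma>) = (0::int)"
  obtains z :: "point \<Rightarrow> int" where "\<And>g. g \<in> colored_edges T C \<Longrightarrow>
    c (white_at T g) = z (node (black_at T g) C) - z (node (white_at T g) C)"
proof -
  obtain base \<phi> \<psi> where "trinity_in_chart T base \<phi> \<psi>" using chart_exists by blast
  then interpret trinity_in_chart T base \<phi> \<psi> .
  \<comment> \<open>the values at points of \<open>C\<close> are integers, so this merely changes the type\<close>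
  define z where "z = (\<lambda>p. \<lfloor>Re (chain_winding c C1 C2 (\<phi> p))\<rfloor>)"
  have int: "chain_winding c C1 C2 (\<phi> (node \<sigma> C)) = of_int (z (node \<sigma> C))" if s: "\<sigma> \<in> triangles T" for \<sigma>
  proof -
    obtain a where a: "a \<in> inner_region \<sigma>" using inner_region_props(1)[OF s] by blast
    have "chain_winding c C1 C2 a \<in> \<int>"
      using inner_region_props(3)[OF s] a segment_in_skeleton[OF white_in_triangles c]
      by (intro chain_winding_integer[OF c zero1 zero2]) blast+
    then have "chain_winding c C1 C2 (\<phi> (node \<sigma> C)) \<in> \<int>"
      using chain_winding_region[OF c s a zero1 zero2] by simp
    then show ?thesis unfolding z_def by (auto elim!: Ints_cases)
  qed
  show ?thesis
  proof (rule that[of z])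
    fix g assume g: "g \<in> colored_edges T C"
    then have gE: "g \<in> edges T" unfolding colored_edges_def by blast
    have w: "white_at T g \<in> white_triangles T" "contains_edge (white_at T g) g"
      using theI'[OF white_black_at_edge(1)[OF gE]] unfolding white_at_def by auto
    have b: "black_at T g \<in> black_triangles T" "contains_edge (black_at T g) g"
      using theI'[OF white_black_at_edge(2)[OF gE]] unfolding black_at_def by auto
    have bT: "black_at T g \<in> triangles T" and ne: "black_at T g \<noteq> white_at T g"
      using b(1) w(1) unfolding black_triangles_def white_triangles_def by auto
    have "of_int (z (node (black_at T g) C) - z (node (white_at T g) C)) = (of_int (c (white_at T g)) :: complex)"
      using chain_winding_jump[OF c w(1) bT ne g w(2) b(2) zero1 zero2] int[OF bT] int[OF white_in_triangles[OF w(1)]] by simp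
    then show "c (white_at T g) = z (node (black_at T g) C) - z (node (white_at T g) C)"
      by (simp only: of_int_eq_iff)
  qed
qed

text \<open>
  Otherwise the triangles in \<open>K\<close> and the others would cover the sphere by two closed sets that meet only in points
  of the triangulation: a common point on an open edge would make this edge a common edge. But the sphere
  without finitely many points is connected.
\<close>

lemma triangles_connected:
  assumes K: "K \<subseteq> triangles T" "K \<noteq> {}"
    and adj: "\<And>\<sigma> \<tau> g. \<sigma> \<in> K \<Longrightarrow> \<tau> \<in> triangles T \<Longrightarrow> g \<in> edges T \<Longrightarrow> contains_edge \<sigma> g \<Longrightarrow> contains_edge \<tau> g \<Longrightarrow> \<tau> \<in> K"
  shows "K = triangles T"
proof (rule ccontr)
  assume neq: "K \<noteq> triangles T"
  obtain base \<phi> \<psi> where "trinity_in_chart T base \<phi> \<psi>" using chart_exists by blast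
  then interpret trinity_in_chart T base \<phi> \<psi> .
  \<comment> \<open>the projection center is removed as well, as connectedness is taken from the plane\<close>
  define M where "M = S2 - {base} - points"
  have "connected (UNIV - \<phi> ` points)"
    using finite_parts(1) by (intro connected_open_diff_countable) (auto simp: countable_finite)
  then have "connected (\<psi> ` (UNIV - \<phi> ` points))"
    using homeo unfolding homeomorphism_def by (intro connected_continuous_image) (auto intro: continuous_on_subset)
  moreover have "\<psi> ` (UNIV - \<phi> ` points) = M"
  proof -
    have "\<psi> ` \<phi> ` points = points"
    proof -
      have "\<psi> (\<phi> p) = p" if "p \<in> points" for p
        using homeo that skeleton_S2 unfolding homeomorphism_def skeleton_def by blast
      then show ?thesis by (simp add: image_comp image_cong[of _ _ _ "\<lambda>x. x"])
    qed
    moreover have "\<psi> ` UNIV = S2 - {base}" "inj \<psi>"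
      using homeo unfolding homeomorphism_def by (auto intro: inj_on_inverseI[of _ \<phi>])
    ultimately show ?thesis unfolding M_def by (simp add: image_set_diff)
  qed
  ultimately have M: "connected M" by simp
  define X where "X = (\<Union>\<sigma>\<in>K. \<sigma> ` std_triangle)"
  define Y where "Y = (\<Union>\<sigma>\<in>triangles T - K. \<sigma> ` std_triangle)"
  have cl: "closed X" "closed Y"
    unfolding X_def Y_def using K(1) finite_parts(3) closed_triangle_closed by (auto intro!: closed_UN intro: finite_subset)
  have cov: "M \<subseteq> X \<union> Y"
  proof
    fix x assume "x \<in> M"
    then obtain \<sigma> where "\<sigma> \<in> triangles T" "x \<in> \<sigma> ` std_triangle"
      using point_in_closed_triangle[of x] unfolding M_def by blast
    then show "x \<in> X \<union> Y" unfolding X_def Y_def by (cases "\<sigma> \<in> K") blast+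
  qed
  have disj: "X \<inter> Y \<inter> M = {}"
  proof (rule ccontr)
    assume "X \<inter> Y \<inter> M \<noteq> {}"
    then obtain x \<sigma> \<tau> where x: "\<sigma> \<in> K" "x \<in> \<sigma> ` std_triangle" "\<tau> \<in> triangles T" "\<tau> \<notin> K" "x \<in> \<tau> ` std_triangle" "x \<in> M"
      unfolding X_def Y_def by blast
    have s: "\<sigma> \<in> triangles T" "\<sigma> \<noteq> \<tau>" using x K(1) by auto
    have "x \<notin> open_triangle \<sigma>" using open_closed_triangle_disjoint[OF s(1) x(3) s(2)] x(5) by blast
    then have "x \<in> skeleton" using closed_triangle_subset[OF s(1)] x(2) by blast
    then obtain g where g: "g \<in> edges T" "x \<in> open_edge g" using x(6) unfolding skeleton_eq M_def by blast
    then show False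
      using adj[OF x(1,3) g(1)] edge_point_in_triangle(1)[OF s(1) g x(2)] edge_point_in_triangle(1)[OF x(3) g x(5)] x(4) by blast
  qed
  have meets: "\<sigma> ` std_triangle \<inter> M \<noteq> {}" if s: "\<sigma> \<in> triangles T" for \<sigma>
  proof -
    obtain a where "a \<in> inner_region \<sigma>" using inner_region_props(1)[OF s] by blast
    then obtain y where y: "y \<in> open_triangle \<sigma>" "y \<noteq> base" unfolding inner_region_def by blast
    have "y \<in> \<sigma> ` std_triangle" using y closed_triangle_split[OF s] by blast
    moreover have "y \<in> S2" using calculation triangle_cell[OF s] unfolding triangle_cell_def by blast
    moreover have "y \<notin> points" using y(1) skeleton_open_triangle[OF s] unfolding skeleton_def by blast
    ultimately show ?thesis using y(2) unfolding M_def by blast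
  qed
  obtain \<sigma> where "\<sigma> \<in> K" using K(2) by blast
  then have "X \<inter> M \<noteq> {}" using meets[of \<sigma>] K(1) unfolding X_def by blast
  moreover obtain \<tau> where "\<tau> \<in> triangles T - K" using neq K(1) by blast
  then have "Y \<inter> M \<noteq> {}" using meets[of \<tau>] unfolding Y_def by blast
  ultimately show False using connected_closedD[OF M disj cov cl] by blast
qed

end

section \<open>Sandpile groups\<close>

lemma integer_group_simps: "carrier integer_group = UNIV" "x \<otimes>\<^bsub>integer_group\<^esub> y = x + y" "\<one>\<^bsub>integer_group\<^esub> = 0"
  by (simp_all add: integer_group_def)

lemma int_vectors_simps:
  "carrier (int_vectors W) = extensional W"
  "x \<otimes>\<^bsub>int_vectors W\<^esub> y = (\<lambda>w\<in>W. x w + y w)"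
  "\<one>\<^bsub>int_vectors W\<^esub> = (\<lambda>w\<in>W. 0)"
  unfolding int_vectors_def by (simp_all add: integer_group_simps PiE_UNIV_domain PiE_def Pi_def)

lemma Div0_simps:
  "carrier (Div0 D) = {x \<in> extensional (verts D). deg D x = 0}"
  "x \<otimes>\<^bsub>Div0 D\<^esub> y = (\<lambda>w\<in>verts D. x w + y w)"
  "\<one>\<^bsub>Div0 D\<^esub> = (\<lambda>w\<in>verts D. 0)"
  unfolding Div0_def Div_def by (simp_all add: int_vectors_simps)

lemma Div0_comm_group: "comm_group (Div0 D)"
proof (rule comm_groupI)
  fix x y assume "x \<in> carrier (Div0 D)" "y \<in> carrier (Div0 D)"
  then show "x \<otimes>\<^bsub>Div0 D\<^esub> y \<in> carrier (Div0 D)" by (simp add: Div0_simps deg_def sum.distrib)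
next
  fix x assume "x \<in> carrier (Div0 D)"
  then show "\<exists>y\<in>carrier (Div0 D). y \<otimes>\<^bsub>Div0 D\<^esub> x = \<one>\<^bsub>Div0 D\<^esub>"
    by (intro bexI[of _ "\<lambda>w\<in>verts D. - x w"]) (simp_all add: Div0_simps deg_def sum_negf cong: restrict_cong)
next
  fix x assume "x \<in> carrier (Div0 D)"
  then show "\<one>\<^bsub>Div0 D\<^esub> \<otimes>\<^bsub>Div0 D\<^esub> x = x" by (simp add: Div0_simps fun_eq_iff extensional_def restrict_def)
qed (simp_all add: Div0_simps deg_def ac_simps cong: restrict_cong)

lemma laplacian_mult_add: "w \<in> verts D \<Longrightarrow> laplacian_mult D (\<lambda>v. z v + z' v) w = laplacian_mult D z w + laplacian_mult D z' w"
  and laplacian_mult_minus: "w \<in> verts D \<Longrightarrow> laplacian_mult D (\<lambda>v. - z v) w = - laplacian_mult D z w"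
  and laplacian_mult_zero: "w \<in> verts D \<Longrightarrow> laplacian_mult D (\<lambda>v. 0) w = 0"
  by (simp_all add: laplacian_mult_def algebra_simps sum.distrib sum_negf)

lemma lin_equiv_iff:
  assumes "x \<in> carrier (Div0 D)" "y \<in> carrier (Div0 D)"
  shows "lin_equiv D x y \<longleftrightarrow> (\<exists>z. \<forall>w\<in>verts D. y w - x w = laplacian_mult D z w)"
proof
  assume "lin_equiv D x y"
  then obtain z where "y = (\<lambda>w\<in>verts D. x w + laplacian_mult D z w)"
    unfolding lin_equiv_def Div_def int_vectors_simps by blast
  then show "\<exists>z. \<forall>w\<in>verts D. y w - x w = laplacian_mult D z w" by auto
next
  assume "\<exists>z. \<forall>w\<in>verts D. y w - x w = laplacian_mult D z w"
  then obtain z where z: "\<And>w. w \<in> verts D \<Longrightarrow> y w - x w = laplacian_mult D z w" by blast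
  have "laplacian_mult D (restrict z (verts D)) = laplacian_mult D z"
    unfolding laplacian_mult_def by (intro restrict_ext sum.cong) auto
  then have "y = (\<lambda>w\<in>verts D. x w + laplacian_mult D (restrict z (verts D)) w)"
    using assms(2) z by (auto simp: Div0_simps fun_eq_iff extensional_def restrict_def algebra_simps)
  then show "lin_equiv D x y"
    unfolding lin_equiv_def Div_def int_vectors_simps by (intro bexI[of _ "restrict z (verts D)"]) auto
qed

lemma div_class_one_iff:
  "x \<in> div_class D \<one>\<^bsub>Div0 D\<^esub> \<longleftrightarrow>
    x \<in> carrier (Div0 D) \<and> (\<exists>z. \<forall>w\<in>verts D. x w = laplacian_mult D z w)"
proof -
  interpret comm_group "Div0 D" by (rule Div0_comm_group)
  show ?thesis unfolding div_class_def using lin_equiv_iff[OF one_closed, of x] by (auto simp: Div0_simps)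
qed

lemma div_class_one_subgroup: "subgroup (div_class D \<one>\<^bsub>Div0 D\<^esub>) (Div0 D)"
proof -
  interpret comm_group "Div0 D" by (rule Div0_comm_group)
  note mem = div_class_one_iff
  show ?thesis
  proof (rule subgroupI)
    show "div_class D \<one>\<^bsub>Div0 D\<^esub> \<subseteq> carrier (Div0 D)" unfolding div_class_def by blast
    have "\<one>\<^bsub>Div0 D\<^esub> \<in> div_class D \<one>\<^bsub>Div0 D\<^esub>"
      unfolding mem using one_closed laplacian_mult_zero by (auto simp: Div0_simps intro!: exI[of _ "\<lambda>v. 0"])
    then show "div_class D \<one>\<^bsub>Div0 D\<^esub> \<noteq> {}" by blast
  next
    fix x assume x: "x \<in> div_class D \<one>\<^bsub>Div0 D\<^esub>"
    then obtain z where xc: "x \<in> carrier (Div0 D)" and z: "\<forall>w\<in>verts D. x w = laplacian_mult D z w" using mem by blast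
    have "inv\<^bsub>Div0 D\<^esub> x = (\<lambda>w\<in>verts D. - x w)"
      using xc by (intro inv_equality) (simp_all add: Div0_simps deg_def sum_negf cong: restrict_cong)
    moreover have "\<forall>w\<in>verts D. - x w = laplacian_mult D (\<lambda>v. - z v) w"
      using z by (simp add: laplacian_mult_minus)
    ultimately show "inv\<^bsub>Div0 D\<^esub> x \<in> div_class D \<one>\<^bsub>Div0 D\<^esub>"
      unfolding mem using inv_closed[OF xc] by auto
  next
    fix x y assume x: "x \<in> div_class D \<one>\<^bsub>Div0 D\<^esub>" and y: "y \<in> div_class D \<one>\<^bsub>Div0 D\<^esub>"
    then obtain z z' where xc: "x \<in> carrier (Div0 D)" and z: "\<forall>w\<in>verts D. x w = laplacian_mult D z w"
      and yc: "y \<in> carrier (Div0 D)" and z': "\<forall>w\<in>verts D. y w = laplacian_mult D z' w" using mem by metis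
    have "\<forall>w\<in>verts D. (x \<otimes>\<^bsub>Div0 D\<^esub> y) w = laplacian_mult D (\<lambda>v. z v + z' v) w"
      using z z' by (intro ballI) (simp add: Div0_simps laplacian_mult_add)
    then show "x \<otimes>\<^bsub>Div0 D\<^esub> y \<in> div_class D \<one>\<^bsub>Div0 D\<^esub>" unfolding mem using m_closed[OF xc yc] by blast
  qed
qed

lemma div_class_eq_coset:
  assumes "x \<in> carrier (Div0 D)"
  shows "div_class D x = div_class D \<one>\<^bsub>Div0 D\<^esub> #>\<^bsub>Div0 D\<^esub> x"
proof -
  interpret comm_group "Div0 D" by (rule Div0_comm_group)
  note mem = div_class_one_iff
  show ?thesis
  proof (rule Set.set_eqI, rule iffI)
    fix y assume "y \<in> div_class D x"
    then have y: "y \<in> carrier (Div0 D)" and "lin_equiv D x y" unfolding div_class_def by auto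
    then obtain z where z: "\<forall>w\<in>verts D. y w - x w = laplacian_mult D z w" using lin_equiv_iff[OF assms] by blast
    define n where "n = (\<lambda>w\<in>verts D. y w - x w)"
    have "n \<in> carrier (Div0 D)" using assms y by (simp add: n_def Div0_simps deg_def sum_subtractf)
    then have "n \<in> div_class D \<one>\<^bsub>Div0 D\<^esub>"
      unfolding mem using z by (auto simp: n_def)
    moreover have "y = n \<otimes>\<^bsub>Div0 D\<^esub> x"
      using y by (auto simp: n_def Div0_simps fun_eq_iff extensional_def restrict_def)
    ultimately show "y \<in> div_class D \<one>\<^bsub>Div0 D\<^esub> #>\<^bsub>Div0 D\<^esub> x" unfolding r_coset_def by blast
  next
    fix y assume "y \<in> div_class D \<one>\<^bsub>Div0 D\<^esub> #>\<^bsub>Div0 D\<^esub> x"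
    then obtain n where n: "n \<in> div_class D \<one>\<^bsub>Div0 D\<^esub>" "y = n \<otimes>\<^bsub>Div0 D\<^esub> x" unfolding r_coset_def by blast
    then have nc: "n \<in> carrier (Div0 D)" and "\<exists>z. \<forall>w\<in>verts D. n w = laplacian_mult D z w" using mem by auto
    then have "\<exists>z. \<forall>w\<in>verts D. y w - x w = laplacian_mult D z w" using n(2) by (simp add: Div0_simps)
    moreover have "y \<in> carrier (Div0 D)" unfolding n(2) using nc assms by (rule m_closed)
    ultimately show "y \<in> div_class D x" unfolding div_class_def using lin_equiv_iff[OF assms] by blast
  qed
qed

lemma div_class_eq_iff:
  assumes "x \<in> carrier (Div0 D)" "y \<in> carrier (Div0 D)"
  shows "div_class D x = div_class D y \<longleftrightarrow> (\<exists>z. \<forall>w\<in>verts D. y w - x w = laplacian_mult D z w)"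
proof -
  interpret comm_group "Div0 D" by (rule Div0_comm_group)
  note sg = div_class_one_subgroup[of D]
  have "div_class D x = div_class D y \<longleftrightarrow> y \<in> div_class D x"
    using repr_independence[OF _ assms(1) sg, of y] rcos_self[OF assms(2) sg]
    unfolding div_class_eq_coset[OF assms(1)] div_class_eq_coset[OF assms(2)] by metis
  then show ?thesis using assms(2) lin_equiv_iff[OF assms] unfolding div_class_def by blast
qed

text \<open>
  The relation plays the role of a homomorphism that is only determined up to the two subgroups.
\<close>

lemma relation_induces_iso:
  assumes N: "N \<lhd> G" and M: "M \<lhd> H"
    and dom: "\<And>x y. R x y \<Longrightarrow> x \<in> carrier G \<and> y \<in> carrier H"
    and total: "\<And>x. x \<in> carrier G \<Longrightarrow> \<exists>y. R x y" and onto: "\<And>y. y \<in> carrier H \<Longrightarrow> \<exists>x. R x y"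
    and mult: "\<And>x y x' y'. R x y \<Longrightarrow> R x' y' \<Longrightarrow> R (x \<otimes>\<^bsub>G\<^esub> x') (y \<otimes>\<^bsub>H\<^esub> y')"
    and cosets: "\<And>x y x' y'. R x y \<Longrightarrow> R x' y' \<Longrightarrow> N #>\<^bsub>G\<^esub> x = N #>\<^bsub>G\<^esub> x' \<longleftrightarrow> M #>\<^bsub>H\<^esub> y = M #>\<^bsub>H\<^esub> y'"
    and f: "\<And>x y. R x y \<Longrightarrow> f (N #>\<^bsub>G\<^esub> x) = M #>\<^bsub>H\<^esub> y"
  shows "f \<in> iso (G Mod N) (H Mod M)"
proof (rule isoI)
  interpret N: normal N G by fact
  interpret M: normal M H by fact
  have cG: "carrier (G Mod N) = (\<lambda>x. N #>\<^bsub>G\<^esub> x) ` carrier G" and cH: "carrier (H Mod M) = (\<lambda>y. M #>\<^bsub>H\<^esub> y) ` carrier H"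
    unfolding FactGroup_def RCOSETS_def by auto
  show "f \<in> hom (G Mod N) (H Mod M)"
  proof (rule homI)
    fix X assume "X \<in> carrier (G Mod N)"
    then obtain x where x: "x \<in> carrier G" "X = N #>\<^bsub>G\<^esub> x" unfolding cG by blast
    obtain y where "R x y" using total x(1) by blast
    then show "f X \<in> carrier (H Mod M)" unfolding x(2) cH using f dom by blast
  next
    fix X X' assume "X \<in> carrier (G Mod N)" "X' \<in> carrier (G Mod N)"
    then obtain x x' where x: "x \<in> carrier G" "X = N #>\<^bsub>G\<^esub> x" "x' \<in> carrier G" "X' = N #>\<^bsub>G\<^esub> x'" unfolding cG by blast
    obtain y y' where y: "R x y" "R x' y'" using total x by metis
    have yc: "y \<in> carrier H" "y' \<in> carrier H" using y dom by blast+
    have "f (X \<otimes>\<^bsub>G Mod N\<^esub> X') = f (N #>\<^bsub>G\<^esub> (x \<otimes>\<^bsub>G\<^esub> x'))"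
      unfolding x using N.rcos_sum[OF x(1,3)] by (simp add: FactGroup_def)
    also have "\<dots> = M #>\<^bsub>H\<^esub> (y \<otimes>\<^bsub>H\<^esub> y')" by (rule f[OF mult[OF y]])
    also have "\<dots> = f X \<otimes>\<^bsub>H Mod M\<^esub> f X'"
      unfolding x f[OF y(1)] f[OF y(2)] using M.rcos_sum[OF yc] by (simp add: FactGroup_def)
    finally show "f (X \<otimes>\<^bsub>G Mod N\<^esub> X') = f X \<otimes>\<^bsub>H Mod M\<^esub> f X'" .
  qed
  show "bij_betw f (carrier (G Mod N)) (carrier (H Mod M))"
  proof (rule bij_betw_imageI)
    show "inj_on f (carrier (G Mod N))"
    proof (rule inj_onI)
      fix X X' assume "X \<in> carrier (G Mod N)" "X' \<in> carrier (G Mod N)" and e: "f X = f X'"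
      then obtain x x' where x: "x \<in> carrier G" "X = N #>\<^bsub>G\<^esub> x" "x' \<in> carrier G" "X' = N #>\<^bsub>G\<^esub> x'" unfolding cG by blast
      obtain y y' where y: "R x y" "R x' y'" using total x by metis
      show "X = X'" using e unfolding x f[OF y(1)] f[OF y(2)] using cosets[OF y] by blast
    qed
    show "f ` carrier (G Mod N) = carrier (H Mod M)"
    proof
      show "f ` carrier (G Mod N) \<subseteq> carrier (H Mod M)"
      proof (rule image_subsetI)
        fix X assume "X \<in> carrier (G Mod N)"
        then obtain x where x: "x \<in> carrier G" "X = N #>\<^bsub>G\<^esub> x" unfolding cG by blast
        obtain y where "R x y" using total x(1) by blast
        then show "f X \<in> carrier (H Mod M)" unfolding x(2) cH using f dom by blast
      qed
      show "carrier (H Mod M) \<subseteq> f ` carrier (G Mod N)"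
      proof
        fix Y assume "Y \<in> carrier (H Mod M)"
        then obtain y where y: "y \<in> carrier H" "Y = M #>\<^bsub>H\<^esub> y" unfolding cH by blast
        obtain x where x: "R x y" using onto y(1) by blast
        then have "f (N #>\<^bsub>G\<^esub> x) = Y" using f y(2) by simp
        moreover have "N #>\<^bsub>G\<^esub> x \<in> carrier (G Mod N)" unfolding cG using dom[OF x] by blast
        ultimately show "Y \<in> f ` carrier (G Mod N)" by blast
      qed
    qed
  qed
qed

section \<open>Boundaries of chains of white triangles\<close>

context trinity_complex
begin

definition boundary :: "(triangle \<Rightarrow> int) \<Rightarrow> point \<Rightarrow> int"
  where "boundary c p = (\<Sum>\<sigma>\<in>white_triangles T. c \<sigma> * indicator (nodes \<sigma>) p)"

lemma boundary_diff: "boundary (\<lambda>\<sigma>. c \<sigma> - d \<sigma>) p = boundary c p - boundary d p"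
  and boundary_add: "boundary (\<lambda>\<sigma>. c \<sigma> + d \<sigma>) p = boundary c p + boundary d p"
  and boundary_mult: "boundary (\<lambda>\<sigma>. k * c \<sigma>) p = k * boundary c p"
  and boundary_sum: "boundary (\<lambda>\<sigma>. \<Sum>i\<in>I. h i \<sigma>) p = (\<Sum>i\<in>I. boundary (h i) p)"
  unfolding boundary_def
  by (simp_all add: algebra_simps sum_subtractf sum.distrib sum_distrib_left sum_distrib_right)
     (rule sum.swap)

lemma finite_colors: "C \<in> colors \<Longrightarrow> finite C"
  using finite_parts(1) by auto

lemma color_is_cyclic:
  assumes "C \<in> colors"
  obtains C1 C2 where "cyclic_colors T C1 C2 C"
  using assms unfolding cyclic_colors_def by blast

lemma node_unique:
  assumes "\<sigma> \<in> triangles T" "C \<in> colors" "p \<in> C"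
  shows "p \<in> nodes \<sigma> \<longleftrightarrow> node \<sigma> C = p"
proof
  assume "p \<in> nodes \<sigma>"
  then obtain q where "q \<in> std_corners" "p = \<sigma> q" unfolding nodes_def by blast
  then show "node \<sigma> C = p" using corner_props(3)[OF assms(1,2)] assms(3) unfolding node_def by blast
next
  assume "node \<sigma> C = p"
  then show "p \<in> nodes \<sigma>" using corner_props(1)[OF assms(1,2)] unfolding node_def nodes_def by blast
qed

lemma boundary_at:
  assumes "C \<in> colors" "p \<in> C"
  shows "boundary c p = (\<Sum>\<sigma> | \<sigma> \<in> white_triangles T \<and> node \<sigma> C = p. c \<sigma>)"
proof -
  have "boundary c p = (\<Sum>\<sigma>\<in>white_triangles T. if node \<sigma> C = p then c \<sigma> else 0)"
    unfolding boundary_def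
    by (intro sum.cong refl) (simp add: node_unique[OF white_in_triangles assms] indicator_def)
  then show ?thesis by (simp add: sum.inter_filter[OF finite_white])
qed

lemma boundary_total:
  assumes "C \<in> colors"
  shows "(\<Sum>p\<in>C. boundary c p) = (\<Sum>\<sigma>\<in>white_triangles T. c \<sigma>)"
  using corner_props(2)[OF white_in_triangles assms]
  by (simp add: boundary_at[OF assms] cong: sum.cong) (intro sum.group finite_white finite_colors[OF assms], auto)

lemma at_edge:
  assumes "g \<in> colored_edges T C"
  shows "white_at T g \<in> white_triangles T" "contains_edge (white_at T g) g"
    "black_at T g \<in> black_triangles T" "contains_edge (black_at T g) g"
    "\<sigma> \<in> white_triangles T \<Longrightarrow> contains_edge \<sigma> g \<Longrightarrow> white_at T g = \<sigma>"
    "\<sigma> \<in> black_triangles T \<Longrightarrow> contains_edge \<sigma> g \<Longrightarrow> black_at T g = \<sigma>"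
proof -
  have g: "g \<in> edges T" using assms unfolding colored_edges_def by blast
  show "white_at T g \<in> white_triangles T" "contains_edge (white_at T g) g"
    "\<sigma> \<in> white_triangles T \<Longrightarrow> contains_edge \<sigma> g \<Longrightarrow> white_at T g = \<sigma>"
    using theI'[OF white_black_at_edge(1)[OF g]] white_black_at_edge(1)[OF g] unfolding white_at_def by blast+
  show "black_at T g \<in> black_triangles T" "contains_edge (black_at T g) g"
    "\<sigma> \<in> black_triangles T \<Longrightarrow> contains_edge \<sigma> g \<Longrightarrow> black_at T g = \<sigma>"
    using theI'[OF white_black_at_edge(2)[OF g]] white_black_at_edge(2)[OF g] unfolding black_at_def by blast+
qed

lemma black_in_triangles: "\<tau> \<in> black_triangles T \<Longrightarrow> \<tau> \<in> triangles T"
  unfolding black_triangles_def by blast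

lemma at_edge_bij:
  assumes "C \<in> colors"
  shows "bij_betw (white_at T) (colored_edges T C) (white_triangles T)"
    "bij_betw (black_at T) (colored_edges T C) (black_triangles T)"
proof -
  obtain C1 C2 where c: "cyclic_colors T C1 C2 C" using color_is_cyclic[OF assms] .
  note u = triangle_side_unique[OF _ c]
  show "bij_betw (white_at T) (colored_edges T C) (white_triangles T)"
  proof (rule bij_betw_imageI)
    show "inj_on (white_at T) (colored_edges T C)"
      using u[OF white_in_triangles[OF at_edge(1)]] at_edge(2) by (metis inj_onI)
    show "white_at T ` colored_edges T C = white_triangles T"
    proof
      show "white_at T ` colored_edges T C \<subseteq> white_triangles T" using at_edge(1) by blast
      show "white_triangles T \<subseteq> white_at T ` colored_edges T C"
      proof
        fix \<sigma> assume s: "\<sigma> \<in> white_triangles T"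
        obtain g where "g \<in> colored_edges T C" "contains_edge \<sigma> g" using u[OF white_in_triangles[OF s]] by blast
        then show "\<sigma> \<in> white_at T ` colored_edges T C" using at_edge(5)[OF _ s] by blast
      qed
    qed
  qed
  show "bij_betw (black_at T) (colored_edges T C) (black_triangles T)"
  proof (rule bij_betw_imageI)
    show "inj_on (black_at T) (colored_edges T C)"
      using u[OF black_in_triangles[OF at_edge(3)]] at_edge(4) by (metis inj_onI)
    show "black_at T ` colored_edges T C = black_triangles T"
    proof
      show "black_at T ` colored_edges T C \<subseteq> black_triangles T" using at_edge(3) by blast
      show "black_triangles T \<subseteq> black_at T ` colored_edges T C"
      proof
        fix \<sigma> assume s: "\<sigma> \<in> black_triangles T"
        obtain g where "g \<in> colored_edges T C" "contains_edge \<sigma> g" using u[OF black_in_triangles[OF s]] by blast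
        then show "\<sigma> \<in> black_at T ` colored_edges T C" using at_edge(6)[OF _ s] by blast
      qed
    qed
  qed
qed

lemma at_edge_node:
  assumes "C \<in> colors" "X \<in> colors" "X \<noteq> C" "g \<in> colored_edges T C"
  shows "node (white_at T g) X = node (black_at T g) X"
proof -
  obtain C1 C2 where c: "cyclic_colors T C1 C2 C" using color_is_cyclic[OF assms(1)] .
  have "X = C1 \<or> X = C2" using c assms(2,3) unfolding cyclic_colors_def by auto
  then show ?thesis
    using side_nodes_agree[OF white_in_triangles[OF at_edge(1)] black_in_triangles[OF at_edge(3)] c assms(4) at_edge(2,4), OF assms(4,4,4,4)] by blast
qed

lemma triangles_nonempty: "triangles T \<noteq> {}"
  using base_exists point_in_closed_triangle by blast

lemma colors_distinct: "red T \<noteq> emerald T" "emerald T \<noteq> violet T" "violet T \<noteq> red T"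
proof -
  obtain \<sigma> where "\<sigma> \<in> triangles T" using triangles_nonempty by blast
  then have "node \<sigma> (red T) \<in> red T" "node \<sigma> (emerald T) \<in> emerald T" using corner_props(2) by blast+
  then show "red T \<noteq> emerald T" "emerald T \<noteq> violet T" "violet T \<noteq> red T" using colors_disjoint by blast+
qed

lemma third_color:
  assumes "D \<in> colors" "D' \<in> colors"
  obtains C where "C \<in> colors" "C \<noteq> D" "C \<noteq> D'"
  using assms colors_distinct by (metis insertCI insertE singletonD)

lemma finite_colored_edges: "finite (colored_edges T C)"
  using finite_parts(2) unfolding colored_edges_def by simp

text \<open>
  Across the edges of a third color, the white triangles with node \<open>p\<close> in \<open>D\<close> are matched with the black
  ones, and the nodes in \<open>D\<close> and \<open>D'\<close> are shared. This is the form in which the alternation of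
  colors around a point is used.
\<close>

lemma white_black_balance:
  assumes "D \<in> colors" "D' \<in> colors"
  shows "(\<Sum>\<sigma> | \<sigma> \<in> white_triangles T \<and> node \<sigma> D = p. f (node \<sigma> D'))
    = (\<Sum>\<tau> | \<tau> \<in> black_triangles T \<and> node \<tau> D = p. f (node \<tau> D') :: int)"
proof -
  obtain C where C: "C \<in> colors" "C \<noteq> D" "C \<noteq> D'" using third_color[OF assms] .
  have fb: "finite (black_triangles T)" using finite_parts(3) unfolding black_triangles_def by simp
  have "(\<Sum>\<sigma> | \<sigma> \<in> white_triangles T \<and> node \<sigma> D = p. f (node \<sigma> D'))
      = (\<Sum>\<sigma>\<in>white_triangles T. if node \<sigma> D = p then f (node \<sigma> D') else 0)"
    by (simp add: sum.inter_filter[OF finite_white])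
  also have "\<dots> = (\<Sum>g\<in>colored_edges T C. if node (white_at T g) D = p then f (node (white_at T g) D') else 0)"
    by (rule sum.reindex_bij_betw[OF at_edge_bij(1)[OF C(1)], symmetric])
  also have "\<dots> = (\<Sum>g\<in>colored_edges T C. if node (black_at T g) D = p then f (node (black_at T g) D') else 0)"
    using C assms by (intro sum.cong refl) (simp add: at_edge_node[of C])
  also have "\<dots> = (\<Sum>\<tau>\<in>black_triangles T. if node \<tau> D = p then f (node \<tau> D') else 0)"
    by (rule sum.reindex_bij_betw[OF at_edge_bij(2)[OF C(1)]])
  also have "\<dots> = (\<Sum>\<tau> | \<tau> \<in> black_triangles T \<and> node \<tau> D = p. f (node \<tau> D'))"
    by (simp add: sum.inter_filter[OF fb])
  finally show ?thesis .
qed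

text \<open>
  This uses that the digraph is Eulerian: the diagonal of the Laplacian contains the outdegree, counted by black triangles,
  which has to be replaced by the indegree, counted by white triangles.
\<close>

lemma laplacian_color_digraph:
  assumes C: "C \<in> colors" and u: "u \<in> C"
  shows "laplacian_mult (color_digraph T C) z u
    = (\<Sum>g | g \<in> colored_edges T C \<and> node (white_at T g) C = u.
        z (node (black_at T g) C) - z (node (white_at T g) C))"
proof -
  let ?D = "color_digraph T C" and ?t = "\<lambda>g. node (black_at T g) C" and ?h = "\<lambda>g. node (white_at T g) C"
  note fe = finite_colored_edges[of C] and fC = finite_colors[OF C]
  have D: "verts ?D = C" "arcs ?D = colored_edges T C" "tail ?D = ?t" "head ?D = ?h" by (simp_all add: color_digraph_def)
  have tC: "?t g \<in> C" if "g \<in> colored_edges T C" for g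
    using corner_props(2)[OF black_in_triangles[OF at_edge(3)[OF that]] C] .
  have fb: "finite (black_triangles T)" using finite_parts(3) unfolding black_triangles_def by simp
  have "int (card {g \<in> colored_edges T C. ?t g = u}) = (\<Sum>g\<in>colored_edges T C. if ?t g = u then 1 else 0)"
    using fe by (simp add: sum.inter_filter[symmetric] del: sum.If_cases)
  also have "\<dots> = (\<Sum>\<tau>\<in>black_triangles T. if node \<tau> C = u then 1 else 0)"
    by (rule sum.reindex_bij_betw[OF at_edge_bij(2)[OF C]])
  also have "\<dots> = (\<Sum>\<sigma>\<in>white_triangles T. if node \<sigma> C = u then 1 else 0)"
    using white_black_balance[OF C C, of "\<lambda>_. 1" u] by (simp only: sum.inter_filter[OF finite_white] sum.inter_filter[OF fb])
  also have "\<dots> = (\<Sum>g\<in>colored_edges T C. if ?h g = u then 1 else 0)"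
    by (rule sum.reindex_bij_betw[OF at_edge_bij(1)[OF C], symmetric])
  also have "\<dots> = int (card {g \<in> colored_edges T C. ?h g = u})"
    using fe by (simp add: sum.inter_filter[symmetric])
  finally have out: "int (out_degree ?D u) = int (card {g \<in> colored_edges T C. ?h g = u})"
    by (simp add: out_degree_def out_arcs_def D)
  have lap: "laplacian ?D u v = int (edge_count ?D v u) - (if v = u then int (out_degree ?D u) else 0)" for v
    unfolding laplacian_def by simp
  have ec: "int (edge_count ?D v u) * z v = (\<Sum>g | g \<in> {g \<in> colored_edges T C. ?h g = u} \<and> ?t g = v. z (?t g))" for v
  proof -
    have "{g \<in> colored_edges T C. ?t g = v \<and> ?h g = u} = {g \<in> {g \<in> colored_edges T C. ?h g = u}. ?t g = v}" by blast
    then show ?thesis by (simp add: edge_count_def D)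
  qed
  have "laplacian_mult ?D z u = (\<Sum>v\<in>C. laplacian ?D u v * z v)"
    using u by (simp add: laplacian_mult_def D)
  also have "\<dots> = (\<Sum>v\<in>C. int (edge_count ?D v u) * z v - (if v = u then int (out_degree ?D u) * z u else 0))"
    unfolding lap by (intro sum.cong refl) (simp add: algebra_simps)
  also have "\<dots> = (\<Sum>v\<in>C. int (edge_count ?D v u) * z v) - int (out_degree ?D u) * z u"
    using u fC by (simp add: sum_subtractf)
  also have "(\<Sum>v\<in>C. int (edge_count ?D v u) * z v) = (\<Sum>g | g \<in> colored_edges T C \<and> ?h g = u. z (?t g))"
    unfolding ec using tC fC fe by (intro sum.group) auto
  also have "int (out_degree ?D u) * z u = (\<Sum>g | g \<in> colored_edges T C \<and> ?h g = u. z (?h g))"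
    unfolding out by simp
  finally show ?thesis by (simp add: sum_subtractf)
qed

lemma boundary_edges:
  assumes "C \<in> colors" "D \<in> colors" "p \<in> D"
  shows "boundary c p = (\<Sum>g | g \<in> colored_edges T C \<and> node (white_at T g) D = p. c (white_at T g))"
proof -
  have "boundary c p = (\<Sum>\<sigma>\<in>white_triangles T. if node \<sigma> D = p then c \<sigma> else 0)"
    unfolding boundary_at[OF assms(2,3)] by (simp add: sum.inter_filter[OF finite_white])
  also have "\<dots> = (\<Sum>g\<in>colored_edges T C. if node (white_at T g) D = p then c (white_at T g) else 0)"
    by (rule sum.reindex_bij_betw[OF at_edge_bij(1)[OF assms(1)], symmetric])
  finally show ?thesis by (simp add: sum.inter_filter[OF finite_colored_edges])
qed

text \<open>
  The coefficient of a white triangle is the difference of \<open>z\<close> along the arc that corresponds to its edge of color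
  \<open>C\<close>. On \<open>C\<close> this sums up to the Laplacian. At a point of another class, the two parts of the difference
  are sums over the black and the white triangles there, which agree by \<open>white_black_balance\<close>.
\<close>

lemma laplacian_is_boundary:
  assumes C: "C \<in> colors"
  obtains c where "\<And>p. p \<in> C \<Longrightarrow> boundary c p = laplacian_mult (color_digraph T C) z p"
    "\<And>D p. D \<in> colors \<Longrightarrow> D \<noteq> C \<Longrightarrow> p \<in> D \<Longrightarrow> boundary c p = 0"
proof -
  define side where "side = inv_into (colored_edges T C) (white_at T)"
  define c where "c = (\<lambda>\<sigma>. z (node (black_at T (side \<sigma>)) C) - z (node \<sigma> C))"
  have cg: "c (white_at T g) = z (node (black_at T g) C) - z (node (white_at T g) C)" if "g \<in> colored_edges T C" for g
    unfolding c_def side_def using inv_into_f_f[OF bij_betw_imp_inj_on[OF at_edge_bij(1)[OF C]] that] by simp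
  have 1: "boundary c p = laplacian_mult (color_digraph T C) z p" if "p \<in> C" for p
    unfolding boundary_edges[OF C C that] laplacian_color_digraph[OF C that] by (intro sum.cong refl) (simp add: cg)
  have 2: "boundary c p = 0" if D: "D \<in> colors" "D \<noteq> C" "p \<in> D" for D p
  proof -
    have fb: "finite (black_triangles T)" using finite_parts(3) unfolding black_triangles_def by simp
    have "boundary c p = (\<Sum>g | g \<in> colored_edges T C \<and> node (white_at T g) D = p. z (node (black_at T g) C) - z (node (white_at T g) C))"
      unfolding boundary_edges[OF C D(1,3)] by (intro sum.cong refl) (simp add: cg)
    also have "\<dots> = (\<Sum>g\<in>colored_edges T C. if node (black_at T g) D = p then z (node (black_at T g) C) else 0)
        - (\<Sum>g\<in>colored_edges T C. if node (white_at T g) D = p then z (node (white_at T g) C) else 0)"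
      using at_edge_node[OF C D(1,2)] unfolding sum.inter_filter[OF finite_colored_edges] sum_subtractf[symmetric]
      by (intro sum.cong refl) simp
    also have "(\<Sum>g\<in>colored_edges T C. if node (black_at T g) D = p then z (node (black_at T g) C) else 0)
        = (\<Sum>\<tau>\<in>black_triangles T. if node \<tau> D = p then z (node \<tau> C) else 0)"
      by (rule sum.reindex_bij_betw[OF at_edge_bij(2)[OF C]])
    also have "(\<Sum>g\<in>colored_edges T C. if node (white_at T g) D = p then z (node (white_at T g) C) else 0)
        = (\<Sum>\<sigma>\<in>white_triangles T. if node \<sigma> D = p then z (node \<sigma> C) else 0)"
      by (rule sum.reindex_bij_betw[OF at_edge_bij(1)[OF C]])
    finally show ?thesis
      using white_black_balance[OF D(1) C, of z p] by (simp only: sum.inter_filter[OF finite_white] sum.inter_filter[OF fb])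
  qed
  show ?thesis by (rule that[of c, OF 1 2])
qed

lemma boundary_is_laplacian:
  assumes C: "C \<in> colors" and zero: "\<And>D p. D \<in> colors \<Longrightarrow> D \<noteq> C \<Longrightarrow> p \<in> D \<Longrightarrow> boundary c p = 0"
  obtains z where "\<And>p. p \<in> C \<Longrightarrow> boundary c p = laplacian_mult (color_digraph T C) z p"
proof -
  obtain C1 C2 where cyc: "cyclic_colors T C1 C2 C" using color_is_cyclic[OF C] .
  note m = cyclic_members[OF cyc]
  have ne: "C1 \<noteq> C" "C2 \<noteq> C" using cyc colors_distinct unfolding cyclic_colors_def by auto
  have z1: "(\<Sum>\<sigma> | \<sigma> \<in> white_triangles T \<and> node \<sigma> C1 = p. c \<sigma>) = 0" if "p \<in> C1" for p
    using zero[OF m(1) ne(1) that] boundary_at[OF m(1) that] by simp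
  have z2: "(\<Sum>\<sigma> | \<sigma> \<in> white_triangles T \<and> node \<sigma> C2 = p. c \<sigma>) = 0" if "p \<in> C2" for p
    using zero[OF m(2) ne(2) that] boundary_at[OF m(2) that] by simp
  obtain z :: "point \<Rightarrow> int" where z: "\<And>g. g \<in> colored_edges T C \<Longrightarrow>
    c (white_at T g) = z (node (black_at T g) C) - z (node (white_at T g) C)"
    using cycles_are_coboundaries[OF cyc z1 z2] by blast
  show ?thesis
  proof (rule that[of z])
    fix p assume p: "p \<in> C"
    show "boundary c p = laplacian_mult (color_digraph T C) z p"
      unfolding boundary_edges[OF C C p] laplacian_color_digraph[OF C p] by (intro sum.cong refl) (simp add: z)
  qed
qed

text \<open>
  Subtracting a chain whose boundary is the Laplacian on \<open>C\<close> and zero elsewhere leaves a chain whose boundary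
  is supported on \<open>D\<close>.
\<close>

lemma laplacian_transfer:
  assumes C: "C \<in> colors" and D: "D \<in> colors" and ne: "C \<noteq> D"
    and b: "\<And>p. p \<in> C \<Longrightarrow> boundary c p = laplacian_mult (color_digraph T C) z p"
    and zero: "\<And>X p. X \<in> colors \<Longrightarrow> X \<noteq> C \<Longrightarrow> X \<noteq> D \<Longrightarrow> p \<in> X \<Longrightarrow> boundary c p = 0"
  obtains z' where "\<And>p. p \<in> D \<Longrightarrow> boundary c p = laplacian_mult (color_digraph T D) z' p"
proof -
  obtain d where d: "\<And>p. p \<in> C \<Longrightarrow> boundary d p = laplacian_mult (color_digraph T C) z p"
    "\<And>D p. D \<in> colors \<Longrightarrow> D \<noteq> C \<Longrightarrow> p \<in> D \<Longrightarrow> boundary d p = 0"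
    using laplacian_is_boundary[OF C, of z] by blast
  have "boundary (\<lambda>\<sigma>. c \<sigma> - d \<sigma>) p = 0" if "X \<in> colors" "X \<noteq> D" "p \<in> X" for X p
    using that b d zero unfolding boundary_diff by (cases "X = C") auto
  then obtain z' where z': "\<And>p. p \<in> D \<Longrightarrow> boundary (\<lambda>\<sigma>. c \<sigma> - d \<sigma>) p = laplacian_mult (color_digraph T D) z' p"
    using boundary_is_laplacian[OF D, of "\<lambda>\<sigma>. c \<sigma> - d \<sigma>"] by blast
  show ?thesis
    by (rule that[of z']) (use z' d(2)[OF D ne[symmetric]] in \<open>simp add: boundary_diff\<close>)
qed

text \<open>
  Two white triangles with a common node in \<open>D\<close> give the difference of their nodes in \<open>C\<close>. Adjacent triangles have the
  same node in \<open>C\<close>, unless they share an edge of color \<open>C\<close>; then they have the same node in \<open>D\<close>. A black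
  triangle is replaced by the white one across its edge of the third color, which has the same nodes in \<open>C\<close> and \<open>D\<close>.
\<close>

lemma point_difference_is_boundary:
  assumes C: "C \<in> colors" and D: "D \<in> colors" "D \<noteq> C" and v: "v \<in> C" "w \<in> C"
  shows "\<exists>c. (\<forall>p\<in>C. boundary c p = (if p = v then 1 else 0) - (if p = w then 1 else 0)) \<and> (\<forall>p\<in>D. boundary c p = 0)"
    (is "?conn v w")
proof -
  obtain X where X: "X \<in> colors" "X \<noteq> C" "X \<noteq> D" using third_color[OF C D(1)] .
  have refl: "?conn u u" for u by (intro exI[of _ "\<lambda>\<sigma>. 0"]) (simp add: boundary_def)
  have trans: "?conn a b \<Longrightarrow> ?conn b d \<Longrightarrow> ?conn a d" for a b d
  proof -
    assume "?conn a b" "?conn b d"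
    then obtain c c' where
      c: "\<forall>p\<in>C. boundary c p = (if p = a then 1 else 0) - (if p = b then 1 else 0)" "\<forall>p\<in>D. boundary c p = 0" and
      c': "\<forall>p\<in>C. boundary c' p = (if p = b then 1 else 0) - (if p = d then 1 else 0)" "\<forall>p\<in>D. boundary c' p = 0" by blast
    show "?conn a d" by (intro exI[of _ "\<lambda>\<sigma>. c \<sigma> + c' \<sigma>"]) (use c c' in \<open>simp add: boundary_add\<close>)
  qed
  have white: "?conn (node \<sigma> C) (node \<tau> C)"
    if s: "\<sigma> \<in> white_triangles T" and t: "\<tau> \<in> white_triangles T" and e: "node \<sigma> D = node \<tau> D" for \<sigma> \<tau>
  proof (intro exI conjI ballI)
    \<comment> \<open>the difference of the two triangles\<close>
    let ?c = "\<lambda>\<rho>. (if \<rho> = \<sigma> then 1 else 0) - (if \<rho> = \<tau> then 1 else (0::int))"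
    have b: "boundary ?c p = (if node \<sigma> Y = p then 1 else 0) - (if node \<tau> Y = p then 1 else 0)" if "Y \<in> colors" "p \<in> Y" for Y p
    proof -
      have "boundary ?c p = (\<Sum>\<rho>\<in>white_triangles T. if node \<rho> Y = p then ?c \<rho> else 0)"
        unfolding boundary_at[OF that] by (simp add: sum.inter_filter[OF finite_white])
      also have "\<dots> = (\<Sum>\<rho>\<in>white_triangles T. (if \<rho> = \<sigma> then (if node \<sigma> Y = p then 1 else 0) else 0) - (if \<rho> = \<tau> then (if node \<tau> Y = p then 1 else 0) else 0))"
        by (intro sum.cong refl) auto
      also have "\<dots> = (if node \<sigma> Y = p then 1 else 0) - (if node \<tau> Y = p then 1 else 0)"
        unfolding sum_subtractf sum.delta[OF finite_white] using s t by simp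
      finally show ?thesis .
    qed
    show "boundary ?c p = (if p = node \<sigma> C then 1 else 0) - (if p = node \<tau> C then 1 else 0)" if "p \<in> C" for p
      using b[OF C that] by auto
    show "boundary ?c p = 0" if "p \<in> D" for p using b[OF D(1) that] e by simp
  qed
  have near: "\<exists>\<sigma>'\<in>white_triangles T. node \<sigma>' C = node \<sigma> C \<and> node \<sigma>' D = node \<sigma> D" if s: "\<sigma> \<in> triangles T" for \<sigma>
  proof (cases "\<sigma> \<in> white_triangles T")
    case False
    then have "\<sigma> \<in> black_triangles T" using s unfolding white_triangles_def black_triangles_def by blast
    then obtain g where g: "g \<in> colored_edges T X" "black_at T g = \<sigma>"
      using bij_betw_imp_surj_on[OF at_edge_bij(2)[OF X(1)]] by (metis imageE)
    then show ?thesis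
      using at_edge_node[OF X(1) C _ g(1)] at_edge_node[OF X(1) D(1) _ g(1)] at_edge(1)[OF g(1)] X by metis
  qed blast
  obtain \<sigma>0 \<sigma>1 where s0: "\<sigma>0 \<in> triangles T" "v = node \<sigma>0 C" and s1: "\<sigma>1 \<in> triangles T" "w = node \<sigma>1 C"
    using point_is_node[OF C] v by blast
  define K where "K = {\<sigma> \<in> triangles T. ?conn v (node \<sigma> C)}"
  have "K = triangles T"
  proof (rule triangles_connected)
    show "K \<subseteq> triangles T" unfolding K_def by blast
    have "\<sigma>0 \<in> K" unfolding K_def using s0 refl by simp
    then show "K \<noteq> {}" by blast
    fix \<sigma> \<tau> g
    assume s: "\<sigma> \<in> K" and t: "\<tau> \<in> triangles T" and g: "g \<in> edges T" "contains_edge \<sigma> g" "contains_edge \<tau> g"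
    have sT: "\<sigma> \<in> triangles T" using s unfolding K_def by blast
    obtain Y1 Y2 Y where Y: "cyclic_colors T Y1 Y2 Y" "g \<in> colored_edges T Y" using edge_has_color[OF g(1)] .
    have ag: "node \<sigma> Z = node \<tau> Z" if "Z \<in> colors" "Z \<noteq> Y" for Z
    proof -
      have "Z = Y1 \<or> Z = Y2" using Y(1) that unfolding cyclic_colors_def by auto
      then show ?thesis using side_nodes_agree[OF sT t Y g(2,3)] by blast
    qed
    have "?conn (node \<sigma> C) (node \<tau> C)"
    proof (cases "Y = C")
      case False
      then show ?thesis using ag[OF C] refl by metis
    next
      case True
      then have "node \<sigma> D = node \<tau> D" using ag[OF D(1)] D(2) by metis
      then show ?thesis using near[OF sT] near[OF t] white by metis
    qed
    then show "\<tau> \<in> K" using s t trans unfolding K_def by blast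
  qed
  then show ?thesis using s1 unfolding K_def by blast
qed

lemma degree_zero_is_boundary:
  assumes C: "C \<in> colors" and D: "D \<in> colors" "D \<noteq> C" and x: "(\<Sum>p\<in>C. x p) = (0::int)"
  obtains c where "\<And>p. p \<in> C \<Longrightarrow> boundary c p = x p" "\<And>p. p \<in> D \<Longrightarrow> boundary c p = 0"
proof (cases "C = {}")
  case True
  obtain \<sigma> where "\<sigma> \<in> triangles T" using triangles_nonempty by blast
  then show ?thesis using corner_props(2)[OF _ C] True by blast
next
  case False
  then obtain w where w: "w \<in> C" by blast
  have "\<forall>v\<in>C. \<exists>c. (\<forall>p\<in>C. boundary c p = (if p = v then 1 else 0) - (if p = w then 1 else 0)) \<and> (\<forall>p\<in>D. boundary c p = 0)"
    using point_difference_is_boundary[OF C D _ w] by blast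
  then obtain h where h: "\<And>v p. v \<in> C \<Longrightarrow> p \<in> C \<Longrightarrow> boundary (h v) p = (if p = v then 1 else 0) - (if p = w then 1 else 0)"
    "\<And>v p. v \<in> C \<Longrightarrow> p \<in> D \<Longrightarrow> boundary (h v) p = 0" by metis
  define c where "c = (\<lambda>\<sigma>. \<Sum>v\<in>C. x v * h v \<sigma>)"
  have bc: "boundary c p = (\<Sum>v\<in>C. x v * boundary (h v) p)" for p
    unfolding c_def boundary_sum boundary_mult ..
  show ?thesis
  proof (rule that[of c])
    fix p assume p: "p \<in> C"
    have "boundary c p = (\<Sum>v\<in>C. (if p = v then x v else 0) - x v * (if p = w then 1 else 0))"
      unfolding bc by (intro sum.cong refl) (simp add: h(1) p algebra_simps)
    also have "\<dots> = x p - (\<Sum>v\<in>C. x v) * (if p = w then 1 else 0)"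
      unfolding sum_subtractf sum_distrib_right using p finite_colors[OF C] by simp
    finally show "boundary c p = x p" using x by simp
  next
    fix p assume "p \<in> D"
    then show "boundary c p = 0" unfolding bc by (simp add: h(2))
  qed
qed

lemma Div0_D:
  "x \<in> carrier (Div0 (D_V T)) \<longleftrightarrow> x \<in> extensional (violet T) \<and> (\<Sum>p\<in>violet T. x p) = 0"
  "x \<in> carrier (Div0 (D_E T)) \<longleftrightarrow> x \<in> extensional (emerald T) \<and> (\<Sum>p\<in>emerald T. x p) = 0"
  unfolding Div0_simps deg_def D_V_def D_E_def color_digraph_def by auto

text \<open>
  The sign in front of \<open>y\<close> turns the equivalence of the two triples into a statement that is symmetric in violet
  and emerald.
\<close>

lemma phi_related_iff:
  "phi_related T x y \<longleftrightarrow> x \<in> carrier (Div0 (D_V T)) \<and> y \<in> carrier (Div0 (D_E T)) \<and>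
    (\<exists>c. (\<forall>p\<in>violet T. boundary c p = x p) \<and> (\<forall>p\<in>emerald T. boundary c p = y p) \<and> (\<forall>p\<in>red T. boundary c p = 0))"
proof -
  have "(\<forall>p\<in>all_points T. triple T x (\<lambda>_. 0) (\<lambda>_. 0) p - triple T (\<lambda>_. 0) (\<lambda>p. - y p) (\<lambda>_. 0) p = boundary c p) \<longleftrightarrow>
    (\<forall>p\<in>violet T. boundary c p = x p) \<and> (\<forall>p\<in>emerald T. boundary c p = y p) \<and> (\<forall>p\<in>red T. boundary c p = 0)" for c
    unfolding all_points_def triple_def using colors_disjoint
    by (auto simp: disjoint_iff Ball_def)
  moreover have "triple T a b d \<in> carrier (int_vectors (all_points T))" for a b d
    unfolding int_vectors_simps triple_def by simp
  ultimately show ?thesis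
    unfolding phi_related_def white_equiv_def boundary_def[symmetric] by simp
qed

lemma phi_related_total:
  assumes "x \<in> carrier (Div0 (D_V T))"
  shows "\<exists>y. phi_related T x y"
proof -
  have V: "violet T \<in> colors" and R: "red T \<in> colors" "red T \<noteq> violet T" and E: "emerald T \<in> colors" using colors_distinct by auto
  have x0: "(\<Sum>p\<in>violet T. x p) = 0" using assms unfolding Div0_D by blast
  obtain c where c: "\<And>p. p \<in> violet T \<Longrightarrow> boundary c p = x p" "\<And>p. p \<in> red T \<Longrightarrow> boundary c p = 0"
    using degree_zero_is_boundary[OF V R x0] by blast
  \<comment> \<open>each triangle has one node of each color, so a boundary has the same degree on all three classes\<close>
  have "(\<Sum>p\<in>emerald T. boundary c p) = 0"
    unfolding boundary_total[OF E] boundary_total[OF R(1), symmetric] using c(2) by simp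
  then have "phi_related T x (restrict (boundary c) (emerald T))"
    unfolding phi_related_iff Div0_D(2) using assms c by auto
  then show ?thesis by blast
qed

lemma phi_related_onto:
  assumes "y \<in> carrier (Div0 (D_E T))"
  shows "\<exists>x. phi_related T x y"
proof -
  have V: "violet T \<in> colors" and R: "red T \<in> colors" "red T \<noteq> emerald T" and E: "emerald T \<in> colors" using colors_distinct by auto
  have y0: "(\<Sum>p\<in>emerald T. y p) = 0" using assms unfolding Div0_D by blast
  obtain c where c: "\<And>p. p \<in> emerald T \<Longrightarrow> boundary c p = y p" "\<And>p. p \<in> red T \<Longrightarrow> boundary c p = 0"
    using degree_zero_is_boundary[OF E R y0] by blast
  have "(\<Sum>p\<in>violet T. boundary c p) = 0"
    unfolding boundary_total[OF V] boundary_total[OF R(1), symmetric] using c(2) by simp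
  then have "phi_related T (restrict (boundary c) (violet T)) y"
    unfolding phi_related_iff Div0_D(1) using assms c by auto
  then show ?thesis by blast
qed

lemma phi_related_mult:
  assumes "phi_related T x y" "phi_related T x' y'"
  shows "phi_related T (x \<otimes>\<^bsub>Div0 (D_V T)\<^esub> x') (y \<otimes>\<^bsub>Div0 (D_E T)\<^esub> y')"
proof -
  interpret V: comm_group "Div0 (D_V T)" by (rule Div0_comm_group)
  interpret E: comm_group "Div0 (D_E T)" by (rule Div0_comm_group)
  obtain c where c: "\<forall>p\<in>violet T. boundary c p = x p" "\<forall>p\<in>emerald T. boundary c p = y p" "\<forall>p\<in>red T. boundary c p = 0"
    using assms(1) unfolding phi_related_iff by blast
  obtain c' where c': "\<forall>p\<in>violet T. boundary c' p = x' p" "\<forall>p\<in>emerald T. boundary c' p = y' p" "\<forall>p\<in>red T. boundary c' p = 0"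
    using assms(2) unfolding phi_related_iff by blast
  have v: "verts (D_V T) = violet T" "verts (D_E T) = emerald T" by (simp_all add: D_V_def D_E_def color_digraph_def)
  have "\<forall>p\<in>violet T. boundary (\<lambda>\<sigma>. c \<sigma> + c' \<sigma>) p = (x \<otimes>\<^bsub>Div0 (D_V T)\<^esub> x') p"
    "\<forall>p\<in>emerald T. boundary (\<lambda>\<sigma>. c \<sigma> + c' \<sigma>) p = (y \<otimes>\<^bsub>Div0 (D_E T)\<^esub> y') p"
    "\<forall>p\<in>red T. boundary (\<lambda>\<sigma>. c \<sigma> + c' \<sigma>) p = 0"
    using c c' by (simp_all add: boundary_add Div0_simps v)
  then show ?thesis
    using assms V.m_closed E.m_closed unfolding phi_related_iff by blast
qed

lemma phi_related_classes:
  assumes r: "phi_related T x y" "phi_related T x' y'"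
  shows "div_class (D_V T) x = div_class (D_V T) x' \<longleftrightarrow> div_class (D_E T) y = div_class (D_E T) y'"
proof -
  obtain c where c: "\<forall>p\<in>violet T. boundary c p = x p" "\<forall>p\<in>emerald T. boundary c p = y p" "\<forall>p\<in>red T. boundary c p = 0"
    using r(1) unfolding phi_related_iff by blast
  obtain c' where c': "\<forall>p\<in>violet T. boundary c' p = x' p" "\<forall>p\<in>emerald T. boundary c' p = y' p" "\<forall>p\<in>red T. boundary c' p = 0"
    using r(2) unfolding phi_related_iff by blast
  have x: "x \<in> carrier (Div0 (D_V T))" "x' \<in> carrier (Div0 (D_V T))" and y: "y \<in> carrier (Div0 (D_E T))" "y' \<in> carrier (Div0 (D_E T))"
    using r unfolding phi_related_iff by blast+
  define d where "d = (\<lambda>\<sigma>. c' \<sigma> - c \<sigma>)"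
  have d: "p \<in> violet T \<Longrightarrow> boundary d p = x' p - x p" "p \<in> emerald T \<Longrightarrow> boundary d p = y' p - y p" "p \<in> red T \<Longrightarrow> boundary d p = 0" for p
    using c c' unfolding d_def boundary_diff by auto
  have V: "violet T \<in> colors" and E: "emerald T \<in> colors" by auto
  have zero: "boundary d p = 0" if "X \<in> colors" "X \<noteq> violet T" "X \<noteq> emerald T" "p \<in> X" for X p
    using that d(3) by blast
  have v: "verts (D_V T) = violet T" "verts (D_E T) = emerald T" by (simp_all add: D_V_def D_E_def color_digraph_def)
  show ?thesis
    unfolding div_class_eq_iff[OF x] div_class_eq_iff[OF y] v
  proof
    assume "\<exists>z. \<forall>w\<in>violet T. x' w - x w = laplacian_mult (D_V T) z w"
    then obtain z where z: "\<And>p. p \<in> violet T \<Longrightarrow> boundary d p = laplacian_mult (color_digraph T (violet T)) z p"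
      using d(1) unfolding D_V_def by metis
    show "\<exists>z. \<forall>w\<in>emerald T. y' w - y w = laplacian_mult (D_E T) z w"
    proof -
      obtain z' where "\<And>p. p \<in> emerald T \<Longrightarrow> boundary d p = laplacian_mult (color_digraph T (emerald T)) z' p"
        using laplacian_transfer[OF V E colors_distinct(2)[symmetric], of d z] z zero by blast
      then show ?thesis using d(2) unfolding D_E_def by metis
    qed
  next
    assume "\<exists>z. \<forall>w\<in>emerald T. y' w - y w = laplacian_mult (D_E T) z w"
    then obtain z where z: "\<And>p. p \<in> emerald T \<Longrightarrow> boundary d p = laplacian_mult (color_digraph T (emerald T)) z p"
      using d(2) unfolding D_E_def by metis
    show "\<exists>z. \<forall>w\<in>violet T. x' w - x w = laplacian_mult (D_V T) z w"
    proof -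
      obtain z' where "\<And>p. p \<in> violet T \<Longrightarrow> boundary d p = laplacian_mult (color_digraph T (violet T)) z' p"
        using laplacian_transfer[OF E V colors_distinct(2), of d z] z zero by blast
      then show ?thesis using d(1) unfolding D_V_def by metis
    qed
  qed
qed

lemma phi_div_class:
  assumes "phi_related T x y"
  shows "phi T (div_class (D_V T) x) = div_class (D_E T) y"
  unfolding phi_def
proof (rule the_equality)
  show "\<exists>x' y'. phi_related T x' y' \<and> div_class (D_V T) x = div_class (D_V T) x' \<and> div_class (D_E T) y = div_class (D_E T) y'"
    using assms by blast
  show "Y = div_class (D_E T) y" if "\<exists>x' y'. phi_related T x' y' \<and> div_class (D_V T) x = div_class (D_V T) x' \<and> Y = div_class (D_E T) y'" for Y
    using that phi_related_classes[OF assms] by metis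
qed

lemma phi_iso: "phi T \<in> iso (Pic0 (D_V T)) (Pic0 (D_E T))"
  unfolding Pic0_def
proof (rule relation_induces_iso[where R = "phi_related T"])
  show "div_class (D_V T) \<one>\<^bsub>Div0 (D_V T)\<^esub> \<lhd> Div0 (D_V T)" "div_class (D_E T) \<one>\<^bsub>Div0 (D_E T)\<^esub> \<lhd> Div0 (D_E T)"
    by (intro comm_group.subgroup_imp_normal Div0_comm_group div_class_one_subgroup)+
  show dom: "x \<in> carrier (Div0 (D_V T)) \<and> y \<in> carrier (Div0 (D_E T))" if "phi_related T x y" for x y
    using that unfolding phi_related_iff by blast
  show "div_class (D_V T) \<one>\<^bsub>Div0 (D_V T)\<^esub> #>\<^bsub>Div0 (D_V T)\<^esub> x = div_class (D_V T) \<one>\<^bsub>Div0 (D_V T)\<^esub> #>\<^bsub>Div0 (D_V T)\<^esub> x' \<longleftrightarrow>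
    div_class (D_E T) \<one>\<^bsub>Div0 (D_E T)\<^esub> #>\<^bsub>Div0 (D_E T)\<^esub> y = div_class (D_E T) \<one>\<^bsub>Div0 (D_E T)\<^esub> #>\<^bsub>Div0 (D_E T)\<^esub> y'"
    if r: "phi_related T x y" "phi_related T x' y'" for x y x' y'
    using phi_related_classes[OF r] dom[OF r(1)] dom[OF r(2)] by (simp add: div_class_eq_coset)
  show "phi T (div_class (D_V T) \<one>\<^bsub>Div0 (D_V T)\<^esub> #>\<^bsub>Div0 (D_V T)\<^esub> x) = div_class (D_E T) \<one>\<^bsub>Div0 (D_E T)\<^esub> #>\<^bsub>Div0 (D_E T)\<^esub> y"
    if r: "phi_related T x y" for x y
    using phi_div_class[OF r] dom[OF r] by (simp add: div_class_eq_coset)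
qed (use phi_related_total phi_related_onto phi_related_mult in blast)+

end

theorem theorem3p6:
  fixes T :: trinity_data
  assumes "trinity T"
  shows "(\<forall>x \<in> carrier (Div0 (D_V T)). \<exists>y. phi_related T x y) \<and>
    (\<forall>x x' y y'. phi_related T x y \<longrightarrow> phi_related T x' y' \<longrightarrow>
       div_class (D_V T) x = div_class (D_V T) x' \<longrightarrow>
       div_class (D_E T) y = div_class (D_E T) y') \<and>
    phi T \<in> iso (Pic0 (D_V T)) (Pic0 (D_E T))"
proof -
  interpret trinity_complex T by standard (rule assms)
  show ?thesis using phi_related_total phi_related_classes phi_iso by blast
qed

end
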